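(* Let $\mathcal{T}$ be a self-affine tiling of $\mathbb{R}^d$ with expansion map $Q$ and a primitive substitution rule $\omega$ with finite local complexity. Suppose there exist a tile $T_0\in\mathcal{T}$ and a lattice $L$ of $\mathbb{R}^d$ such that $\{T_0+v: v\in L\}\subset\mathcal{T}$ and $Q(L)\subset L$. Then the tiling dynamical system $(X_{\mathcal{T}},\mu,\mathbb{R}^d)$ has pure discrete spectrum.
   Context: A tile in $\mathbb{R}^d$ is a compact set equal to the closure of its interior, possibly carrying a label from a fixed finite set; $T+x$ is its translate. A patch is a set of tiles any two distinct members of which have disjoint interiors; its support is the closure of the union of the supports; a tiling is a patch with support $\mathbb{R}^d$. For a patch $\mathcal{P}$ and $S\subset\mathbb{R}^d$, $\mathcal{P}\sqcap S=\{T\in\mathcal{P}:\operatorname{supp}T\cap S\neq\emptyset\}$. A tiling has finite local complexity (FLC) if for each compact $K$ the set $\{\mathcal{T}\sqcap(K+x)\}_x$ is finite up to translation; it is repetitive if for every finite patch $\mathcal{P}$ with $\mathcal{P}+y\subset\mathcal{T}$ for some $y$ there is $R>0$ such that every ball of radius $R$ contains the support of some translate $\mathcal{P}+x\subset\mathcal{T}$. A substitution rule consists of a finite set $\mathcal{A}$ of prototiles, a linear expansion map $Q$ (all eigenvalues of modulus $>1$) and a map $\omega$ assigning to each $P\in\mathcal{A}$ a finite patch of translates of prototiles with $\operatorname{supp}\omega(P)=Q(\operatorname{supp}P)$, extended by $\omega(P+x)=\omega(P)+Qx$ and unions; it is primitive if some power of its substitution matrix (entry $(i,j)$ = number of translates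 of the $i$-th prototile in $\omega$ of the $j$-th) is positive, and has FLC if for each compact $K$ the set $\{\omega^n(P)\sqcap(K+x)\}_{n>0,P,x}$ is finite up to translation. A self-affine tiling for $\omega$ is a tiling $\mathcal{T}$ of translates of prototiles with $\omega(\mathcal{T})=\mathcal{T}$, having FLC and being repetitive. The hull $X_{\mathcal{T}}$ is the closure of $\{\mathcal{T}+x:x\in\mathbb{R}^d\}$ in the local matching topology (patches are close if, after translating each by a small vector, they agree on a large ball around the origin); $\mathbb{R}^d$ acts on it by translation, and $\mu$ is its unique translation-invariant Borel probability measure. A vector $a$ is an eigenvalue if there is a nonzero $f\in L^2(\mu)$ with $f(\mathcal{S}-x)=e^{2\pi i\langle x,a\rangle}f(\mathcal{S})$ for $\mu$-a.e. $\mathcal{S}$, for each $x$; the system has pure discrete spectrum if $L^2(\mu)$ has an orthonormal basis of eigenfunctions. *)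

theory Defs
  imports "HOL-Analysis.Analysis" "HOL-Probability.Probability"
begin

text \<open>Tiles in R^d (d = CARD('n)): a pair (support, label).\<close>
type_synonym ('n, 'l) tile = "(real^'n) set \<times> 'l"
type_synonym ('n, 'l) patch = "('n, 'l) tile set"

definition supp :: "('n::finite, 'l) tile \<Rightarrow> (real^'n) set" where
  "supp T = fst T"

definition is_tile :: "('n::finite, 'l) tile \<Rightarrow> bool" where
  "is_tile T \<longleftrightarrow> compact (supp T) \<and> supp T = closure (interior (supp T))"

definition tr :: "('n::finite, 'l) tile \<Rightarrow> real^'n \<Rightarrow> ('n, 'l) tile" where
  "tr T x = ((\<lambda>y. y + x) ` fst T, snd T)"

definition tr_patch :: "('n::finite, 'l) patch \<Rightarrow> real^'n \<Rightarrow> ('n, 'l) patch" where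
  "tr_patch P x = (\<lambda>T. tr T x) ` P"

definition is_patch :: "('n::finite, 'l) patch \<Rightarrow> bool" where
  "is_patch P \<longleftrightarrow> (\<forall>T\<in>P. is_tile T) \<and>
     (\<forall>T\<in>P. \<forall>T'\<in>P. T \<noteq> T' \<longrightarrow> interior (supp T) \<inter> interior (supp T') = {})"

definition patch_supp :: "('n::finite, 'l) patch \<Rightarrow> (real^'n) set" where
  "patch_supp P = closure (\<Union>T\<in>P. supp T)"

definition is_tiling :: "('n::finite, 'l) patch \<Rightarrow> bool" where
  "is_tiling P \<longleftrightarrow> is_patch P \<and> patch_supp P = UNIV"

definition patch_meet :: "('n::finite, 'l) patch \<Rightarrow> (real^'n) set \<Rightarrow> ('n, 'l) patch" where
  "patch_meet P S = {T \<in> P. supp T \<inter> S \<noteq> {}}"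

definition fin_up_to_tr :: "('n::finite, 'l) patch set \<Rightarrow> bool" where
  "fin_up_to_tr Ps \<longleftrightarrow> (\<exists>F. finite F \<and> (\<forall>P\<in>Ps. \<exists>F0\<in>F. \<exists>y. P = tr_patch F0 y))"

definition FLC_tiling :: "('n::finite, 'l) patch \<Rightarrow> bool" where
  "FLC_tiling Tl \<longleftrightarrow>
     (\<forall>K. compact K \<longrightarrow> fin_up_to_tr {patch_meet Tl ((\<lambda>y. y + x) ` K) | x. True})"

definition repetitive :: "('n::finite, 'l) patch \<Rightarrow> bool" where
  "repetitive Tl \<longleftrightarrow>
     (\<forall>P. finite P \<and> (\<exists>y. tr_patch P y \<subseteq> Tl) \<longrightarrow>
        (\<exists>R>0. \<forall>c. \<exists>x. tr_patch P x \<subseteq> Tl \<and> patch_supp (tr_patch P x) \<subseteq> ball c R))"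

definition complexify :: "real^'n^'n \<Rightarrow> complex^'n^'n" where
  "complexify M = (\<chi> i j. complex_of_real (M $ i $ j))"

definition expansive :: "(real^'n::finite \<Rightarrow> real^'n) \<Rightarrow> bool" where
  "expansive Q \<longleftrightarrow> linear Q \<and>
     (\<forall>z::complex. det (complexify (matrix Q) - mat z) = 0 \<longrightarrow> cmod z > 1)"

text \<open>Substitution rule (A, Q, \<omega>).  The last condition says that the extension
  \<omega>(P + x) = \<omega>(P) + Qx is well defined.\<close>
definition subst_rule ::
  "('n::finite, 'l) tile set \<Rightarrow> (real^'n \<Rightarrow> real^'n) \<Rightarrow> (('n, 'l) tile \<Rightarrow> ('n, 'l) patch) \<Rightarrow> bool" where
  "subst_rule A Q \<omega> \<longleftrightarrow> finite A \<and> (\<forall>P\<in>A. is_tile P) \<and> expansive Q \<and>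
     (\<forall>P\<in>A. finite (\<omega> P) \<and> is_patch (\<omega> P) \<and>
        (\<forall>T\<in>\<omega> P. \<exists>P'\<in>A. \<exists>x. T = tr P' x) \<and>
        patch_supp (\<omega> P) = Q ` supp P) \<and>
     (\<forall>P\<in>A. \<forall>P'\<in>A. \<forall>y. P' = tr P y \<longrightarrow> \<omega> P' = tr_patch (\<omega> P) (Q y))"

definition subst_tile ::
  "('n::finite, 'l) tile set \<Rightarrow> (real^'n \<Rightarrow> real^'n) \<Rightarrow> (('n, 'l) tile \<Rightarrow> ('n, 'l) patch)
     \<Rightarrow> ('n, 'l) tile \<Rightarrow> ('n, 'l) patch" where
  "subst_tile A Q \<omega> T = (\<Union>P\<in>A. \<Union>x\<in>{x. T = tr P x}. tr_patch (\<omega> P) (Q x))"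

definition subst_patch ::
  "('n::finite, 'l) tile set \<Rightarrow> (real^'n \<Rightarrow> real^'n) \<Rightarrow> (('n, 'l) tile \<Rightarrow> ('n, 'l) patch)
     \<Rightarrow> ('n, 'l) patch \<Rightarrow> ('n, 'l) patch" where
  "subst_patch A Q \<omega> P = (\<Union>T\<in>P. subst_tile A Q \<omega> T)"

definition subst_matrix ::
  "('n::finite, 'l) tile set \<Rightarrow> (('n, 'l) tile \<Rightarrow> ('n, 'l) patch) \<Rightarrow> ('n, 'l) tile \<Rightarrow> ('n, 'l) tile \<Rightarrow> nat" where
  "subst_matrix A \<omega> P P' = card {T \<in> \<omega> P'. \<exists>x. T = tr P x}"

fun mat_pow :: "'a set \<Rightarrow> ('a \<Rightarrow> 'a \<Rightarrow> nat) \<Rightarrow> nat \<Rightarrow> 'a \<Rightarrow> 'a \<Rightarrow> nat" where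
  "mat_pow I M 0 = (\<lambda>i j. if i = j then 1 else 0)"
| "mat_pow I M (Suc k) = (\<lambda>i j. \<Sum>l\<in>I. M i l * mat_pow I M k l j)"

definition primitive_subst ::
  "('n::finite, 'l) tile set \<Rightarrow> (('n, 'l) tile \<Rightarrow> ('n, 'l) patch) \<Rightarrow> bool" where
  "primitive_subst A \<omega> \<longleftrightarrow>
     (\<exists>k>0. \<forall>P\<in>A. \<forall>P'\<in>A. mat_pow A (subst_matrix A \<omega>) k P P' > 0)"

definition FLC_subst ::
  "('n::finite, 'l) tile set \<Rightarrow> (real^'n \<Rightarrow> real^'n) \<Rightarrow> (('n, 'l) tile \<Rightarrow> ('n, 'l) patch) \<Rightarrow> bool" where
  "FLC_subst A Q \<omega> \<longleftrightarrow>
     (\<forall>K. compact K \<longrightarrow> fin_up_to_tr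
        {patch_meet ((subst_patch A Q \<omega> ^^ n) {P}) ((\<lambda>y. y + x) ` K) | n P x. n > 0 \<and> P \<in> A})"

definition self_affine_tiling ::
  "('n::finite, 'l) tile set \<Rightarrow> (real^'n \<Rightarrow> real^'n) \<Rightarrow> (('n, 'l) tile \<Rightarrow> ('n, 'l) patch)
     \<Rightarrow> ('n, 'l) patch \<Rightarrow> bool" where
  "self_affine_tiling A Q \<omega> Tl \<longleftrightarrow> is_tiling Tl \<and> (\<forall>T\<in>Tl. \<exists>P\<in>A. \<exists>x. T = tr P x) \<and>
     subst_patch A Q \<omega> Tl = Tl \<and> FLC_tiling Tl \<and> repetitive Tl"

definition lattice :: "(real^'n::finite) set \<Rightarrow> bool" where
  "lattice L \<longleftrightarrow> (\<exists>B::real^'n^'n. invertible B \<and> L = {B *v k | k. \<forall>i. k $ i \<in> \<int>})"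

definition lm_nbhd :: "real \<Rightarrow> real \<Rightarrow> ('n::finite, 'l) patch \<Rightarrow> ('n, 'l) patch set" where
  "lm_nbhd R \<epsilon> S = {S'. \<exists>u v. norm u < \<epsilon> \<and> norm v < \<epsilon> \<and>
      patch_meet (tr_patch S' u) (ball 0 R) = patch_meet (tr_patch S v) (ball 0 R)}"

definition lm_open :: "('n::finite, 'l) patch set \<Rightarrow> bool" where
  "lm_open U \<longleftrightarrow> (\<forall>S\<in>U. \<exists>R>0. \<exists>\<epsilon>>0. lm_nbhd R \<epsilon> S \<subseteq> U)"

definition lm_topology :: "('n::finite, 'l) patch topology" where
  "lm_topology = topology lm_open"

definition tiling_hull :: "('n::finite, 'l) patch \<Rightarrow> ('n, 'l) patch set" where
  "tiling_hull Tl = lm_topology closure_of (range (tr_patch Tl))"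

definition borel_of :: "'a topology \<Rightarrow> 'a measure" where
  "borel_of T = sigma (topspace T) {U. openin T U}"

definition invariant_hull_measure :: "('n::finite, 'l) patch \<Rightarrow> ('n, 'l) patch measure \<Rightarrow> bool" where
  "invariant_hull_measure Tl \<mu> \<longleftrightarrow> prob_space \<mu> \<and>
     space \<mu> = tiling_hull Tl \<and>
     sets \<mu> = sets (borel_of (subtopology lm_topology (tiling_hull Tl))) \<and>
     (\<forall>x. (\<lambda>S. tr_patch S x) \<in> \<mu> \<rightarrow>\<^sub>M \<mu> \<and> distr \<mu> \<mu> (\<lambda>S. tr_patch S x) = \<mu>)"

definition L2 :: "'a measure \<Rightarrow> ('a \<Rightarrow> complex) \<Rightarrow> bool" where
  "L2 \<mu> f \<longleftrightarrow> f \<in> borel_measurable \<mu> \<and> integrable \<mu> (\<lambda>S. (cmod (f S))\<^sup>2)"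

definition L2_inner :: "'a measure \<Rightarrow> ('a \<Rightarrow> complex) \<Rightarrow> ('a \<Rightarrow> complex) \<Rightarrow> complex" where
  "L2_inner \<mu> f g = (LINT S|\<mu>. f S * cnj (g S))"

definition eigenfunction ::
  "('n::finite, 'l) patch measure \<Rightarrow> real^'n \<Rightarrow> (('n, 'l) patch \<Rightarrow> complex) \<Rightarrow> bool" where
  "eigenfunction \<mu> a f \<longleftrightarrow> L2 \<mu> f \<and> \<not> (AE S in \<mu>. f S = 0) \<and>
     (\<forall>x. AE S in \<mu>. f (tr_patch S (- x)) = exp (\<i> * complex_of_real (2 * pi * (x \<bullet> a))) * f S)"

text \<open>Pure discrete spectrum: L^2(\<mu>) has an orthonormal basis (maximal orthonormal
  family) consisting of eigenfunctions.\<close>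
definition pure_discrete_spectrum :: "('n::finite, 'l) patch measure \<Rightarrow> bool" where
  "pure_discrete_spectrum \<mu> \<longleftrightarrow> (\<exists>B.
     (\<forall>f\<in>B. \<exists>a. eigenfunction \<mu> a f) \<and>
     (\<forall>f\<in>B. L2_inner \<mu> f f = 1) \<and>
     (\<forall>f\<in>B. \<forall>g\<in>B. f \<noteq> g \<longrightarrow> L2_inner \<mu> f g = 0) \<and>
     (\<forall>g. L2 \<mu> g \<and> (\<forall>f\<in>B. L2_inner \<mu> g f = 0) \<longrightarrow> (AE S in \<mu>. g S = 0)))"

end

theory Submission
  imports Defs "HOL-Computational_Algebra.Fundamental_Theorem_Algebra"
begin

text \<open>Since \<open>Q L \<subseteq> L\<close>, every tile of \<open>T0 + L\<close> is \<open>Q^n L\<close>-periodic in the tiling for all \<open>n\<close>, and hence so is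
  every tile of \<open>\<omega>^i (T0 + u)\<close> for \<open>u \<in> L\<close> and \<open>i \<le> n\<close>. Rescaled by \<open>Q^-n\<close>, the region covered by these tiles is
  the union of the sets \<open>Q^-i (supp T0 + L)\<close>, \<open>i \<le> n\<close>. All of them have the same positive density and, \<open>Q\<close> being
  expansive, they equidistribute, so they exhaust space up to a null set: the tiling is limit-periodic.

  By compactness modulo \<open>Q^n L\<close> the periodic part reappears in every element of the hull, and Fubini
  over a fundamental domain shows that for every invariant measure the event "a given tile occurs near a given
  position" is, up to a set whose measure tends to 0, the \<open>Q^n L\<close>-invariant event "it occurs there periodically".
  Finite intersections of the former events generate the Borel sets of the hull. An indicator of a \<open>Q^n L\<close>-invariant
  event moves under translation through a torus, and its Fourier coefficients along the orbits are eigenfunctions.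
  A function orthogonal to all these countably many eigenfunctions integrates to 0 over all invariant events, hence over
  all Borel sets. Gram-Schmidt turns the family into an orthonormal basis of eigenfunctions.\<close>

section \<open>Lattice-periodic functions and the unit cube\<close>

text \<open>One probability measure serves all period lattices: \<open>BQ n\<close> carries
  \<open>Zvec\<close> onto \<open>Q^n L\<close>, so the unit cube is a common chart of the
  fundamental domains. In this chart level i of the substitution appears as the set of x with
  \<open>Q^j (B x)\<close> in the support of \<open>T0 + L\<close>, where j = n - i. The reversal of
  exponents turns growing supertiles into shrinking copies of a fixed set, and the uncovered parts
  decrease as n grows. Two obstacles shape the rest. A periodic event involves infinitely many
  tiles, so the local topology does not make it open; it is open along orbits, and the continuity
  argument for Fourier coefficients is built on that alone. Gram-Schmidt mixes functions of
  different frequencies; eigenfunctions that satisfy their equation at every point make the cross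
  terms vanish exactly. Finite local complexity enters as rigidity: two nearby copies of a finite
  configuration differ by one common translation, so events about single tiles determine the local
  matching topology.\<close>

lemma linear_borel_measurable:
  fixes f :: "'a::euclidean_space \<Rightarrow> 'b::euclidean_space"
  assumes "linear f"
  shows "f \<in> borel_measurable borel"
proof -
  have "bounded_linear f" using assms by (simp add: linear_conv_bounded_linear)
  then show ?thesis by (intro borel_measurable_continuous_onI linear_continuous_on)
qed

definition Zvec :: "(real^'n::finite) set" where
  "Zvec = {k. \<forall>i. k $ i \<in> \<int>}"

text \<open>Half-open, so that the integer translates partition space without overlap; centred at
  the origin, so that small balls about 0 lie inside.\<close>

definition unit_cube :: "(real^'n::finite) set" where
  "unit_cube = {x. \<forall>i. - 1/2 \<le> x $ i \<and> x $ i < 1/2}"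

text \<open>Haar measure of the torus R^n / Z^n, carried by the cube but defined on the Borel sets
  of the whole space, so that periodic functions are integrated without being restricted.\<close>

definition cube_measure :: "(real^'n::finite) measure" where
  "cube_measure = density lborel (indicator unit_cube)"

lemma Zvec_add: "k \<in> Zvec \<Longrightarrow> l \<in> Zvec \<Longrightarrow> k + l \<in> Zvec"
  and Zvec_uminus: "k \<in> Zvec \<Longrightarrow> - k \<in> Zvec"
  and zero_Zvec: "0 \<in> Zvec"
  by (auto simp: Zvec_def)

lemma countable_Zvec: "countable (Zvec :: (real^'n::finite) set)"
proof -
  have "countable (vec_nth ` (Zvec :: (real^'n::finite) set))"
  proof (rule countable_subset)
    show "vec_nth ` Zvec \<subseteq> PiE UNIV (\<lambda>_::'n. \<int>)" by (auto simp: Zvec_def)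
    show "countable (PiE UNIV (\<lambda>_::'n. \<int>::real set))"
      by (intro countable_PiE) (auto simp: Ints_def)
  qed
  then show ?thesis
    by (rule countable_image_inj_on) (auto simp: inj_on_def vec_eq_iff)
qed

lemma unit_cube_borel [measurable]: "unit_cube \<in> sets borel"
proof -
  have "unit_cube = {x\<in>space borel. \<forall>i::'n. - 1/2 \<le> (x::real^'n) $ i \<and> x $ i < 1/2}"
    by (simp add: unit_cube_def)
  also have "\<dots> \<in> sets borel" by measurable
  finally show ?thesis .
qed

lemma bounded_unit_cube: "bounded (unit_cube :: (real^'n::finite) set)"
proof (rule boundedI)
  fix x :: "real^'n" assume x: "x \<in> unit_cube"
  have "\<bar>x $ i\<bar> \<le> 1" for i
    using x unfolding unit_cube_def by (smt (verit) mem_Collect_eq divide_minus_left half_bounded_equal)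
  then have "(\<Sum>i\<in>UNIV. \<bar>x $ i\<bar>) \<le> (\<Sum>i\<in>(UNIV::'n set). 1)" by (intro sum_mono) auto
  then show "norm x \<le> real CARD('n)" using norm_le_l1_cart[of x] by simp
qed

lemma emeasure_unit_cube: "emeasure lborel (unit_cube :: (real^'n::finite) set) = 1"
proof (rule antisym)
  define h where "h = ((\<chi> i. 1/2) :: real^'n)"
  have h: "h \<bullet> b = 1/2" if "b \<in> Basis" for b
    using that by (auto simp: h_def Basis_vec_def inner_axis)
  have h_nth: "h $ i = 1/2" for i by (simp add: h_def)
  have h2: "(h - - h) \<bullet> b = 1" if "b \<in> Basis" for b
    unfolding inner_diff_left inner_minus_left using h[OF that] by simp
  then have p: "(\<Prod>b\<in>Basis. (h - - h) \<bullet> b) = 1" by (rule prod.neutral[OF ballI])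
  have le: "\<forall>b\<in>Basis. (- h) \<bullet> b \<le> h \<bullet> b"
    unfolding inner_minus_left by (simp add: h)
  have box: "emeasure lborel (cbox (-h) h) = 1" "emeasure lborel (box (-h) h) = 1"
    using p le unfolding emeasure_lborel_cbox_eq emeasure_lborel_box_eq by (simp_all only: if_P ennreal_1)
  have "emeasure lborel (unit_cube :: (real^'n) set) \<le> emeasure lborel (cbox (-h) h)"
    by (rule emeasure_mono) (auto simp: unit_cube_def mem_box_cart h_nth less_imp_le)
  then show "emeasure lborel (unit_cube :: (real^'n) set) \<le> 1" using box by simp
  have "emeasure lborel (box (-h) h) \<le> emeasure lborel (unit_cube :: (real^'n) set)"
    by (rule emeasure_mono) (auto simp: unit_cube_def mem_box_cart h_nth less_imp_le)
  then show "1 \<le> emeasure lborel (unit_cube :: (real^'n) set)" using box by simp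
qed

lemma sets_cube_measure [measurable_cong, simp]: "sets cube_measure = sets borel"
  and space_cube_measure [simp]: "space cube_measure = UNIV"
  by (auto simp: cube_measure_def)

lemma emeasure_cube_measure:
  "X \<in> sets borel \<Longrightarrow> emeasure cube_measure X = emeasure lborel (unit_cube \<inter> X)"
  unfolding cube_measure_def
  by (subst emeasure_density) (auto simp: nn_integral_indicator indicator_inter_arith[symmetric])

lemma prob_space_cube_measure: "prob_space cube_measure"
  by standard (simp add: emeasure_cube_measure emeasure_unit_cube)

lemma nn_integral_cube_measure:
  assumes [measurable]: "F \<in> borel_measurable borel"
  shows "(\<integral>\<^sup>+x. F x \<partial>cube_measure) = (\<integral>\<^sup>+x. F x * indicator unit_cube x \<partial>lborel)"
  unfolding cube_measure_def by (subst nn_integral_density) (auto simp: mult.commute)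

text \<open>Rounding each coordinate, with ties upward to match the half-open cube, is the only way
  to reach the cube by an integer translation.\<close>

lemma nearest_Zvec:
  "x - k \<in> unit_cube \<and> k \<in> Zvec \<longleftrightarrow> k = (\<chi> i. real_of_int \<lfloor>x $ i + 1/2\<rfloor>)"
proof
  assume "x - k \<in> unit_cube \<and> k \<in> Zvec"
  then have *: "- 1/2 \<le> x $ i - k $ i" "x $ i - k $ i < 1/2" "k $ i \<in> \<int>" for i
    by (auto simp: unit_cube_def Zvec_def)
  have "k $ i = of_int \<lfloor>x $ i + 1/2\<rfloor>" for i
  proof -
    obtain z where z: "k $ i = of_int z" using *(3) Ints_cases by blast
    have "\<lfloor>x $ i + 1/2\<rfloor> = z" using *(1,2)[of i] unfolding z by linarith
    then show ?thesis using z by simp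
  qed
  then show "k = (\<chi> i. of_int \<lfloor>x $ i + 1/2\<rfloor>)" by (simp add: vec_eq_iff)
next
  assume k: "k = (\<chi> i. of_int \<lfloor>x $ i + 1/2\<rfloor>)"
  show "x - k \<in> unit_cube \<and> k \<in> Zvec"
    unfolding k unit_cube_def Zvec_def by (auto; linarith)
qed

text \<open>A partition of unity by integer translates of the cube; inserting this factor 1 moves an
  integral from one fundamental domain to another.\<close>

lemma nn_integral_count_Zvec_cube:
  "(\<integral>\<^sup>+k. indicator unit_cube (x - k) \<partial>count_space Zvec) = (1::ennreal)"
proof -
  define k0 where "k0 = (\<chi> i. real_of_int \<lfloor>x $ i + 1/2\<rfloor>)"
  have k0: "x - k \<in> unit_cube \<and> k \<in> Zvec \<longleftrightarrow> k = k0" for k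
    using nearest_Zvec[of x k] by (simp add: k0_def)
  have "(\<integral>\<^sup>+k. indicator unit_cube (x - k) \<partial>count_space Zvec)
      = (\<integral>\<^sup>+k. indicator {k0} k \<partial>count_space Zvec)"
    using k0 by (intro nn_integral_cong) (auto simp: indicator_def)
  also have "\<dots> = 1"
    using k0[of k0] by (subst nn_integral_indicator) auto
  finally show ?thesis .
qed

lemma nn_integral_lborel_shift:
  fixes F :: "'a::euclidean_space \<Rightarrow> ennreal"
  assumes [measurable]: "F \<in> borel_measurable borel"
  shows "(\<integral>\<^sup>+x. F (x + z) \<partial>lborel) = (\<integral>\<^sup>+x. F x \<partial>lborel)"
proof -
  have "(\<integral>\<^sup>+x. F x \<partial>lborel) = (\<integral>\<^sup>+x. F x \<partial>distr lborel borel ((+) z))"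
    by (simp add: lborel_distr_plus)
  also have "\<dots> = (\<integral>\<^sup>+x. F (x + z) \<partial>lborel)"
    by (subst nn_integral_distr) (auto simp: add.commute)
  finally show ?thesis by simp
qed

text \<open>The cube and its translate by \<open>z\<close> are both fundamental domains. The
  integral over the one is cut along integer translates of the other, each piece is moved by some
  \<open>k\<close>, which \<open>F\<close> does not notice, and the pieces are reassembled.\<close>

lemma nn_integral_cube_shift:
  assumes [measurable]: "F \<in> borel_measurable borel"
    and per: "\<And>x k. k \<in> Zvec \<Longrightarrow> F (x + k) = F x"
  shows "(\<integral>\<^sup>+x. F (x + z) \<partial>cube_measure) = (\<integral>\<^sup>+x. F x \<partial>cube_measure)"
proof -
  let ?c = "indicator unit_cube :: real^'a \<Rightarrow> ennreal"
  have "(\<integral>\<^sup>+x. F (x + z) \<partial>cube_measure) = (\<integral>\<^sup>+x. F (x + z) * ?c x \<partial>lborel)"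
    by (rule nn_integral_cube_measure) measurable
  also have "\<dots> = (\<integral>\<^sup>+x. F x * ?c (x - z) \<partial>lborel)"
    by (subst nn_integral_lborel_shift[where z=z and F="\<lambda>x. F x * ?c (x - z)", symmetric]) auto
  also have "\<dots> = (\<integral>\<^sup>+x. \<integral>\<^sup>+k. F x * ?c (x - z) * ?c (x - k) \<partial>count_space Zvec \<partial>lborel)"
    by (subst nn_integral_cmult) (auto simp: nn_integral_count_Zvec_cube)
  also have "\<dots> = (\<integral>\<^sup>+k. \<integral>\<^sup>+x. F x * ?c (x - z) * ?c (x - k) \<partial>lborel \<partial>count_space Zvec)"
    by (rule nn_integral_count_space_nn_integral) (auto simp: countable_Zvec)
  also have "\<dots> = (\<integral>\<^sup>+k. \<integral>\<^sup>+x. F x * ?c x * ?c (x + k - z) \<partial>lborel \<partial>count_space Zvec)"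
  proof (rule nn_integral_cong)
    fix k assume "k \<in> space (count_space (Zvec :: (real^'a) set))"
    then show "(\<integral>\<^sup>+x. F x * ?c (x - z) * ?c (x - k) \<partial>lborel) = (\<integral>\<^sup>+x. F x * ?c x * ?c (x + k - z) \<partial>lborel)"
      by (subst nn_integral_lborel_shift[where z=k and F="\<lambda>x. F x * ?c (x - z) * ?c (x - k)", symmetric])
        (auto simp: per mult_ac)
  qed
  also have "\<dots> = (\<integral>\<^sup>+x. \<integral>\<^sup>+k. F x * ?c x * ?c (x + k - z) \<partial>count_space Zvec \<partial>lborel)"
    by (rule nn_integral_count_space_nn_integral[symmetric]) (auto simp: countable_Zvec)
  also have "\<dots> = (\<integral>\<^sup>+x. F x * ?c x * (\<integral>\<^sup>+k. ?c (x + k - z) \<partial>count_space Zvec) \<partial>lborel)"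
    by (subst nn_integral_cmult) auto
  also have "\<dots> = (\<integral>\<^sup>+x. F x * ?c x \<partial>lborel)"
  proof -
    have "(\<integral>\<^sup>+k. ?c (x + k - z) \<partial>count_space Zvec) = (\<integral>\<^sup>+k. ?c ((x - z) - k) \<partial>count_space Zvec)" for x
    proof -
      have "bij_betw uminus (Zvec :: (real^'a) set) Zvec"
        by (rule bij_betw_byWitness[where f'=uminus]) (auto simp: Zvec_uminus)
      from nn_integral_bij_count_space[OF this, of "\<lambda>k. ?c ((x - z) + k)"]
      show ?thesis by (simp add: algebra_simps)
    qed
    then show ?thesis by (simp add: nn_integral_count_Zvec_cube)
  qed
  also have "\<dots> = (\<integral>\<^sup>+x. F x \<partial>cube_measure)"
    by (rule nn_integral_cube_measure[symmetric]) measurable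
  finally show ?thesis .
qed

text \<open>Comparing the distributions of \<open>F\<close> and of its translate reduces the claim
  to indicators, hence to the nonnegative case, without splitting \<open>F\<close>.\<close>

lemma integral_cube_shift:
  fixes F :: "real^'n::finite \<Rightarrow> 'b::{banach, second_countable_topology}"
  assumes [measurable]: "F \<in> borel_measurable borel"
    and per: "\<And>x k. k \<in> Zvec \<Longrightarrow> F (x + k) = F x"
  shows "(LINT x|cube_measure. F (x + z)) = (LINT x|cube_measure. F x)"
proof -
  have "distr cube_measure borel F = distr cube_measure borel (\<lambda>x. F (x + z))"
  proof (rule measure_eqI)
    fix E assume "E \<in> sets (distr cube_measure borel F)"
    then have [measurable]: "E \<in> sets borel" by simp
    have *: "emeasure (distr cube_measure borel G) E = (\<integral>\<^sup>+x. indicator E (G x) \<partial>cube_measure)"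
      if [measurable]: "G \<in> borel_measurable borel" for G
      by (subst nn_integral_indicator[symmetric, of E "distr cube_measure borel G"], simp)
        (subst nn_integral_distr, auto)
    show "emeasure (distr cube_measure borel F) E
        = emeasure (distr cube_measure borel (\<lambda>x. F (x + z))) E"
      using nn_integral_cube_shift[of "\<lambda>x. indicator E (F x)" z] by (simp add: * per)
  qed simp
  then have "(LINT y|distr cube_measure borel F. y) = (LINT y|distr cube_measure borel (\<lambda>x. F (x + z)). y)"
    by simp
  then show ?thesis by (simp add: integral_distr)
qed

lemma emeasure_cube_ball_pos:
  assumes "e > 0"
  shows "emeasure cube_measure (ball (0 :: real^'n::finite) e) > 0"
proof -
  let ?S = "ball (0 :: real^'n) (min e (1/2))"
  have "?S \<subseteq> unit_cube"
  proof
    fix x assume "x \<in> ?S"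
    then have "norm x < 1/2" by simp
    then have "\<bar>x $ i\<bar> < 1/2" for i using component_le_norm_cart[of x i] by linarith
    then show "x \<in> unit_cube" unfolding unit_cube_def by (smt (verit) mem_Collect_eq minus_divide_left)
  qed
  then have "emeasure lborel ?S \<le> emeasure cube_measure (ball (0 :: real^'n) e)"
    by (subst emeasure_cube_measure) (auto intro!: emeasure_mono)
  moreover have "measure lborel ?S > 0" using assms by (simp add: content_ball_pos)
  then have "emeasure lborel ?S > 0" unfolding measure_def
    by (metis enn2real_0 less_irrefl zero_less_iff_neq_zero)
  ultimately show ?thesis by simp
qed

text \<open>The open part of \<open>W\<close> may lie far from the cube. Shift invariance recentres
  it: a ball around a point of \<open>U\<close> is moved to the origin, where the cube has room for
  it.\<close>

lemma periodic_open_cube_pos: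
  fixes W U :: "(real^'n::finite) set"
  assumes [measurable]: "W \<in> sets borel" and per: "\<And>x k. k \<in> Zvec \<Longrightarrow> x + k \<in> W \<longleftrightarrow> x \<in> W"
    and U: "open U" "U \<noteq> {}" "U \<subseteq> W"
  shows "emeasure lborel (unit_cube \<inter> W) > 0"
proof -
  obtain z e where z: "e > 0" "ball z e \<subseteq> U" using U(1,2) openE by blast
  have "emeasure cube_measure (ball (0 :: real^'n) e) = (\<integral>\<^sup>+x. indicator (ball (0 :: real^'n) e) x \<partial>cube_measure)"
    by simp
  also have "\<dots> \<le> (\<integral>\<^sup>+x. indicator W (x + z) \<partial>cube_measure)"
  proof (rule nn_integral_mono)
    fix x :: "real^'n"
    have "x + z \<in> W" if "x \<in> ball 0 e"
    proof -
      have "x + z \<in> ball z e" using that by (simp add: dist_norm)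
      then show ?thesis using z(2) U(3) by blast
    qed
    then show "indicator (ball 0 e) x \<le> (indicator W (x + z) :: ennreal)" by (auto split: split_indicator)
  qed
  also have "\<dots> = (\<integral>\<^sup>+x. indicator W x \<partial>cube_measure)"
    by (rule nn_integral_cube_shift) (simp_all add: per indicator_def)
  also have "\<dots> = emeasure lborel (unit_cube \<inter> W)" by (simp add: emeasure_cube_measure)
  finally show ?thesis using emeasure_cube_ball_pos[OF z(1), where 'n='n] by simp
qed

section \<open>Expansive linear maps\<close>

lemma contracting_recurrence_tendsto_0:
  fixes u e :: "nat \<Rightarrow> real"
  assumes a: "0 \<le> a" "a < 1" and u: "\<And>n. 0 \<le> u n" and rec: "\<And>n. u (Suc n) \<le> a * u n + e n"
    and e: "e \<longlonglongrightarrow> 0"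
  shows "u \<longlonglongrightarrow> 0"
proof (rule LIMSEQ_I)
  fix d :: real assume d: "0 < d"
  \<comment> \<open>With errors below this bound the level \<open>d / 2\<close> is fixed by the
    majorising recurrence, so the excess of \<open>u\<close> over it shrinks by the factor
    \<open>a\<close> at each step.\<close>
  have "0 < (1 - a) * (d / 2)" using a d by simp
  from LIMSEQ_D[OF e this] obtain N where N: "\<And>n. n \<ge> N \<Longrightarrow> e n < (1 - a) * (d / 2)"
    by (metis abs_le_iff diff_zero le_less_trans order_refl real_norm_def)
  have step: "u (N + k) - d / 2 \<le> a ^ k * \<bar>u N - d / 2\<bar>" for k
  proof (induction k)
    case (Suc k)
    have "u (N + Suc k) - d / 2 \<le> a * u (N + k) + (1 - a) * (d / 2) - d / 2"
      using rec[of "N + k"] N[of "N + k"] by simp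
    also have "\<dots> = a * (u (N + k) - d / 2)" by (simp add: field_simps)
    also have "\<dots> \<le> a * (a ^ k * \<bar>u N - d / 2\<bar>)" using Suc a by (intro mult_left_mono) auto
    finally show ?case by simp
  qed simp
  have "(\<lambda>k. a ^ k * \<bar>u N - d / 2\<bar>) \<longlonglongrightarrow> 0"
    using LIMSEQ_power_zero[of a] a by (auto intro: tendsto_mult_left_zero)
  from order_tendstoD(2)[OF this, of "d / 2"] d
  obtain K where K: "\<And>k. k \<ge> K \<Longrightarrow> a ^ k * \<bar>u N - d / 2\<bar> < d / 2"
    by (auto simp: eventually_sequentially)
  have "norm (u n - 0) < d" if "n \<ge> N + K" for n
  proof -
    have "K \<le> n - N" "N + (n - N) = n" using that by auto
    then show ?thesis using step[of "n - N"] K[of "n - N"] u[of n] by simp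
  qed
  then show "\<exists>no. \<forall>n\<ge>no. norm (u n - 0) < d" by blast
qed

text \<open>A polynomial acts on sequences with its variable as the shift.\<close>
definition shift_poly :: "complex poly \<Rightarrow> (nat \<Rightarrow> complex^'n::finite) \<Rightarrow> nat \<Rightarrow> complex^'n" where
  "shift_poly p y n = (\<Sum>i\<le>degree p. coeff p i *s y (n + i))"

lemma shift_poly_bound:
  "degree p \<le> K \<Longrightarrow> shift_poly p y n = (\<Sum>i\<le>K. coeff p i *s y (n + i))"
  unfolding shift_poly_def
  by (rule sum.mono_neutral_left) (auto simp: coeff_eq_0)

text \<open>Multiplication by X - l acts as the shift minus l; this is the means to peel off one
  root at a time.\<close>

lemma shift_poly_linear_factor:
  "shift_poly ([:- l, 1:] * q) y n = shift_poly q y (Suc n) - l *s shift_poly q y n"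
proof -
  define K where "K = degree q"
  have "degree ([:- l, 1:] * q) \<le> Suc K"
    unfolding K_def by (rule order_trans[OF degree_mult_le]) simp
  then have "shift_poly ([:- l, 1:] * q) y n = (\<Sum>i\<le>Suc K. coeff ([:- l, 1:] * q) i *s y (n + i))"
    by (rule shift_poly_bound)
  also have fac: "[:- l, 1:] * q = pCons 0 q - smult l q" by simp
  also have "(\<Sum>i\<le>Suc K. coeff (pCons 0 q - smult l q) i *s y (n + i))
      = (\<Sum>i\<le>Suc K. coeff (pCons 0 q) i *s y (n + i)) - l *s (\<Sum>i\<le>Suc K. coeff q i *s y (n + i))"
    by (simp add: vec_eq_iff sum_component sum_distrib_left algebra_simps sum_subtractf del: sum.atMost_Suc)
  also have "(\<Sum>i\<le>Suc K. coeff (pCons 0 q) i *s y (n + i)) = shift_poly q y (Suc n)"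
    by (subst sum.atMost_Suc_shift) (simp add: shift_poly_def K_def)
  also have "(\<Sum>i\<le>Suc K. coeff q i *s y (n + i)) = shift_poly q y n"
    by (rule shift_poly_bound[symmetric]) (simp add: K_def)
  finally show ?thesis by (simp only: fac)
qed

lemma shift_poly_of_difference:
  "shift_poly q (\<lambda>n. y (Suc n) - l *s y n) n = shift_poly q y (Suc n) - l *s shift_poly q y n"
  by (simp add: shift_poly_def vec_eq_iff sum_component sum_distrib_left algebra_simps sum_subtractf)

lemma matrix_vector_mult_scale: "(N :: complex^'n^'n) *v (c *s x) = c *s (N *v x)"
  by (simp add: matrix_vector_mult_def vec_eq_iff sum_distrib_left mult_ac)

text \<open>Induction on the degree of a polynomial annihilating the backward orbit takes the place
  of a Jordan form. For a root l with quotient q, the sequence (shift - l) y is annihilated by q and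
  so tends to 0. If l has modulus below 1, then y satisfies a contracting recurrence with this
  error. Otherwise q annihilates y already.\<close>

lemma inverse_orbit_tendsto_0:
  fixes N :: "complex^'n^'n::finite" and y :: "nat \<Rightarrow> complex^'n"
  assumes ev: "\<And>z. det (N - mat z) = 0 \<Longrightarrow> cmod z > 1"
    and "p \<noteq> 0" "\<And>n. N *v y (Suc n) = y n" "\<And>n. shift_poly p y n = 0"
  shows "y \<longlonglongrightarrow> 0"
  using assms(2-)
proof (induction "degree p" arbitrary: p y)
  case 0
  then have "coeff p 0 \<noteq> 0" using leading_coeff_0_iff by metis
  then have "y n = 0" for n
    using 0(1) 0(4)[of n] by (simp add: shift_poly_def vec_eq_iff)
  then show ?case by simp
next
  case (Suc d)
  have "\<not> constant (poly p)" using Suc(2) by (simp add: constant_degree)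
  then obtain l where "poly p l = 0" using fundamental_theorem_of_algebra by blast
  then obtain q where q: "p = [:- l, 1:] * q" by (metis dvdE poly_eq_0_iff_dvd)
  then have q0: "q \<noteq> 0" using Suc by auto
  then have dq: "d = degree q" using Suc(2) unfolding q by (subst (asm) degree_mult_eq) auto
  have fac: "shift_poly q y (Suc n) = l *s shift_poly q y n" for n
    using Suc(5)[of n] unfolding q shift_poly_linear_factor by simp
  define w where "w n = y (Suc n) - l *s y n" for n
  have w0: "w \<longlonglongrightarrow> 0"
  proof (rule Suc(1)[OF dq q0])
    show "N *v w (Suc n) = w n" for n
      by (simp add: w_def matrix_vector_mult_diff_distrib matrix_vector_mult_scale Suc(4))
    show "shift_poly q w n = 0" for n
      unfolding w_def shift_poly_of_difference by (simp add: fac)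
  qed
  show ?case
  proof (cases "cmod l < 1")
    case True
    show ?thesis
    proof (rule vec_tendstoI)
      fix k
      have "(\<lambda>n. cmod (y n $ k)) \<longlonglongrightarrow> 0"
      proof (rule contracting_recurrence_tendsto_0[of "cmod l" _ "\<lambda>n. cmod (w n $ k)"])
        show "cmod (y (Suc n) $ k) \<le> cmod l * cmod (y n $ k) + cmod (w n $ k)" for n
        proof -
          have "y (Suc n) $ k = l * y n $ k + w n $ k" by (simp add: w_def)
          then show ?thesis by (metis norm_mult norm_triangle_ineq)
        qed
        show "(\<lambda>n. cmod (w n $ k)) \<longlonglongrightarrow> 0"
          using tendsto_norm_zero[OF tendsto_vec_nth[OF w0, of k, simplified]] by simp
      qed (use True in auto)
      then show "(\<lambda>n. y n $ k) \<longlonglongrightarrow> 0 $ k" by (simp add: tendsto_norm_zero_iff)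
    qed
  next
    case False
    show ?thesis
    proof (rule Suc(1)[OF dq q0])
      show "N *v y (Suc n) = y n" for n by (rule Suc(4))
    next
      fix n
      \<comment> \<open>The shift multiplies \<open>z\<close> by \<open>l\<close> and
        \<open>N\<close> undoes the shift, so \<open>N\<close> sends \<open>z\<close> to
        \<open>z / l\<close>. As 1 / l has modulus at most 1, it is no eigenvalue of
        \<open>N\<close>, and \<open>z\<close> vanishes.\<close>
      define z where "z = shift_poly q y n"
      have "N *v shift_poly q y (Suc n) = z"
        unfolding z_def shift_poly_def
        by (simp add: matrix_vector_mult_scale Suc(4) vec.linear_sum[OF matrix_vector_mul_linear_gen])
      then have "l *s (N *v z) = z" by (simp add: fac z_def matrix_vector_mult_scale)
      moreover have "l \<noteq> 0" using False by auto
      ultimately have "N *v z = (1 / l) *s z" by (auto simp: vec_eq_iff field_simps)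
      then have "(N - mat (1 / l)) *v z = 0"
        by (simp add: matrix_vector_mult_diff_rdistrib) (simp add: matrix_vector_mult_def mat_def vec_eq_iff if_distrib if_distribR cong: if_cong)
      moreover have "det (N - mat (1 / l)) \<noteq> 0"
      proof
        assume "det (N - mat (1 / l)) = 0"
        from ev[OF this] show False using False by (auto simp: norm_divide divide_simps split: if_splits)
      qed
      ultimately show "shift_poly q y n = 0"
        using invertible_det_nz[of "N - mat (1/l)"] invertible_left_inverse[of "N - mat (1/l)"]
          matrix_left_invertible_ker[of "N - mat (1/l)"]
        unfolding z_def by blast
    qed
  qed
qed

text \<open>A substitute for the characteristic polynomial along a single orbit. Among DIM + 1
  vectors some two coincide or they form a dependent set; the cases are separate because
  \<open>dependent\<close> speaks of sets, not of families.\<close>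

lemma linear_relation_exists:
  fixes f :: "nat \<Rightarrow> 'a::euclidean_space"
  shows "\<exists>r d. (\<exists>i\<le>d. r i \<noteq> (0::real)) \<and> (\<Sum>i\<le>d. r i *\<^sub>R f i) = 0"
proof (cases "inj_on f {..DIM('a)}")
  case True
  then have "card (f ` {..DIM('a)}) > DIM('a)" by (simp add: card_image)
  then have "dependent (f ` {..DIM('a)})" by (intro dependent_biggerset) auto
  then obtain u v where u: "v \<in> f ` {..DIM('a)}" "u v \<noteq> 0" "(\<Sum>v\<in>f ` {..DIM('a)}. u v *\<^sub>R v) = 0"
    by (auto simp: dependent_finite)
  have "(\<Sum>i\<le>DIM('a). u (f i) *\<^sub>R f i) = 0"
    using u(3) by (simp add: sum.reindex[OF True])
  then show ?thesis using u(1,2)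
    by (intro exI[of _ "\<lambda>i. u (f i)"] exI[of _ "DIM('a)"]) auto
next
  case False
  then obtain i j where ij: "i \<noteq> j" "f i = f j" by (auto simp: inj_on_def)
  let ?r = "\<lambda>k. if k = i then 1 else if k = j then - 1 else (0::real)"
  have "(\<Sum>k\<le>max i j. ?r k *\<^sub>R f k) = (\<Sum>k\<in>{i, j}. ?r k *\<^sub>R f k)"
    by (rule sum.mono_neutral_right) auto
  also have "\<dots> = 0" using ij by simp
  finally show ?thesis by (intro exI[of _ ?r] exI[of _ "max i j"]) auto
qed

text \<open>Zero has modulus at most 1, hence is not an eigenvalue.\<close>

lemma expansive_bij:
  assumes "expansive (Q :: real^'n::finite \<Rightarrow> real^'n)"
  shows "bij Q"
proof -
  have lin: "linear Q" using assms by (simp add: expansive_def)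
  have "det (complexify (matrix Q)) \<noteq> 0"
    using assms unfolding expansive_def by (auto dest!: spec[of _ 0] simp: mat_0)
  moreover have "det (complexify (matrix Q)) = complex_of_real (det (matrix Q))"
    by (simp add: det_def complexify_def of_real_sum of_real_prod)
  ultimately have "det (matrix Q) \<noteq> 0" by simp
  then have "invertible (matrix Q)" by (simp add: invertible_det_nz)
  then have "bij ((*v) (matrix Q))" by (simp only: invertible_eq_bij)
  also have "(*v) (matrix Q) = Q" using matrix_vector_mul(2)[OF lin] .
  finally show ?thesis .
qed

lemma expansive_inverse_orbit_tendsto_0:
  fixes Q :: "real^'n::finite \<Rightarrow> real^'n"
  assumes ex: "expansive Q"
  shows "(\<lambda>n. (inv Q ^^ n) b) \<longlonglongrightarrow> 0"
proof -
  have lin: "linear Q" using ex by (simp add: expansive_def)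
  have bij: "bij Q" by (rule expansive_bij[OF ex])
  have linv: "linear (inv Q)"
    by (rule inj_linear_imp_inv_linear[OF lin bij_is_inj[OF bij]])
  have linn: "linear (inv Q ^^ n)" for n
    
  proof (induction n)
    case (Suc n)
    show ?case using linear_compose[OF Suc linv] by (simp add: o_def)
  qed (simp add: linear_id id_def[symmetric])
  define c where "c x = (\<chi> i. complex_of_real (x $ i))" for x :: "real^'n"
  define y where "y n = c ((inv Q ^^ n) b)" for n
  obtain r d where r: "\<exists>i\<le>d. r i \<noteq> (0::real)" "(\<Sum>i\<le>d. r i *\<^sub>R (inv Q ^^ i) b) = 0"
    using linear_relation_exists[of "\<lambda>i. (inv Q ^^ i) b"] by blast
  \<comment> \<open>The eigenvalue condition is complex, so the orbit is complexified by
    \<open>c\<close> and the real relation becomes a polynomial. Applying \<open>inv Q ^^ n\<close>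
    to the relation gives it for every later window of the orbit.\<close>
  define p where "p = (\<Sum>i\<le>d. monom (complex_of_real (r i)) i)"
  have cp: "coeff p k = (if k \<le> d then complex_of_real (r k) else 0)" for k
    by (simp add: p_def coeff_sum)
  have "y \<longlonglongrightarrow> 0"
  proof (rule inverse_orbit_tendsto_0[of "complexify (matrix Q)" p])
    show "cmod z > 1" if "det (complexify (matrix Q) - mat z) = 0" for z
      using ex that by (simp add: expansive_def)
    show "p \<noteq> 0" using r(1) cp by (metis coeff_0 of_real_eq_0_iff)
    show "complexify (matrix Q) *v y (Suc n) = y n" for n
    proof -
      have "complexify (matrix Q) *v c x = c (matrix Q *v x)" for x
        by (simp add: complexify_def c_def matrix_vector_mult_def vec_eq_iff)
      then show ?thesis
        using bij by (simp add: y_def fun_cong[OF matrix_vector_mul(2)[OF lin]] bij_is_surj surj_f_inv_f)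
    qed
    show "shift_poly p y n = 0" for n
    proof -
      have deg: "degree p \<le> d" by (rule degree_le) (simp add: cp)
      have "shift_poly p y n = c (\<Sum>i\<le>d. r i *\<^sub>R (inv Q ^^ (n + i)) b)"
        by (subst shift_poly_bound[OF deg]) (simp add: cp y_def c_def vec_eq_iff sum_component)
      also have "(\<Sum>i\<le>d. r i *\<^sub>R (inv Q ^^ (n + i)) b) = (inv Q ^^ n) (\<Sum>i\<le>d. r i *\<^sub>R (inv Q ^^ i) b)"
        by (simp add: linear_sum[OF linn] linear_cmul[OF linn] funpow_add)
      also have "c \<dots> = 0" using linear_0[OF linn] by (simp add: r(2) c_def vec_eq_iff)
      finally show ?thesis .
    qed
  qed
  then have "(\<lambda>n. y n $ i) \<longlonglongrightarrow> 0" for i using tendsto_vec_nth by fastforce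
  then have "(\<lambda>n. ((inv Q ^^ n) b) $ i) \<longlonglongrightarrow> 0" for i
    using tendsto_Re[of "\<lambda>n. y n $ i" 0] by (simp add: y_def c_def)
  then show ?thesis by (intro vec_tendstoI) simp
qed

section \<open>Contracted periodic sets\<close>

text \<open>A point of \<open>U\<close> stays in \<open>U\<close> under all sufficiently small
  translations, so the integrand is eventually 0 at each point while the indicator of
  \<open>U\<close> dominates it.\<close>

lemma tendsto_measure_leaving_open_set:
  fixes U :: "'a::euclidean_space set"
  assumes "open U" and fin: "emeasure lborel U < \<infinity>" and h: "h \<longlonglongrightarrow> 0"
  shows "(\<lambda>n::nat. \<integral>\<^sup>+x. indicator U x * indicator (- U) (x + h n) \<partial>lborel) \<longlonglongrightarrow> 0"
proof -
  have [measurable]: "U \<in> sets borel" using \<open>open U\<close> by simp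
  have "(\<lambda>n::nat. \<integral>\<^sup>+x. indicator U x * indicator (- U) (x + h n) \<partial>lborel) \<longlonglongrightarrow> (\<integral>\<^sup>+x. 0 \<partial>(lborel :: 'a measure))"
  proof (rule nn_integral_dominated_convergence[where w="indicator U"])
    show "AE x in lborel. (\<lambda>n. indicator U x * indicator (- U) (x + h n) :: ennreal) \<longlonglongrightarrow> 0"
    proof (intro AE_I2)
      fix x
      show "(\<lambda>n. indicator U x * indicator (- U) (x + h n) :: ennreal) \<longlonglongrightarrow> 0"
      proof (cases "x \<in> U")
        case True
        have "(\<lambda>n. x + h n) \<longlonglongrightarrow> x + 0" by (intro tendsto_intros h)
        then have "\<forall>\<^sub>F n in sequentially. x + h n \<in> U"
          using topological_tendstoD[OF _ \<open>open U\<close>] True by simp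
        then have "\<forall>\<^sub>F n in sequentially. indicator U x * indicator (- U) (x + h n) = (0::ennreal)"
          by eventually_elim simp
        then show ?thesis by (rule tendsto_eventually)
      qed simp
    qed
    show "(\<integral>\<^sup>+ x. indicator U x \<partial>lborel) < \<infinity>" using fin by simp
  qed (auto split: split_indicator)
  then show ?thesis by simp
qed

text \<open>If \<open>W\<close> is periodic of positive density, its contracted copies meet every open set in
  asymptotically the same positive proportion, so they cannot all miss a set of positive measure.\<close>
lemma contracted_copies_exhaust:
  fixes W :: "(real^'n::finite) set" and f g :: "nat \<Rightarrow> real^'n \<Rightarrow> real^'n"
  assumes W [measurable]: "W \<in> sets borel" and per: "\<And>x k. x \<in> W \<Longrightarrow> k \<in> Zvec \<Longrightarrow> x + k \<in> W"
    and pos: "emeasure lborel (unit_cube \<inter> W) > 0"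
    and lin: "\<And>n. linear (f n)" and inv: "\<And>n y. f n (g n y) = y"
    and g0: "\<And>y. (\<lambda>n. g n y) \<longlonglongrightarrow> 0" and ling: "\<And>n. linear (g n)"
  shows "emeasure lborel (unit_cube - (\<Union>n. f n -` W)) = 0"
proof -
  have [measurable]: "f n \<in> borel_measurable borel" "g n \<in> borel_measurable borel" for n
    by (rule linear_borel_measurable[OF lin], rule linear_borel_measurable[OF ling])
  let ?Y = "\<Union>n. f n -` W"
  have [measurable]: "?Y \<in> sets borel"
    using measurable_sets_borel[of "f _" borel W] by (auto intro!: sets.countable_UN)
  define E where "E = unit_cube - ?Y"
  have E [measurable]: "E \<in> sets borel" unfolding E_def by measurable
  have Efin: "emeasure lborel E < \<infinity>"
    using emeasure_mono[of E unit_cube lborel] by (auto simp: E_def emeasure_unit_cube intro: le_less_trans)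
  define d where "d = emeasure lborel (unit_cube \<inter> W)"
  interpret C: prob_space "cube_measure :: (real^'n) measure" by (rule prob_space_cube_measure)
  interpret P: pair_sigma_finite "cube_measure :: (real^'n) measure" "lborel :: (real^'n) measure" ..
  have iff: "x + k \<in> W \<longleftrightarrow> x \<in> W" if "k \<in> Zvec" for x k
    using per[of x k] per[of "x + k" "- k"] that by (auto simp: Zvec_uminus)
  \<comment> \<open>By periodicity the average over one cube of translations does not depend on the
    base point: \<open>d\<close> is the density of \<open>W\<close>.\<close>
  have density: "(\<integral>\<^sup>+y. indicator W (z + y) \<partial>cube_measure) = d" for z
  proof -
    have "(\<integral>\<^sup>+y. indicator W (y + z) \<partial>cube_measure) = (\<integral>\<^sup>+y. indicator W y \<partial>cube_measure)"
      by (rule nn_integral_cube_shift) (auto simp: iff indicator_def)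
    then show ?thesis by (simp add: add.commute d_def emeasure_cube_measure)
  qed
  have "d * emeasure lborel E \<le> 0 + ennreal e" if "e > 0" for e
  proof -
    \<comment> \<open>\<open>E\<close> is only measurable, whereas almost-invariance under small
      translations is available for open sets; the enlargement costs measure less than
      \<open>e\<close>.\<close>
    obtain U where U: "open U" "E \<subseteq> U" "emeasure lborel (U - E) < ennreal e"
      using outer_regular_lborel[OF E \<open>e > 0\<close>] by blast
    have [measurable]: "U \<in> sets borel" using U(1) by simp
    have "emeasure lborel U = emeasure lborel E + emeasure lborel (U - E)"
      using U(2) by (subst plus_emeasure) (auto simp: Un_absorb1)
    also have "\<dots> < \<infinity>"
      using Efin order.strict_trans[OF U(3) ennreal_less_top] by (simp add: less_top[symmetric])
    finally have Ufin: "emeasure lborel U < \<infinity>" .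
    define a where "a n y = (\<integral>\<^sup>+x. indicator U x * indicator (- U) (x + g n y) \<partial>lborel)" for n y
    have [measurable]: "a n \<in> borel_measurable borel" for n
      unfolding a_def by measurable
    have step: "d * emeasure lborel U \<le> (\<integral>\<^sup>+y. a n y \<partial>cube_measure) + ennreal e" for n
    proof -
      have "d * emeasure lborel U = (\<integral>\<^sup>+x. indicator U x * (\<integral>\<^sup>+y. indicator W (f n x + y) \<partial>cube_measure) \<partial>lborel)"
        by (simp add: density nn_integral_multc) (simp add: mult.commute nn_integral_cmult_indicator)
      also have "\<dots> = (\<integral>\<^sup>+x. \<integral>\<^sup>+y. indicator U x * indicator W (f n x + y) \<partial>cube_measure \<partial>lborel)"
        by (subst nn_integral_cmult) auto
      also have "\<dots> = (\<integral>\<^sup>+y. \<integral>\<^sup>+x. indicator U x * indicator W (f n x + y) \<partial>lborel \<partial>cube_measure)"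
        by (rule P.Fubini') measurable
      also have "\<dots> \<le> (\<integral>\<^sup>+y. a n y + ennreal e \<partial>cube_measure)"
      proof (rule nn_integral_mono)
        \<comment> \<open>Translating by \<open>y\<close> after \<open>f n\<close> is translating by
          the small vector \<open>g n y\<close> before it. Points of \<open>U\<close> that leave
          \<open>U\<close> under this translation are counted by \<open>a n y\<close>; the others
          are handled by shift invariance.\<close>
        fix y
        have "(\<integral>\<^sup>+x. indicator U x * indicator W (f n x + y) \<partial>lborel)
            \<le> (\<integral>\<^sup>+x. indicator U x * indicator (- U) (x + g n y) + indicator U (x + g n y) * indicator W (f n (x + g n y)) \<partial>lborel)"
          by (intro nn_integral_mono) (auto simp: linear_add[OF lin] inv split: split_indicator)
        also have "\<dots> = a n y + (\<integral>\<^sup>+x. indicator U (x + g n y) * indicator W (f n (x + g n y)) \<partial>lborel)"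
          unfolding a_def by (subst nn_integral_add) auto
        also have "(\<integral>\<^sup>+x. indicator U (x + g n y) * indicator W (f n (x + g n y)) \<partial>lborel)
            = (\<integral>\<^sup>+x. indicator U x * indicator W (f n x) \<partial>lborel)"
          by (rule nn_integral_lborel_shift[where F="\<lambda>x. indicator U x * indicator W (f n x)"]) measurable
        \<comment> \<open>\<open>E\<close> avoids every preimage of \<open>W\<close>, so within
          \<open>U\<close> such a preimage lies in \<open>U - E\<close>.\<close>
        also have "\<dots> \<le> (\<integral>\<^sup>+x. indicator (U - E) x \<partial>lborel)"
          by (intro nn_integral_mono) (auto simp: E_def split: split_indicator)
        also have "\<dots> \<le> ennreal e" using U(3) by (simp add: less_imp_le)
        finally show "(\<integral>\<^sup>+x. indicator U x * indicator W (f n x + y) \<partial>lborel) \<le> a n y + ennreal e"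
          by (simp add: add_left_mono)
      qed
      also have "\<dots> = (\<integral>\<^sup>+y. a n y \<partial>cube_measure) + ennreal e"
        by (subst nn_integral_add) (auto simp: C.emeasure_space_1[simplified])
      finally show ?thesis .
    qed
    have "(\<lambda>n. \<integral>\<^sup>+y. a n y \<partial>cube_measure) \<longlonglongrightarrow> (\<integral>\<^sup>+y. 0 \<partial>(cube_measure :: (real^'n) measure))"
    proof (rule nn_integral_dominated_convergence[where w="\<lambda>_. emeasure lborel U"])
      show "AE y in cube_measure. a n y \<le> emeasure lborel U" for n
      proof (intro AE_I2)
        fix y
        have "a n y \<le> (\<integral>\<^sup>+x. indicator U x \<partial>lborel)"
          unfolding a_def by (intro nn_integral_mono) (auto split: split_indicator)
        then show "a n y \<le> emeasure lborel U" by simp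
      qed
      show "AE y in cube_measure. (\<lambda>n. a n y) \<longlonglongrightarrow> 0"
        unfolding a_def by (intro AE_I2 tendsto_measure_leaving_open_set U(1) Ufin g0)
      show "(\<integral>\<^sup>+ y. emeasure lborel U \<partial>(cube_measure :: (real^'n) measure)) < \<infinity>"
        using Ufin by (simp add: C.emeasure_space_1[simplified])
    qed measurable
    then have "(\<lambda>n. (\<integral>\<^sup>+y. a n y \<partial>cube_measure) + ennreal e) \<longlonglongrightarrow> 0 + ennreal e"
      by (intro tendsto_add) auto
    from LIMSEQ_le_const[OF this] step
    have "d * emeasure lborel U \<le> 0 + ennreal e" by blast
    moreover have "d * emeasure lborel E \<le> d * emeasure lborel U"
      using U(2) by (intro mult_left_mono emeasure_mono) auto
    ultimately show ?thesis by (rule order_trans[rotated])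
  qed
  then have "d * emeasure lborel E \<le> 0" by (rule ennreal_le_epsilon) auto
  then show ?thesis using pos by (auto simp: E_def d_def)
qed

section \<open>Uniqueness of Fourier coefficients\<close>

definition char_fun :: "real^'n::finite \<Rightarrow> real^'n \<Rightarrow> complex" where
  "char_fun m x = cis (2 * pi * (x \<bullet> m))"

lemma char_fun_measurable [measurable]: "char_fun m \<in> borel_measurable borel"
  unfolding char_fun_def cis_conv_exp by measurable

lemma norm_char_fun [simp]: "cmod (char_fun m x) = 1"
  by (simp add: char_fun_def)

lemma char_fun_add: "char_fun m (x + y) = char_fun m x * char_fun m y"
  by (simp add: char_fun_def inner_add_left ring_distribs cis_mult)

lemma char_fun_add_index: "char_fun (m + k) x = char_fun m x * char_fun k x"
  by (simp add: char_fun_def inner_add_right ring_distribs cis_mult)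

lemma char_fun_uminus: "char_fun (- m) x = cnj (char_fun m x)"
  by (simp add: char_fun_def cis_cnj)

lemma inner_Zvec: "k \<in> Zvec \<Longrightarrow> m \<in> Zvec \<Longrightarrow> k \<bullet> m \<in> \<int>"
  by (auto simp: inner_vec_def Zvec_def intro!: Ints_sum Ints_mult)

lemma char_fun_Zvec: "k \<in> Zvec \<Longrightarrow> m \<in> Zvec \<Longrightarrow> char_fun m k = 1"
  using inner_Zvec[of k m] by (simp add: char_fun_def cis_multiple_2pi)

lemma char_fun_axis: "char_fun (axis i 1) x + char_fun (- axis i 1) x = of_real (2 * cos (2 * pi * x $ i))"
  by (simp add: char_fun_def inner_axis cis.ctr complex_eq_iff)

lemma axis_Zvec: "axis i 1 \<in> Zvec"
  by (simp add: Zvec_def axis_def)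

lemma bounded_measurable_integrable_cube:
  fixes f :: "real^'n::finite \<Rightarrow> complex"
  assumes "f \<in> borel_measurable borel" "\<And>x. cmod (f x) \<le> K"
  shows "integrable cube_measure f"
proof -
  interpret prob_space "cube_measure :: (real^'n) measure" by (rule prob_space_cube_measure)
  show ?thesis using assms by (intro integrable_const_bound[where B=K]) auto
qed

lemma Re_of_real_mult: "Re (of_real r * z) = r * Re z"
  by simp

lemma isCont_near_0:
  fixes f :: "'a::real_normed_vector \<Rightarrow> real"
  assumes "isCont f 0" "f 0 = 1" "e > 0"
  shows "\<exists>d>0. \<forall>x. norm x < d \<longrightarrow> \<bar>f x - 1\<bar> < e"
  using assms unfolding continuous_at_eps_delta dist_norm real_norm_def by (metis diff_zero)

text \<open>Real multipliers \<open>p\<close> for which all Fourier coefficients of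
  \<open>p * c\<close> vanish. Once 1 is among them, the closure properties below bring in every
  polynomial in the coordinate cosines; boundedness secures integrability.\<close>

definition fourier_null :: "(real^'n::finite \<Rightarrow> complex) \<Rightarrow> (real^'n \<Rightarrow> real) \<Rightarrow> bool" where
  "fourier_null c p \<longleftrightarrow> p \<in> borel_measurable borel \<and> (\<exists>K. \<forall>x. \<bar>p x\<bar> \<le> K) \<and>
     (\<forall>m\<in>Zvec. (LINT x|cube_measure. char_fun m x * (of_real (p x) * c x)) = 0)"

section \<open>Multipliers and the peak kernel\<close>

context
  fixes c :: "real^'n::finite \<Rightarrow> complex" and K :: real
  assumes c_meas [measurable]: "c \<in> borel_measurable borel" and c_bound: "\<And>x. cmod (c x) \<le> K"
begin

lemma fourier_null_integrable:
  assumes "fourier_null c p"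
  shows "integrable cube_measure (\<lambda>x. char_fun m x * (of_real (p x) * c x))"
proof -
  obtain K' where [measurable]: "p \<in> borel_measurable borel" and K': "\<And>x. \<bar>p x\<bar> \<le> K'"
    using assms by (auto simp: fourier_null_def)
  have "0 \<le> K'" using K'[of 0] by simp
  then show ?thesis
    using K' c_bound
    by (intro bounded_measurable_integrable_cube[where K="K' * K"]) (auto simp: norm_mult intro!: mult_mono)
qed

lemma fourier_null_add:
  assumes p: "fourier_null c p" and q: "fourier_null c q"
  shows "fourier_null c (\<lambda>x. p x + q x)"
proof -
  obtain K1 K2 where "\<And>x. \<bar>p x\<bar> \<le> K1" "\<And>x. \<bar>q x\<bar> \<le> K2"
    using p q by (auto simp: fourier_null_def)
  then have "\<forall>x. \<bar>p x + q x\<bar> \<le> K1 + K2" by (meson abs_triangle_ineq add_mono order_trans)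
  moreover have "(LINT x|cube_measure. char_fun m x * (of_real (p x + q x) * c x)) = 0" if "m \<in> Zvec" for m
    using p q that fourier_null_integrable[OF p, of m] fourier_null_integrable[OF q, of m]
    by (simp add: ring_distribs fourier_null_def)
  ultimately show ?thesis using p q unfolding fourier_null_def by auto
qed

lemma fourier_null_scale:
  assumes p: "fourier_null c p"
  shows "fourier_null c (\<lambda>x. r * p x)"
proof -
  obtain K1 where K1: "\<And>x. \<bar>p x\<bar> \<le> K1"
    using p by (auto simp: fourier_null_def)
  then have "\<forall>x. \<bar>r * p x\<bar> \<le> \<bar>r\<bar> * K1" by (simp add: abs_mult mult_left_mono)
  moreover have "(LINT x|cube_measure. char_fun m x * (of_real (r * p x) * c x)) = 0" if "m \<in> Zvec" for m
  proof -
    have "(LINT x|cube_measure. char_fun m x * (of_real (r * p x) * c x))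
        = (LINT x|cube_measure. of_real r * (char_fun m x * (of_real (p x) * c x)))"
      by (simp add: mult_ac)
    then show ?thesis using p that by (simp add: fourier_null_def)
  qed
  ultimately show ?thesis using p unfolding fourier_null_def by auto
qed

text \<open>A cosine is half the sum of two opposite characters, so the coefficient at
  \<open>m\<close> becomes the mean of the coefficients at two neighbouring indices, which vanish
  too.\<close>

lemma fourier_null_cos:
  assumes p: "fourier_null c p"
  shows "fourier_null c (\<lambda>x. cos (2 * pi * x $ i) * p x)"
proof -
  obtain K1 where K1: "\<And>x. \<bar>p x\<bar> \<le> K1" and [measurable]: "p \<in> borel_measurable borel"
    using p by (auto simp: fourier_null_def)
  have "\<bar>cos (2 * pi * x $ i) * p x\<bar> \<le> 1 * K1" for x
    unfolding abs_mult using K1[of x] by (intro mult_mono) auto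
  moreover have "(LINT x|cube_measure. char_fun m x * (of_real (cos (2 * pi * x $ i) * p x) * c x)) = 0"
    if m: "m \<in> Zvec" for m
  proof -
    have split: "char_fun m x * (of_real (cos (2 * pi * x $ i) * p x) * c x)
        = (char_fun (m + axis i 1) x * (of_real (p x) * c x) + char_fun (m + - axis i 1) x * (of_real (p x) * c x)) / 2" for x
    proof -
      have E: "complex_of_real (cos (2 * pi * x $ i)) = (char_fun (axis i 1) x + char_fun (- axis i 1) x) / 2"
        unfolding char_fun_axis by simp
      show ?thesis unfolding char_fun_add_index of_real_mult E by (simp add: algebra_simps add_divide_distrib)
    qed
    have "(LINT x|cube_measure. char_fun m x * (of_real (cos (2 * pi * x $ i) * p x) * c x))
      = ((LINT x|cube_measure. char_fun (m + axis i 1) x * (of_real (p x) * c x))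
          + (LINT x|cube_measure. char_fun (m + - axis i 1) x * (of_real (p x) * c x))) / 2"
      unfolding split
      by (subst integral_divide_zero, subst Bochner_Integration.integral_add)
        (intro fourier_null_integrable[OF p] refl)+
    then show ?thesis
      using p m Zvec_add[OF m axis_Zvec] Zvec_add[OF m Zvec_uminus[OF axis_Zvec]]
      by (simp add: fourier_null_def)
  qed
  ultimately show ?thesis using p unfolding fourier_null_def by auto
qed

lemma fourier_null_sum:
  assumes "finite I" "fourier_null c (\<lambda>x. 0)" "\<And>i. i \<in> I \<Longrightarrow> fourier_null c (p i)"
  shows "fourier_null c (\<lambda>x. \<Sum>i\<in>I. p i x)"
  using assms by (induction I rule: finite_induct) (auto intro: fourier_null_add)

text \<open>The peak function below exceeds 1 near the origin and stays in \<open>[0, 1]\<close> elsewhere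
  on the cube, so its powers concentrate at the origin.\<close>
lemma fourier_uniqueness_at_0:
  assumes cont: "isCont c 0"
    and null: "\<And>m. m \<in> Zvec \<Longrightarrow> (LINT x|cube_measure. char_fun m x * c x) = 0"
  shows "c 0 = 0"
proof (rule ccontr)
  assume c0: "c 0 \<noteq> 0"
  interpret C: prob_space "cube_measure :: (real^'n) measure" by (rule prob_space_cube_measure)
  define D where "D = real CARD('n)"
  have D: "D \<ge> 1" unfolding D_def using zero_less_card_finite[where 'a='n] by linarith
  define c' where "c' x = Re (c x / c 0)" for x
  have [measurable]: "c' \<in> borel_measurable borel" unfolding c'_def by measurable
  define K' where "K' = K / cmod (c 0)"
  have c'_bound: "\<bar>c' x\<bar> \<le> K'" for x
  proof -
    have "\<bar>c' x\<bar> \<le> cmod (c x / c 0)" unfolding c'_def by (rule abs_Re_le_cmod)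
    also have "\<dots> \<le> K'" using c_bound[of x] by (simp add: norm_divide K'_def divide_right_mono)
    finally show ?thesis .
  qed
  have "isCont c' 0" unfolding c'_def divide_inverse
    by (intro continuous_Re continuous_mult cont continuous_const)
  moreover have "c' 0 = 1" using c0 by (simp add: c'_def)
  ultimately obtain d0 where d0: "d0 > 0" "\<And>x. norm x < d0 \<Longrightarrow> \<bar>c' x - 1\<bar> < 1/2"
    using isCont_near_0[of c' "1/2"] by auto
  \<comment> \<open>The bound 1/2 keeps the angle \<open>2 * pi * d\<close> where the cosine
    decreases. Since the norm is at most the sum of the \<open>D\<close> coordinates,
    \<open>d0 / (D + 1)\<close> puts the cube of half-width \<open>d\<close> into the ball of radius
    \<open>d0\<close>.\<close>
  define d where "d = min (1/2) (d0 / (D + 1))"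
  have d: "0 < d" "d \<le> 1/2" using d0(1) D unfolding d_def by (simp_all only: min_less_iff_conj min.cobounded1) simp
  have near: "c' x \<ge> 1/2" if "\<And>i. \<bar>x $ i\<bar> < d" for x
  proof -
    have "norm x \<le> (\<Sum>i\<in>UNIV. \<bar>x $ i\<bar>)" by (rule norm_le_l1_cart)
    also have "\<dots> \<le> (\<Sum>i\<in>(UNIV::'n set). d)" using that by (intro sum_mono) (simp add: less_imp_le)
    also have "\<dots> = D * d" by (simp add: D_def)
    also have "\<dots> \<le> D * (d0 / (D + 1))" using D by (intro mult_left_mono) (auto simp: d_def)
    also have "\<dots> < d0" using D d0(1) by (simp add: field_simps)
    finally show ?thesis using d0(2)[of x] by linarith
  qed
  \<comment> \<open>A mean of \<open>D\<close> terms in [0, 1], each equal to 1 exactly where its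
    coordinate is an integer. The number \<open>h\<close> is the loss in this mean guaranteed by one
    coordinate at distance at least \<open>d\<close> from 0 within the cube.\<close>
  define Q where "Q x = (\<Sum>i\<in>UNIV. (1 + cos (2 * pi * x $ i)) / 2) / D" for x :: "real^'n"
  define h where "h = (1 - cos (2 * pi * d)) / (2 * D)"
  have "cos (2 * pi * d) < cos 0" using d by (intro cos_monotone_0_pi) auto
  then have h: "h > 0" using D by (simp add: h_def)
  have Q0: "0 \<le> Q x" for x unfolding Q_def using D
    by (intro divide_nonneg_pos sum_nonneg) (auto, smt (verit) cos_ge_minus_one)
  have far: "Q x \<le> 1 - h" if x: "x \<in> unit_cube" "d \<le> \<bar>x $ i\<bar>" for x i
  proof -
    have xi: "\<bar>x $ i\<bar> \<le> 1/2" using x(1) unfolding unit_cube_def by (auto simp: abs_le_iff dest!: spec[of _ i])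
    have "cos (2 * pi * x $ i) = cos (2 * pi * \<bar>x $ i\<bar>)" by (simp add: abs_if)
    also have "\<dots> \<le> cos (2 * pi * d)"
      using x(2) xi d by (intro cos_monotone_0_pi_le) (auto simp: mult_le_cancel_left)
    finally have ci: "cos (2 * pi * x $ i) \<le> cos (2 * pi * d)" .
    have "(\<Sum>j\<in>UNIV. (1 + cos (2 * pi * x $ j)) / 2)
        = (1 + cos (2 * pi * x $ i)) / 2 + (\<Sum>j\<in>UNIV - {i}. (1 + cos (2 * pi * x $ j)) / 2)"
      by (rule sum.remove) auto
    also have "(\<Sum>j\<in>UNIV - {i}. (1 + cos (2 * pi * x $ j)) / 2) \<le> (\<Sum>j\<in>UNIV - {i}. 1)"
      by (rule sum_mono) (auto simp: field_simps)
    also have "(\<Sum>j\<in>UNIV - {i}. 1::real) = D - 1"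
      by (simp add: D_def card_Diff_singleton of_nat_diff)
    also have "(1 + cos (2 * pi * x $ i)) / 2 + (D - 1) \<le> (1 + cos (2 * pi * d)) / 2 + (D - 1)"
      using ci by simp
    also have "(\<Sum>j\<in>UNIV. (1 + cos (2 * pi * x $ j)) / 2) = D * Q x" using D by (simp add: Q_def)
    finally have "D * Q x \<le> (1 + cos (2 * pi * d)) / 2 + (D - 1)" by simp
    also have "\<dots> = D * (1 - h)" using D by (simp add: h_def field_simps)
    finally show ?thesis using D by simp
  qed
  have "isCont Q 0" unfolding Q_def using D by (intro continuous_intros) auto
  moreover have "Q 0 = 1" using D by (simp add: Q_def D_def)
  ultimately obtain d1 where d1: "d1 > 0" "\<And>x. norm x < d1 \<Longrightarrow> \<bar>Q x - 1\<bar> < h/4"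
    using isCont_near_0[of Q "h/4"] h by auto
  \<comment> \<open>On \<open>S\<close> the kernel \<open>Q + h/2\<close> is at least
    \<open>1 + h/4\<close>; far from the origin it is at most \<open>1 - h/2\<close>.\<close>
  define S where "S = ball (0::real^'n) (min d d1)"
  have S: "1 + h/4 \<le> Q x + h/2 \<and> 1/2 \<le> c' x" if "x \<in> S" for x
  proof -
    have n: "norm x < d" "norm x < d1" using that by (auto simp: S_def)
    have "\<bar>x $ i\<bar> < d" for i using component_le_norm_cart[of x i] n(1) by linarith
    moreover have "1 + h/4 \<le> Q x + h/2" using d1(2)[OF n(2)] by linarith
    ultimately show ?thesis using near[of x] by blast
  qed
  have nullQ: "fourier_null c (\<lambda>x. (Q x + h/2) ^ N)" for N
  proof (induction N)
    case 0
    have "fourier_null c (\<lambda>_. 1)" using null by (auto simp: fourier_null_def)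
    then show ?case by simp
  next
    case (Suc N)
    let ?p = "\<lambda>x. (Q x + h/2) ^ N"
    have "fourier_null c (\<lambda>x. (1/2 + h/2) * ?p x + (\<Sum>i\<in>UNIV. 1 / (2 * D) * (cos (2 * pi * x $ i) * ?p x)))"
      using fourier_null_scale[OF Suc, of 0]
      by (intro fourier_null_add fourier_null_sum fourier_null_scale fourier_null_cos Suc) auto
    also have "(\<lambda>x. (1/2 + h/2) * ?p x + (\<Sum>i\<in>UNIV. 1 / (2 * D) * (cos (2 * pi * x $ i) * ?p x))) = (\<lambda>x. (Q x + h/2) ^ Suc N)"
    proof
      fix x
      have "Q x = 1/2 + (\<Sum>i\<in>UNIV. 1 / (2 * D) * cos (2 * pi * x $ i))"
        using D by (simp add: Q_def sum.distrib add_divide_distrib sum_divide_distrib[symmetric] sum_distrib_left[symmetric] D_def)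
      then have "(Q x + h/2) ^ Suc N = (1/2 + h/2 + (\<Sum>i\<in>UNIV. 1 / (2 * D) * cos (2 * pi * x $ i))) * ?p x" by simp
      then show "(1/2 + h/2) * ?p x + (\<Sum>i\<in>UNIV. 1 / (2 * D) * (cos (2 * pi * x $ i) * ?p x)) = (Q x + h/2) ^ Suc N"
        by (simp only: ring_distribs(2) sum_distrib_right mult.assoc)
    qed
    finally show ?case .
  qed
  have Qm [measurable]: "Q \<in> borel_measurable borel" unfolding Q_def by measurable
  have zero: "(LINT x|cube_measure. (Q x + h/2) ^ N * c' x) = 0"
    and intg: "integrable cube_measure (\<lambda>x. (Q x + h/2) ^ N * c' x)" for N
  proof -
    have eq: "(Q x + h/2) ^ N * c' x = Re (char_fun 0 x * (of_real ((Q x + h/2) ^ N) * c x) / c 0)" for x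
    proof -
      have "char_fun 0 x * (of_real ((Q x + h/2) ^ N) * c x) / c 0 = of_real ((Q x + h/2) ^ N) * (c x / c 0)"
        by (simp add: char_fun_def)
      then show ?thesis unfolding c'_def by (simp only: Re_of_real_mult)
    qed
    note I = fourier_null_integrable[OF nullQ, of 0 N]
    show "integrable cube_measure (\<lambda>x. (Q x + h/2) ^ N * c' x)"
      unfolding eq by (intro integrable_Re integrable_divide_zero I)
    have "(LINT x|cube_measure. char_fun 0 x * (of_real ((Q x + h/2) ^ N) * c x)) = 0"
      using nullQ[of N] zero_Zvec unfolding fourier_null_def by blast
    then have "(LINT x|cube_measure. char_fun 0 x * (of_real ((Q x + h/2) ^ N) * c x) / c 0) = 0"
      by (simp only: integral_divide_zero div_0)
    then show "(LINT x|cube_measure. (Q x + h/2) ^ N * c' x) = 0"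
      unfolding eq using I by (subst integral_Re) auto
  qed
  define v where "v = measure cube_measure S"
  have [measurable]: "S \<in> sets borel" by (simp add: S_def)
  have "emeasure cube_measure S > 0" unfolding S_def using d d1 by (intro emeasure_cube_ball_pos) simp
  then have v: "v > 0" by (simp add: v_def C.emeasure_eq_measure)
  have bound: "(1 + h/4) ^ N / 2 * v \<le> K'" for N
  proof -
    have "(LINT x|cube_measure. (1 + h/4) ^ N / 2 * indicator S x - K') \<le> (LINT x|cube_measure. (Q x + h/2) ^ N * c' x)"
    proof (rule integral_mono_AE)
      show "integrable cube_measure (\<lambda>x. (1 + h/4) ^ N / 2 * indicator S x - K')"
        by (intro Bochner_Integration.integrable_diff integrable_mult_right) (auto simp: C.emeasure_finite less_top[symmetric])
      have "AE x in cube_measure. x \<in> unit_cube"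
        unfolding cube_measure_def by (subst AE_density) (auto simp: indicator_def)
      then show "AE x in cube_measure. (1 + h/4) ^ N / 2 * indicator S x - K' \<le> (Q x + h/2) ^ N * c' x"
      proof eventually_elim
        fix x assume x: "x \<in> (unit_cube :: (real^'n) set)"
        have K0: "0 \<le> K'" using c'_bound[of 0] by linarith
        \<comment> \<open>Between \<open>S\<close> and the far region the kernel may exceed 1, but
          \<open>c'\<close> is positive there. Negative contributions come only from the far region
          and are at least \<open>- K'\<close>.\<close>
        consider "x \<in> S" | "x \<notin> S" "\<And>i. \<bar>x $ i\<bar> < d" | i where "x \<notin> S" "d \<le> \<bar>x $ i\<bar>"
          using leI by blast
        then show "(1 + h/4) ^ N / 2 * indicator S x - K' \<le> (Q x + h/2) ^ N * c' x"
        proof cases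
          case 1
          have "(1 + h/4) ^ N * (1/2) \<le> (Q x + h/2) ^ N * c' x"
            using S[OF 1] h Q0[of x] by (intro mult_mono power_mono) auto
          then show ?thesis using 1 K0 by simp
        next
          case 2
          have "0 \<le> (Q x + h/2) ^ N * c' x"
            using near[OF 2(2)] Q0[of x] h by (intro mult_nonneg_nonneg) auto
          then show ?thesis using 2 K0 by simp
        next
          case 3
          have "0 \<le> Q x + h/2" "Q x + h/2 \<le> 1" using far[OF x 3(2)] Q0[of x] h by auto
          then have "(Q x + h/2) ^ N \<le> 1" "0 \<le> (Q x + h/2) ^ N" by (auto intro: power_le_one)
          then have "\<bar>(Q x + h/2) ^ N * c' x\<bar> \<le> 1 * K'"
            unfolding abs_mult using c'_bound[of x] by (intro mult_mono) auto
          then show ?thesis using 3 by simp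
        qed
      qed
    qed (rule intg)
    also have "\<dots> = 0" by (rule zero)
    also have "(LINT x|cube_measure. (1 + h/4) ^ N / 2 * indicator S x - K') = (1 + h/4) ^ N / 2 * v - K'"
      using C.emeasure_finite[of S] C.prob_space
      by (subst Bochner_Integration.integral_diff)
        (auto simp: v_def less_top[symmetric] intro!: integrable_mult_right)
    finally show ?thesis by simp
  qed
  obtain N where "(1 + h/4) ^ N > 2 * K' / v"
    using real_arch_pow[of "1 + h/4"] h by auto
  then show False using bound[of N] v by (simp add: field_simps)
qed

end

section \<open>Orthonormal bases of eigenfunctions\<close>

text \<open>A bound at every point rather than almost everywhere, in keeping with eigenfunctions
  that satisfy their equation pointwise.\<close>

definition bounded_on_space :: "'s measure \<Rightarrow> ('s \<Rightarrow> complex) \<Rightarrow> bool" where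
  "bounded_on_space M f \<longleftrightarrow> f \<in> borel_measurable M \<and> (\<exists>K. \<forall>s\<in>space M. cmod (f s) \<le> K)"

lemma bounded_on_spaceI:
  "f \<in> borel_measurable M \<Longrightarrow> (\<And>s. s \<in> space M \<Longrightarrow> cmod (f s) \<le> K) \<Longrightarrow> bounded_on_space M f"
  by (auto simp: bounded_on_space_def)

lemma bounded_on_space_add:
  assumes "bounded_on_space M f" "bounded_on_space M g"
  shows "bounded_on_space M (\<lambda>s. f s + c * g s)"
proof -
  obtain K1 K2 where "\<And>s. s \<in> space M \<Longrightarrow> cmod (f s) \<le> K1" "\<And>s. s \<in> space M \<Longrightarrow> cmod (g s) \<le> K2"
    using assms by (auto simp: bounded_on_space_def)
  moreover have "cmod (f s + c * g s) \<le> cmod (f s) + cmod c * cmod (g s)" for s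
    by (metis norm_mult norm_triangle_ineq)
  ultimately have "cmod (f s + c * g s) \<le> K1 + cmod c * K2" if "s \<in> space M" for s
    using that by (meson add_mono mult_left_mono norm_ge_zero order_trans)
  then show ?thesis using assms by (auto simp: bounded_on_space_def)
qed

lemma borel_measurable_cnj [measurable (raw)]:
  "f \<in> borel_measurable M \<Longrightarrow> (\<lambda>x. cnj (f x)) \<in> borel_measurable M"
  by (rule measurable_compose[OF _ borel_measurable_continuous_onI]) (auto intro: continuous_intros)

section \<open>Inner products on a probability space\<close>

context prob_space
begin

lemma bounded_on_space_integrable: "bounded_on_space M f \<Longrightarrow> integrable M f"
  unfolding bounded_on_space_def by (auto intro!: integrable_const_bound AE_I2)

lemma L2_bounded_on_space:
  assumes "bounded_on_space M f"
  shows "L2 M f"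
proof -
  obtain K where K: "\<And>s. s \<in> space M \<Longrightarrow> cmod (f s) \<le> K" and [measurable]: "f \<in> borel_measurable M"
    using assms by (auto simp: bounded_on_space_def)
  have "integrable M (\<lambda>s. (cmod (f s))\<^sup>2)"
    using K by (intro integrable_const_bound[where B="K\<^sup>2"]) (auto intro!: AE_I2 power_mono)
  then show ?thesis by (simp add: L2_def)
qed

lemma L2_integrable:
  assumes "L2 M g"
  shows "integrable M g"
proof (rule Bochner_Integration.integrable_bound)
  show "integrable M (\<lambda>s. 1 + (cmod (g s))\<^sup>2)" using assms by (simp add: L2_def)
  show "g \<in> borel_measurable M" using assms by (simp add: L2_def)
  have "t \<le> 1 + t\<^sup>2" for t :: real
    using zero_le_power2[of "t - 1/2"] by (simp add: power2_eq_square algebra_simps)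
  then show "AE s in M. norm (g s) \<le> norm (1 + (cmod (g s))\<^sup>2)"
    by (intro AE_I2) (metis abs_ge_self order_trans real_norm_def)
qed

lemma integrable_mult_bounded:
  assumes g: "integrable M g" and f: "bounded_on_space M f"
  shows "integrable M (\<lambda>s. g s * cnj (f s))"
proof -
  obtain K where K: "\<And>s. s \<in> space M \<Longrightarrow> cmod (f s) \<le> K" and [measurable]: "f \<in> borel_measurable M"
    using f by (auto simp: bounded_on_space_def)
  have [measurable]: "g \<in> borel_measurable M" using g by simp
  show ?thesis
  proof (rule Bochner_Integration.integrable_bound)
    show "integrable M (\<lambda>s. K * cmod (g s))" using g by simp
    show "AE s in M. norm (g s * cnj (f s)) \<le> norm (K * cmod (g s))"
      using K by (intro AE_I2) (smt (verit) complex_mod_cnj mult.commute mult_right_mono norm_ge_zero norm_mult real_norm_def)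
  qed measurable
qed

lemma L2_inner_add_right:
  assumes "integrable M g" "bounded_on_space M f" "bounded_on_space M h"
  shows "L2_inner M g (\<lambda>s. f s + c * h s) = L2_inner M g f + cnj c * L2_inner M g h"
proof -
  have "(LINT s|M. g s * cnj (f s + c * h s)) = (LINT s|M. g s * cnj (f s) + cnj c * (g s * cnj (h s)))"
    by (simp add: algebra_simps)
  then show ?thesis
    using integrable_mult_bounded[OF assms(1,2)] integrable_mult_bounded[OF assms(1,3)]
    by (simp add: L2_inner_def)
qed

lemma L2_inner_cnj: "cnj (L2_inner M f g) = L2_inner M g f"
  unfolding L2_inner_def by (simp only: Bochner_Integration.integral_cnj[symmetric] complex_cnj_mult complex_cnj_cnj mult.commute)

lemma L2_inner_scale: "L2_inner M (\<lambda>s. c * f s) g = c * L2_inner M f g"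
  and L2_inner_scale_right: "L2_inner M f (\<lambda>s. c * g s) = cnj c * L2_inner M f g"
proof -
  show "L2_inner M (\<lambda>s. c * f s) g = c * L2_inner M f g"
    by (simp add: L2_inner_def mult.assoc)
  have "(LINT s|M. f s * cnj (c * g s)) = (LINT s|M. cnj c * (f s * cnj (g s)))" by (simp add: mult_ac)
  then show "L2_inner M f (\<lambda>s. c * g s) = cnj c * L2_inner M f g" by (simp add: L2_inner_def)
qed

lemma L2_inner_self:
  "L2_inner M f f = of_real (LINT s|M. (cmod (f s))\<^sup>2)"
  unfolding L2_inner_def integral_complex_of_real[symmetric]
  by (simp only: complex_norm_square)

lemma L2_inner_cong_AE:
  assumes "f \<in> borel_measurable M" "f' \<in> borel_measurable M" "g \<in> borel_measurable M" "AE s in M. f s = f' s"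
  shows "L2_inner M g f = L2_inner M g f'"
  unfolding L2_inner_def using assms by (intro integral_cong_AE) auto

lemma L2_inner_self_eq_0:
  assumes f: "bounded_on_space M f" and "L2_inner M f f = 0"
  shows "AE s in M. f s = 0"
proof -
  have int: "integrable M (\<lambda>s. (cmod (f s))\<^sup>2)" using L2_bounded_on_space[OF f] by (simp add: L2_def)
  have "(LINT s|M. (cmod (f s))\<^sup>2) = 0" using assms(2) by (simp add: L2_inner_self)
  then have "AE s in M. (cmod (f s))\<^sup>2 = 0" by (subst (asm) integral_nonneg_eq_0_iff_AE[OF int]) auto
  then show ?thesis by simp
qed

end

text \<open>Joint measurability, beyond that of each single map, allows integration along orbits and
  Fubini for the pair of a translation and a point.\<close>

locale measure_flow = prob_space M for M :: "'s measure" +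
  fixes \<tau> :: "real^'n::finite \<Rightarrow> 's \<Rightarrow> 's"
  assumes joint [measurable]: "(\<lambda>(x, s). \<tau> x s) \<in> borel \<Otimes>\<^sub>M M \<rightarrow>\<^sub>M M"
    and invariant: "distr M M (\<tau> x) = M"
    and flow_add: "s \<in> space M \<Longrightarrow> \<tau> x (\<tau> y s) = \<tau> (x + y) s"
    and flow_zero: "s \<in> space M \<Longrightarrow> \<tau> 0 s = s"
begin

definition eigen_everywhere :: "real^'n \<Rightarrow> ('s \<Rightarrow> complex) \<Rightarrow> bool" where
  "eigen_everywhere a f \<longleftrightarrow> bounded_on_space M f \<and>
     (\<forall>x. \<forall>s\<in>space M. f (\<tau> x s) = char_fun a x * f s)"

lemma flow_measurable [measurable]: "\<tau> x \<in> M \<rightarrow>\<^sub>M M"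
  using measurable_Pair2[OF joint, of x] by simp

lemma flow_space: "s \<in> space M \<Longrightarrow> \<tau> x s \<in> space M"
  using flow_measurable by (rule measurable_space)

lemma emeasure_flow:
  assumes [measurable]: "V \<in> sets M"
  shows "emeasure M {s\<in>space M. \<tau> x s \<in> V} = emeasure M V"
proof -
  have "emeasure M V = emeasure (distr M M (\<tau> x)) V" by (simp add: invariant)
  also have "\<dots> = emeasure M (\<tau> x -` V \<inter> space M)" by (subst emeasure_distr) auto
  also have "\<tau> x -` V \<inter> space M = {s\<in>space M. \<tau> x s \<in> V}" by auto
  finally show ?thesis by simp
qed

lemma eigen_everywhere_add:
  "eigen_everywhere a f \<Longrightarrow> eigen_everywhere a g \<Longrightarrow> eigen_everywhere a (\<lambda>s. f s + c * g s)"
  by (auto simp: eigen_everywhere_def algebra_simps intro: bounded_on_space_add)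

lemma eigen_everywhere_zero: "eigen_everywhere a (\<lambda>s. 0)"
  by (auto simp: eigen_everywhere_def intro: bounded_on_spaceI)

lemma eigen_everywhere_scale:
  "eigen_everywhere a f \<Longrightarrow> eigen_everywhere a (\<lambda>s. c * f s)"
  using eigen_everywhere_add[OF eigen_everywhere_zero] by simp

lemma eigen_orthogonal:
  assumes f: "eigen_everywhere a f" and g: "eigen_everywhere b g" and ab: "a \<noteq> b"
  shows "L2_inner M f g = 0"
proof -
  have [measurable]: "f \<in> borel_measurable M" "g \<in> borel_measurable M"
    using f g by (auto simp: eigen_everywhere_def bounded_on_space_def)
  \<comment> \<open>Chosen so that \<open>x\<close> has inner product 1/2 with \<open>a - b\<close>:
    the two characters differ by the factor -1 at \<open>x\<close>, and by invariance the inner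
    product equals its own negative.\<close>
  define x where "x = (1 / (2 * ((a - b) \<bullet> (a - b)))) *\<^sub>R (a - b)"
  have "x \<bullet> a - x \<bullet> b = x \<bullet> (a - b)" by (simp add: inner_diff_right)
  also have "\<dots> = 1/2" using ab by (simp add: x_def)
  finally have "x \<bullet> a - x \<bullet> b = 1/2" .
  have "char_fun a x * cnj (char_fun b x) = - 1"
  proof -
    have "2 * pi * (x \<bullet> a) + - (2 * pi * (x \<bullet> b)) = 2 * pi * (x \<bullet> a - x \<bullet> b)" by (simp add: algebra_simps)
    also have "\<dots> = pi" by (simp add: \<open>x \<bullet> a - x \<bullet> b = 1/2\<close>)
    finally show ?thesis by (simp only: char_fun_def cis_cnj cis_mult cis_pi)
  qed
  have "L2_inner M f g = (LINT s|distr M M (\<tau> x). f s * cnj (g s))"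
    by (simp add: L2_inner_def invariant)
  also have "\<dots> = (LINT s|M. f (\<tau> x s) * cnj (g (\<tau> x s)))" by (rule integral_distr) auto
  also have "\<dots> = (LINT s|M. (char_fun a x * cnj (char_fun b x)) * (f s * cnj (g s)))"
    using f g by (intro Bochner_Integration.integral_cong) (auto simp: eigen_everywhere_def)
  also have "\<dots> = - L2_inner M f g"
    by (simp add: \<open>char_fun a x * cnj (char_fun b x) = - 1\<close> L2_inner_def)
  finally show ?thesis by simp
qed

text \<open>Since \<open>1 / sqrt 0\<close> is 0, a residual of norm 0 gives the zero function, so
  linearly dependent families are processed without pruning.\<close>

fun gram_schmidt :: "(nat \<Rightarrow> 's \<Rightarrow> complex) \<Rightarrow> nat \<Rightarrow> 's \<Rightarrow> complex" where
  "gram_schmidt e i =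
     (let r = (\<lambda>s. e i s - (\<Sum>j<i. L2_inner M (e i) (gram_schmidt e j) * gram_schmidt e j s))
      in (\<lambda>s. of_real (1 / sqrt (Re (L2_inner M r r))) * r s))"

declare gram_schmidt.simps [simp del]

definition residual :: "(nat \<Rightarrow> 's \<Rightarrow> complex) \<Rightarrow> nat \<Rightarrow> 's \<Rightarrow> complex" where
  "residual e i s = e i s - (\<Sum>j<i. L2_inner M (e i) (gram_schmidt e j) * gram_schmidt e j s)"

lemma gram_schmidt_residual:
  "gram_schmidt e i = (\<lambda>s. of_real (1 / sqrt (Re (L2_inner M (residual e i) (residual e i)))) * residual e i s)"
  unfolding residual_def[abs_def] by (subst gram_schmidt.simps) (simp add: Let_def)

section \<open>Gram-Schmidt for eigenfunctions of varying frequency\<close>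

context
  fixes e :: "nat \<Rightarrow> 's \<Rightarrow> complex" and a :: "nat \<Rightarrow> real^'n"
  assumes eig: "\<And>i. eigen_everywhere (a i) (e i)"
begin

text \<open>Subtracting a function of another frequency would destroy the eigenvalue equation, but
  orthogonality makes its coefficient 0; only terms of equal frequency are really
  subtracted.\<close>

lemma eigen_residual_gram_schmidt:
  "eigen_everywhere (a i) (residual e i) \<and> eigen_everywhere (a i) (gram_schmidt e i)"
proof (induction i rule: less_induct)
  case (less i)
  have sum: "eigen_everywhere (a i) (\<lambda>s. e i s - (\<Sum>j\<in>J. L2_inner M (e i) (gram_schmidt e j) * gram_schmidt e j s))"
    if "finite J" "J \<subseteq> {..<i}" for J
    using that
  proof (induction J rule: finite_induct)
    case empty
    then show ?case using eig by simp
  next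
    case (insert j J)
    let ?f = "\<lambda>s. e i s - (\<Sum>j\<in>J. L2_inner M (e i) (gram_schmidt e j) * gram_schmidt e j s)"
    have f: "eigen_everywhere (a i) ?f" using insert by simp
    have j: "eigen_everywhere (a j) (gram_schmidt e j)" using insert less by auto
    have "eigen_everywhere (a i) (\<lambda>s. ?f s + (- L2_inner M (e i) (gram_schmidt e j)) * gram_schmidt e j s)"
    proof (cases "a i = a j")
      case True
      then have "eigen_everywhere (a i) (gram_schmidt e j)" using j by simp
      then show ?thesis by (rule eigen_everywhere_add[OF f])
    next
      case False
      then show ?thesis using eigen_orthogonal[OF eig j] f by simp
    qed
    then show ?case using insert by (simp add: algebra_simps)
  qed
  then have "eigen_everywhere (a i) (residual e i)" unfolding residual_def[abs_def] by simp
  then show ?case unfolding gram_schmidt_residual[of e i] by (intro conjI eigen_everywhere_scale)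
qed

lemma bounded_gram_schmidt: "bounded_on_space M (gram_schmidt e i)"
  and bounded_residual: "bounded_on_space M (residual e i)"
  and bounded_e: "bounded_on_space M (e i)"
  using eigen_residual_gram_schmidt[of i] eig[of i] by (auto simp: eigen_everywhere_def)

lemma gram_schmidt_norm:
  "(\<forall>s. gram_schmidt e i s = 0) \<and> (AE s in M. residual e i s = 0) \<or> L2_inner M (gram_schmidt e i) (gram_schmidt e i) = 1"
proof -
  define q where "q = (LINT s|M. (cmod (residual e i s))\<^sup>2)"
  have q: "L2_inner M (residual e i) (residual e i) = of_real q" unfolding q_def by (rule L2_inner_self)
  have "q \<ge> 0" unfolding q_def by simp
  show ?thesis
  proof (cases "q = 0")
    case True
    then show ?thesis
      using L2_inner_self_eq_0[OF bounded_residual, of i] q by (simp add: gram_schmidt_residual[of e i])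
  next
    case False
    then have "q > 0" using \<open>q \<ge> 0\<close> by simp
    have "L2_inner M (gram_schmidt e i) (gram_schmidt e i)
        = of_real (1 / sqrt q) * (of_real (1 / sqrt q) * of_real q)"
      unfolding gram_schmidt_residual[of e i] q Re_complex_of_real L2_inner_scale L2_inner_scale_right
      by (simp add: q)
    also have "\<dots> = of_real (1 / sqrt q * (1 / sqrt q * q))" by (simp only: of_real_mult)
    also have "1 / sqrt q * (1 / sqrt q * q) = 1"
      using \<open>q > 0\<close> by (simp add: field_simps)
    finally show ?thesis by simp
  qed
qed

text \<open>The sum is built up one index at a time, and boundedness of the partial residuals is
  carried along because additivity of the inner product relies on it.\<close>

lemma L2_inner_residual_right:
  assumes g: "integrable M g"
  shows "L2_inner M g (residual e i)
    = L2_inner M g (e i) - (\<Sum>j<i. cnj (L2_inner M (e i) (gram_schmidt e j)) * L2_inner M g (gram_schmidt e j))"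
proof -
  have "L2_inner M g (\<lambda>s. e i s - (\<Sum>j\<in>J. L2_inner M (e i) (gram_schmidt e j) * gram_schmidt e j s))
    = L2_inner M g (e i) - (\<Sum>j\<in>J. cnj (L2_inner M (e i) (gram_schmidt e j)) * L2_inner M g (gram_schmidt e j))
    \<and> bounded_on_space M (\<lambda>s. e i s - (\<Sum>j\<in>J. L2_inner M (e i) (gram_schmidt e j) * gram_schmidt e j s))"
    if "finite J" for J
    using that
  proof (induction J rule: finite_induct)
    case empty
    then show ?case using bounded_e by simp
  next
    case (insert j J)
    define f where "f s = e i s - (\<Sum>j\<in>J. L2_inner M (e i) (gram_schmidt e j) * gram_schmidt e j s)" for s
    define c where "c = - L2_inner M (e i) (gram_schmidt e j)"
    have f: "bounded_on_space M f"
      and f_inner: "L2_inner M g f = L2_inner M g (e i)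
        - (\<Sum>j\<in>J. cnj (L2_inner M (e i) (gram_schmidt e j)) * L2_inner M g (gram_schmidt e j))"
      using insert.IH unfolding f_def[abs_def] by auto
    have eq: "(\<lambda>s. e i s - (\<Sum>j\<in>insert j J. L2_inner M (e i) (gram_schmidt e j) * gram_schmidt e j s))
        = (\<lambda>s. f s + c * gram_schmidt e j s)"
      using insert.hyps by (simp add: f_def c_def algebra_simps)
    have "L2_inner M g (\<lambda>s. f s + c * gram_schmidt e j s)
        = L2_inner M g f + cnj c * L2_inner M g (gram_schmidt e j)"
      by (rule L2_inner_add_right[OF g f bounded_gram_schmidt])
    then show ?case unfolding eq f_inner using insert.hyps bounded_on_space_add[OF f bounded_gram_schmidt, of c j]
      by (simp add: c_def)
  qed
  from this[of "{..<i}"] show ?thesis by (simp add: residual_def[abs_def])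
qed

text \<open>Strong induction on the larger index: when a residual is paired with an earlier vector,
  only that vector's own term survives in the sum, and it cancels the leading one.\<close>

lemma gram_schmidt_orthogonal: "i \<noteq> j \<Longrightarrow> L2_inner M (gram_schmidt e i) (gram_schmidt e j) = 0"
proof -
  have *: "j < i \<Longrightarrow> L2_inner M (gram_schmidt e j) (gram_schmidt e i) = 0" for i j
  proof (induction i arbitrary: j rule: less_induct)
    case (less i)
    have "L2_inner M (gram_schmidt e j) (residual e i) = 0"
    proof (cases "\<forall>s. gram_schmidt e j s = 0")
      case True
      then show ?thesis by (simp add: L2_inner_def)
    next
      case False
      then have 1: "L2_inner M (gram_schmidt e j) (gram_schmidt e j) = 1" using gram_schmidt_norm by blast
      have 0: "L2_inner M (gram_schmidt e j) (gram_schmidt e k) = 0" if "k < i" "k \<noteq> j" for k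
      proof (cases "j < k")
        case True
        then show ?thesis using less that by simp
      next
        case False
        then have "L2_inner M (gram_schmidt e k) (gram_schmidt e j) = 0" using less that by simp
        then show ?thesis using L2_inner_cnj[of "gram_schmidt e k" "gram_schmidt e j"] by simp
      qed
      have "(\<Sum>k<i. cnj (L2_inner M (e i) (gram_schmidt e k)) * L2_inner M (gram_schmidt e j) (gram_schmidt e k))
          = (\<Sum>k\<in>{j}. cnj (L2_inner M (e i) (gram_schmidt e k)) * L2_inner M (gram_schmidt e j) (gram_schmidt e k))"
        using less(2) 0 by (intro sum.mono_neutral_right) auto
      then show ?thesis
        by (simp add: L2_inner_residual_right bounded_on_space_integrable bounded_gram_schmidt 1 L2_inner_cnj)
    qed
    then show ?case
      unfolding gram_schmidt_residual[of e i] by (simp only: L2_inner_scale_right) simp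
  qed
  show "i \<noteq> j \<Longrightarrow> ?thesis"
    using *[of i j] *[of j i] L2_inner_cnj[of "gram_schmidt e j" "gram_schmidt e i"]
    by (cases "i < j") auto
qed

text \<open>Dropping the vanishing vectors loses nothing: each \<open>e i\<close> is its residual
  plus earlier vectors, and a residual is either a multiple of a retained vector or zero almost
  everywhere.\<close>

lemma orthonormal_eigenbasis:
  assumes complete: "\<And>g. L2 M g \<Longrightarrow> (\<And>i. L2_inner M g (e i) = 0) \<Longrightarrow> AE s in M. g s = 0"
  shows "\<exists>B. (\<forall>f\<in>B. \<exists>a. eigen_everywhere a f) \<and> (\<forall>f\<in>B. L2_inner M f f = 1) \<and>
    (\<forall>f\<in>B. \<forall>g\<in>B. f \<noteq> g \<longrightarrow> L2_inner M f g = 0) \<and>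
    (\<forall>g. L2 M g \<and> (\<forall>f\<in>B. L2_inner M g f = 0) \<longrightarrow> (AE s in M. g s = 0))"
proof -
  define B where "B = {gram_schmidt e i | i. L2_inner M (gram_schmidt e i) (gram_schmidt e i) = 1}"
  have "AE s in M. g s = 0" if g: "L2 M g" and gB: "\<forall>f\<in>B. L2_inner M g f = 0" for g
  proof (rule complete[OF g])
    fix i
    have gi: "integrable M g" by (rule L2_integrable[OF g])
    have go: "L2_inner M g (gram_schmidt e j) = 0" for j
    proof (cases "L2_inner M (gram_schmidt e j) (gram_schmidt e j) = 1")
      case True
      then show ?thesis using gB by (auto simp: B_def)
    next
      case False
      then show ?thesis using gram_schmidt_norm[of j] by (auto simp: L2_inner_def)
    qed
    have "L2_inner M g (residual e i) = 0"
    proof (cases "L2_inner M (gram_schmidt e i) (gram_schmidt e i) = 1")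
      case True
      let ?c = "1 / sqrt (Re (L2_inner M (residual e i) (residual e i)))"
      have "?c \<noteq> 0" using True by (auto simp: gram_schmidt_residual[of e i] L2_inner_def)
      moreover have "of_real ?c * L2_inner M g (residual e i) = 0"
        using go[of i] unfolding gram_schmidt_residual[of e i] L2_inner_scale_right by simp
      ultimately show ?thesis by (metis mult_eq_0_iff of_real_eq_0_iff)
    next
      case False
      then have "AE s in M. residual e i s = 0" using gram_schmidt_norm[of i] by auto
      then have "L2_inner M g (residual e i) = L2_inner M g (\<lambda>_. 0)"
        using bounded_residual[of i] gi by (intro L2_inner_cong_AE) (auto simp: bounded_on_space_def)
      then show ?thesis by (simp add: L2_inner_def)
    qed
    then show "L2_inner M g (e i) = 0" using L2_inner_residual_right[OF gi, of i] by (simp add: go)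
  qed
  moreover have "\<forall>f\<in>B. \<exists>a. eigen_everywhere a f" using eigen_residual_gram_schmidt by (auto simp: B_def)
  moreover have "\<forall>f\<in>B. \<forall>g\<in>B. f \<noteq> g \<longrightarrow> L2_inner M f g = 0"
    using gram_schmidt_orthogonal by (auto simp: B_def) metis
  moreover have "\<forall>f\<in>B. L2_inner M f f = 1" by (auto simp: B_def)
  ultimately show ?thesis by (intro exI[of _ B] conjI) blast+
qed

end

end

section \<open>Fourier coefficients along orbits\<close>

context measure_flow
begin

lemma flow_measurable_comp [measurable (raw)]:
  "f \<in> N \<rightarrow>\<^sub>M borel \<Longrightarrow> g \<in> N \<rightarrow>\<^sub>M M \<Longrightarrow> (\<lambda>w. \<tau> (f w) (g w)) \<in> N \<rightarrow>\<^sub>M M"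
  using measurable_compose[OF measurable_Pair joint, of f N g] by simp

text \<open>The Fourier coefficient at \<open>m\<close> of the function that records, along the
  orbit of \<open>s\<close> in the coordinates given by \<open>B\<close>, the visits to
  \<open>V\<close>.\<close>

definition box_coeff :: "'s set \<Rightarrow> (real^'n \<Rightarrow> real^'n) \<Rightarrow> real^'n \<Rightarrow> 's \<Rightarrow> complex" where
  "box_coeff V B m s = (LINT x|cube_measure. char_fun (- m) x * indicator V (\<tau> (B x) s))"

definition periodic_set :: "(real^'n \<Rightarrow> real^'n) \<Rightarrow> 's set \<Rightarrow> bool" where
  "periodic_set B V \<longleftrightarrow> (\<forall>s\<in>space M. \<forall>k\<in>Zvec. \<tau> (B k) s \<in> V \<longleftrightarrow> s \<in> V)"

text \<open>Openness is asked along orbits alone, so the space carries no topology; the sequential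
  form feeds dominated convergence directly.\<close>

definition orbitwise_open :: "'s set \<Rightarrow> bool" where
  "orbitwise_open V \<longleftrightarrow> (\<forall>s\<in>V. \<forall>h. h \<longlonglongrightarrow> 0 \<longrightarrow> (\<forall>\<^sub>F n in sequentially. \<tau> (h n) s \<in> V))"

context
  fixes V :: "'s set" and B :: "real^'n \<Rightarrow> real^'n"
  assumes V [measurable]: "V \<in> sets M" and lin: "linear B" and bij: "bij B"
    and per: "periodic_set B V"
begin

lemma linear_borel [measurable]: "B \<in> borel_measurable borel"
  by (rule linear_borel_measurable[OF lin])

lemma bounded_box_coeff: "bounded_on_space M (box_coeff V B m)"
proof (rule bounded_on_spaceI)
  interpret C: prob_space "cube_measure :: (real^'n) measure" by (rule prob_space_cube_measure)
  show "box_coeff V B m \<in> borel_measurable M"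
    unfolding box_coeff_def[abs_def] by (rule C.borel_measurable_lebesgue_integral) measurable
  fix s
  have "cmod (box_coeff V B m s) \<le> (LINT x|cube_measure. cmod (char_fun (- m) x * indicator V (\<tau> (B x) s)))"
    unfolding box_coeff_def by (rule integral_norm_bound)
  also have "\<dots> \<le> (LINT x|(cube_measure :: (real^'n) measure). 1)"
  proof (rule integral_mono')
    show "integrable (cube_measure :: (real^'n) measure) (\<lambda>x. 1::real)" by simp
  qed (auto simp: norm_mult split: split_indicator)
  also have "\<dots> = 1" using C.prob_space by simp
  finally show "cmod (box_coeff V B m s) \<le> 1" .
qed

text \<open>Moving \<open>s\<close> by \<open>y = B z\<close> shifts the integration variable by
  \<open>z\<close>, which by periodicity costs only the factor \<open>char_fun m z\<close>. The
  frequency is an element of the lattice dual to the periods.\<close>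

lemma eigen_box_coeff:
  assumes m: "m \<in> Zvec"
  shows "eigen_everywhere (adjoint (inv B) m) (box_coeff V B m)"
  unfolding eigen_everywhere_def
proof (intro conjI bounded_box_coeff allI ballI)
  fix y s assume s [measurable]: "s \<in> space M"
  define z where "z = inv B y"
  have y: "y = B z" using bij by (simp add: z_def bij_is_surj surj_f_inv_f)
  have linv: "linear (inv B)" by (rule inj_linear_imp_inv_linear[OF lin bij_is_inj[OF bij]])
  have ch: "char_fun (adjoint (inv B) m) y = char_fun m z"
    by (simp add: char_fun_def adjoint_works[OF linv] z_def)
  define F where "F x = char_fun (- m) x * indicator V (\<tau> (B x) s)" for x
  have [measurable]: "F \<in> borel_measurable borel" unfolding F_def[abs_def] by measurable
  have F: "F (x + k) = F x" if k: "k \<in> Zvec" for x k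
  proof -
    have "\<tau> (B (x + k)) s = \<tau> (B k) (\<tau> (B x) s)" using s by (simp add: flow_add linear_add[OF lin] add.commute)
    then have "\<tau> (B (x + k)) s \<in> V \<longleftrightarrow> \<tau> (B x) s \<in> V"
      using per k s by (simp add: periodic_set_def flow_space)
    then show ?thesis by (simp add: F_def char_fun_add char_fun_Zvec k m Zvec_uminus indicator_def)
  qed
  have unit: "char_fun m z * char_fun (- m) z = 1"
    by (simp add: char_fun_uminus) (simp add: char_fun_def cis_cnj cis_mult)
  have "box_coeff V B m (\<tau> y s) = (LINT x|cube_measure. char_fun m z * F (x + z))"
    unfolding box_coeff_def
  proof (rule Bochner_Integration.integral_cong[OF refl])
    fix x
    have "char_fun m z * F (x + z) = (char_fun m z * char_fun (- m) z) * (char_fun (- m) x * indicator V (\<tau> (B (x + z)) s))"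
      by (simp add: F_def char_fun_add mult_ac)
    then show "char_fun (- m) x * indicator V (\<tau> (B x) (\<tau> y s)) = char_fun m z * F (x + z)"
      using s unfolding unit y by (simp add: flow_add linear_add[OF lin])
  qed
  also have "\<dots> = char_fun m z * (LINT x|cube_measure. F x)"
    using integral_cube_shift[of F z] F by simp
  finally show "box_coeff V B m (\<tau> y s) = char_fun (adjoint (inv B) m) y * box_coeff V B m s"
    by (simp add: ch box_coeff_def F_def)
qed

lemma measure_leaving_tendsto_0:
  assumes "orbitwise_open V" and h: "h \<longlonglongrightarrow> 0"
  shows "(\<lambda>n. LINT s|M. indicator V s * (1 - indicator V (\<tau> (h n) s)) :: real) \<longlonglongrightarrow> 0"
proof -
  have "(\<lambda>n. LINT s|M. indicator V s * (1 - indicator V (\<tau> (h n) s)) :: real) \<longlonglongrightarrow> (LINT s|M. 0)"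
  proof (rule integral_dominated_convergence[where w="\<lambda>_. 1"])
    show "AE s in M. (\<lambda>n. indicator V s * (1 - indicator V (\<tau> (h n) s)) :: real) \<longlonglongrightarrow> 0"
    proof (intro AE_I2)
      fix s
      show "(\<lambda>n. indicator V s * (1 - indicator V (\<tau> (h n) s)) :: real) \<longlonglongrightarrow> 0"
      proof (cases "s \<in> V")
        case True
        with assms have "\<forall>\<^sub>F n in sequentially. \<tau> (h n) s \<in> V" by (simp add: orbitwise_open_def)
        then have "\<forall>\<^sub>F n in sequentially. indicator V s * (1 - indicator V (\<tau> (h n) s)) = (0::real)"
          by eventually_elim simp
        then show ?thesis by (rule tendsto_eventually)
      qed simp
    qed
  qed (auto split: split_indicator)
  then show ?thesis by simp
qed

text \<open>As \<open>g\<close> is merely square integrable, the inequality a \<le> e a^2 + 1/e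
  separates it from the set where the two indicators differ: the first part is small with
  \<open>e\<close>, the second for fixed \<open>e\<close> as n grows.\<close>

lemma correlation_continuous_at_0:
  assumes "orbitwise_open V" and g: "L2 M g"
  shows "isCont (\<lambda>x. LINT s|M. g s * indicator V (\<tau> (B x) s)) 0"
  unfolding continuous_at_sequentially
proof (intro allI impI)
  fix x :: "nat \<Rightarrow> real^'n" assume x: "x \<longlonglongrightarrow> 0"
  define h where "h n = B (x n)" for n
  have "isCont B 0" using lin by (simp add: linear_continuous_at linear_conv_bounded_linear)
  then have "h \<longlonglongrightarrow> B 0" unfolding h_def using x isCont_tendsto_compose by blast
  then have h: "h \<longlonglongrightarrow> 0" using linear_0[OF lin] by simp
  define c where "c x = (LINT s|M. g s * indicator V (\<tau> (B x) s))" for x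
  define t where "t n = (LINT s|M. indicator V s * (1 - indicator V (\<tau> (h n) s)) :: real)" for n
  have t: "t \<longlonglongrightarrow> 0" unfolding t_def by (rule measure_leaving_tendsto_0[OF assms(1) h])
  define G where "G = (LINT s|M. (cmod (g s))\<^sup>2)"
  have G: "G \<ge> 0" by (simp add: G_def)
  have gm [measurable]: "g \<in> borel_measurable M" and g2: "integrable M (\<lambda>s. (cmod (g s))\<^sup>2)"
    using g by (auto simp: L2_def)
  have g1: "integrable M g" by (rule L2_integrable[OF g])
  have gI: "integrable M (\<lambda>s. g s * indicator V (\<tau> y s))" for y
    by (rule Bochner_Integration.integrable_bound[OF g1]) (auto split: split_indicator)
  have bound: "cmod (c (x n) - c 0) \<le> e * G + 2 * t n / e" if e: "e > 0" for n e
  proof -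
    define d :: "'s \<Rightarrow> real" where "d s = \<bar>indicator V (\<tau> (h n) s) - indicator V s\<bar>" for s
    have [measurable]: "d \<in> borel_measurable M" unfolding d_def[abs_def] by measurable
    have dI: "integrable M d"
      by (rule integrable_const_bound[where B=1]) (auto simp: d_def split: split_indicator)
    have iI: "integrable M (\<lambda>s. indicator V (\<tau> y s) :: real)" "integrable M (\<lambda>s. indicator V s * (1 - indicator V (\<tau> y s)) :: real)" for y
      by (auto intro!: integrable_const_bound[where B=1] split: split_indicator)
    \<comment> \<open>The flow preserves the measure of \<open>V\<close>, so as much mass enters
      \<open>V\<close> as leaves it; the symmetric difference has twice the mass \<open>t n\<close>
      that leaves.\<close>
    have "(LINT s|M. d s) = (LINT s|M. (indicator V (\<tau> (h n) s) - indicator V s) + 2 * (indicator V s * (1 - indicator V (\<tau> (h n) s))))"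
      by (intro Bochner_Integration.integral_cong) (auto simp: d_def split: split_indicator)
    also have "\<dots> = (LINT s|M. indicator V (\<tau> (h n) s)) - (LINT s|M. indicator V s) + 2 * t n"
      using iI(1)[of "h n"] iI(2)[of "h n"] by (simp add: t_def less_top[symmetric])
    also have "(LINT s|M. indicator V (\<tau> (h n) s)) = (LINT s|distr M M (\<tau> (h n)). indicator V s :: real)"
      by (subst integral_distr) auto
    finally have td: "(LINT s|M. d s) = 2 * t n" by (simp add: invariant)
    have "c (x n) - c 0 = (LINT s|M. g s * indicator V (\<tau> (h n) s) - g s * indicator V (\<tau> 0 s))"
      using gI by (simp add: c_def h_def linear_0[OF lin])
    also have "cmod \<dots> \<le> (LINT s|M. cmod (g s * indicator V (\<tau> (h n) s) - g s * indicator V (\<tau> 0 s)))"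
      by (rule integral_norm_bound)
    also have "\<dots> \<le> (LINT s|M. e * (cmod (g s))\<^sup>2 + d s / e)"
    proof (rule integral_mono)
      show "integrable M (\<lambda>s. cmod (g s * indicator V (\<tau> (h n) s) - g s * indicator V (\<tau> 0 s)))"
        by (intro integrable_norm Bochner_Integration.integrable_diff gI)
      show "integrable M (\<lambda>s. e * (cmod (g s))\<^sup>2 + d s / e)" using g2 dI by simp
      fix s assume s: "s \<in> space M"
      have "a \<le> e * a\<^sup>2 + 1 / e" for a :: real
      proof -
        have "0 \<le> (e * a - 1/2)\<^sup>2" by simp
        then have "e * a \<le> (e * a)\<^sup>2 + 1" by (simp add: power2_eq_square algebra_simps)
        also have "(e * a)\<^sup>2 + 1 = e * (e * a\<^sup>2 + 1 / e)" using e by (simp add: power2_eq_square field_simps)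
        finally have "e * a \<le> e * (e * a\<^sup>2 + 1 / e)" .
        then show ?thesis using e by simp
      qed
      then show "cmod (g s * indicator V (\<tau> (h n) s) - g s * indicator V (\<tau> 0 s)) \<le> e * (cmod (g s))\<^sup>2 + d s / e"
        using e s by (auto simp: d_def flow_zero split: split_indicator)
    qed
    also have "\<dots> = e * G + 2 * t n / e" using g2 dI by (simp add: G_def td)
    finally show ?thesis .
  qed
  have "(\<lambda>n. c (x n)) \<longlonglongrightarrow> c 0"
  proof (rule LIMSEQ_I)
    fix r :: real assume r: "r > 0"
    define e where "e = r / (2 * (G + 1))"
    have e: "e > 0" "e * G < r / 2" using r G by (auto simp: e_def field_simps)
    have "r * e / 4 > 0" using r e by simp
    from order_tendstoD(2)[OF t this] obtain N where N: "\<And>n. n \<ge> N \<Longrightarrow> t n < r * e / 4"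
      by (auto simp: eventually_sequentially)
    have "norm (c (x n) - c 0) < r" if "n \<ge> N" for n
    proof -
      have "2 * t n / e < r / 2" using N[OF that] e by (simp add: field_simps)
      then show ?thesis using bound[OF e(1), of n] e(2) by simp
    qed
    then show "\<exists>no. \<forall>n\<ge>no. norm (c (x n) - c 0) < r" by blast
  qed
  then show "((\<lambda>x. LINT s|M. g s * indicator V (\<tau> (B x) s)) \<circ> x) \<longlonglongrightarrow> (LINT s|M. g s * indicator V (\<tau> (B 0) s))"
    by (simp add: c_def[abs_def] comp_def)
qed

text \<open>By Fubini, the correlation of \<open>g\<close> with \<open>V\<close> moved by
  \<open>B x\<close> has as Fourier coefficients in x the inner products of \<open>g\<close> with
  the \<open>box_coeff\<close>. They vanish, so by continuity at 0 the correlation vanishes there,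
  and its value at 0 is the integral in question.\<close>

lemma integral_periodic_set_eq_0:
  assumes "orbitwise_open V" and g: "L2 M g"
    and orth: "\<And>m. m \<in> Zvec \<Longrightarrow> L2_inner M g (box_coeff V B m) = 0"
  shows "(LINT s|M. g s * indicator V s) = 0"
proof -
  interpret C: prob_space "cube_measure :: (real^'n) measure" by (rule prob_space_cube_measure)
  interpret P: pair_sigma_finite M "cube_measure :: (real^'n) measure" ..
  define c where "c x = (LINT s|M. g s * indicator V (\<tau> (B x) s))" for x
  have gm [measurable]: "g \<in> borel_measurable M" using g by (simp add: L2_def)
  have g1: "integrable M g" by (rule L2_integrable[OF g])
  have cm: "c \<in> borel_measurable borel"
    unfolding c_def[abs_def] by (rule borel_measurable_lebesgue_integral) measurable
  have cb: "cmod (c x) \<le> (LINT s|M. cmod (g s))" for x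
  proof -
    have "cmod (c x) \<le> (LINT s|M. cmod (g s * indicator V (\<tau> (B x) s)))"
      unfolding c_def by (rule integral_norm_bound)
    also have "\<dots> \<le> (LINT s|M. cmod (g s))"
      using g1 by (intro integral_mono') (auto split: split_indicator)
    finally show ?thesis .
  qed
  have "c 0 = 0"
  proof (rule fourier_uniqueness_at_0[OF cm cb])
    show "isCont c 0" unfolding c_def[abs_def] by (rule correlation_continuous_at_0[OF assms(1) g])
    fix m :: "real^'n" assume m: "m \<in> Zvec"
    define F where "F s x = g s * (char_fun m x * indicator V (\<tau> (B x) s))" for s x
    have FI: "integrable (M \<Otimes>\<^sub>M cube_measure) (case_prod F)"
    proof (rule Bochner_Integration.integrable_bound)
      have "integrable (distr (M \<Otimes>\<^sub>M (cube_measure :: (real^'n) measure)) M fst) g"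
        using g1 by (simp add: C.distr_pair_fst)
      then show "integrable (M \<Otimes>\<^sub>M (cube_measure :: (real^'n) measure)) (\<lambda>p. g (fst p))"
        by (subst (asm) integrable_distr_eq) auto
      show "case_prod F \<in> borel_measurable (M \<Otimes>\<^sub>M cube_measure)" unfolding F_def by measurable
    qed (auto simp: F_def norm_mult split: split_indicator)
    have "0 = (LINT s|M. g s * cnj (box_coeff V B m s))" using orth[OF m] by (simp add: L2_inner_def)
    also have "\<dots> = (LINT s|M. LINT x|cube_measure. F s x)"
    proof (rule Bochner_Integration.integral_cong[OF refl])
      fix s
      have "cnj (box_coeff V B m s) = (LINT x|cube_measure. cnj (char_fun (- m) x * indicator V (\<tau> (B x) s)))"
        unfolding box_coeff_def by (rule Bochner_Integration.integral_cnj[symmetric])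
      also have "\<dots> = (LINT x|cube_measure. char_fun m x * indicator V (\<tau> (B x) s))"
        by (intro Bochner_Integration.integral_cong) (auto simp: char_fun_uminus indicator_def)
      finally show "g s * cnj (box_coeff V B m s) = (LINT x|cube_measure. F s x)" by (simp add: F_def)
    qed
    also have "\<dots> = (LINT x|cube_measure. LINT s|M. F s x)"
      by (rule P.Fubini_integral[OF FI, symmetric])
    also have "\<dots> = (LINT x|cube_measure. char_fun m x * c x)"
    proof (rule Bochner_Integration.integral_cong[OF refl])
      fix x
      have "(LINT s|M. F s x) = (LINT s|M. char_fun m x * (g s * indicator V (\<tau> (B x) s)))"
        by (simp add: F_def mult_ac)
      then show "(LINT s|M. F s x) = char_fun m x * c x" by (simp add: c_def)
    qed
    finally show "(LINT x|cube_measure. char_fun m x * c x) = 0" by simp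
  qed
  moreover have "c 0 = (LINT s|M. g s * indicator V s)"
    unfolding c_def linear_0[OF lin] by (intro Bochner_Integration.integral_cong) (auto simp: flow_zero)
  ultimately show ?thesis by simp
qed

end

text \<open>Pairs of an event and an integer vector are enumerated by the naturals; a function that
  occurs repeatedly is harmless, as Gram-Schmidt turns repetitions into 0.\<close>

theorem periodic_sets_eigenbasis:
  assumes count: "countable \<V>" and ne: "\<V> \<noteq> {}"
    and \<V>: "\<And>V B. (V, B) \<in> \<V> \<Longrightarrow> V \<in> sets M \<and> linear B \<and> bij B \<and> periodic_set B V \<and> orbitwise_open V"
    and gen: "\<And>g. L2 M g \<Longrightarrow> (\<And>V B. (V, B) \<in> \<V> \<Longrightarrow> (LINT s|M. g s * indicator V s) = 0) \<Longrightarrow> AE s in M. g s = 0"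
  shows "\<exists>B. (\<forall>f\<in>B. \<exists>a. eigen_everywhere a f) \<and> (\<forall>f\<in>B. L2_inner M f f = 1) \<and>
    (\<forall>f\<in>B. \<forall>g\<in>B. f \<noteq> g \<longrightarrow> L2_inner M f g = 0) \<and>
    (\<forall>g. L2 M g \<and> (\<forall>f\<in>B. L2_inner M g f = 0) \<longrightarrow> (AE s in M. g s = 0))"
proof -
  define I where "I = \<V> \<times> (Zvec :: (real^'n) set)"
  have I: "countable I" "I \<noteq> {}" using count ne zero_Zvec by (auto simp: I_def countable_Zvec)
  define v where "v i = fst (fst (from_nat_into I i))" for i
  define b where "b i = snd (fst (from_nat_into I i))" for i
  define m where "m i = snd (from_nat_into I i)" for i
  have vbm: "(v i, b i) \<in> \<V>" "m i \<in> Zvec" for i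
    using from_nat_into[OF I(2), of i] by (auto simp: I_def v_def b_def m_def)
  show ?thesis
  proof (rule orthonormal_eigenbasis)
    show "eigen_everywhere (adjoint (inv (b i)) (m i)) (box_coeff (v i) (b i) (m i))" for i
      using \<V>[OF vbm(1)] vbm(2) by (intro eigen_box_coeff) auto
    fix g assume g: "L2 M g" and orth: "\<And>i. L2_inner M g (box_coeff (v i) (b i) (m i)) = 0"
    show "AE s in M. g s = 0"
    proof (rule gen[OF g])
      fix V B assume VB: "(V, B) \<in> \<V>"
      have "L2_inner M g (box_coeff V B k) = 0" if "k \<in> Zvec" for k
      proof -
        have "((V, B), k) \<in> I" using VB that by (simp add: I_def)
        then obtain i where "from_nat_into I i = ((V, B), k)" using from_nat_into_surj[OF I(1)] by blast
        then show ?thesis using orth[of i] by (simp add: v_def b_def m_def)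
      qed
      then show "(LINT s|M. g s * indicator V s) = 0"
        using \<V>[OF VB] g by (intro integral_periodic_set_eq_0) auto
    qed
  qed
qed

end

section \<open>Tiles and the hull\<close>

lemma tr_tr: "tr (tr T x) y = tr T (x + y)"
  by (simp add: tr_def image_image add.assoc)

lemma tr_0 [simp]: "tr T 0 = T"
  by (simp add: tr_def)

lemma mem_supp_tr: "z \<in> supp (tr T x) \<longleftrightarrow> z - x \<in> supp T"
  by (auto simp: supp_def tr_def image_iff intro: bexI[of _ "z - x"])

lemma supp_tr_eq_empty [simp]: "supp (tr T x) = {} \<longleftrightarrow> supp T = {}"
  by (simp add: supp_def tr_def)

lemma interior_supp_tr: "z \<in> interior (supp (tr T x)) \<longleftrightarrow> z - x \<in> interior (supp T)"
proof -
  have "interior (supp (tr T x)) = (+) x ` interior (supp T)"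
    using interior_translation[of x "supp T"] by (simp add: supp_def tr_def add.commute[of _ x])
  then show ?thesis by (auto simp: image_iff intro: bexI[of _ "z - x"])
qed

lemma mem_tr_patch: "T \<in> tr_patch S x \<longleftrightarrow> tr T (- x) \<in> S"
  unfolding tr_patch_def image_iff by (metis tr_tr tr_0 add.right_inverse add.left_inverse)

lemma tr_patch_tr_patch: "tr_patch (tr_patch S x) y = tr_patch S (x + y)"
  by (simp add: tr_patch_def image_image tr_tr)

lemma tr_patch_0 [simp]: "tr_patch S 0 = S"
  by (simp add: tr_patch_def)

lemma bounded_translation_invariant:
  fixes X :: "'a::real_normed_vector set"
  assumes "bounded X" "X \<noteq> {}" "\<And>x. x \<in> X \<Longrightarrow> x + w \<in> X"
  shows "w = 0"
proof (rule ccontr)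
  assume w: "w \<noteq> 0"
  obtain x where x: "x \<in> X" using assms by auto
  have *: "x + real n *\<^sub>R w \<in> X" for n
  proof (induction n)
    case (Suc n)
    show ?case using assms(3)[OF Suc] by (simp add: algebra_simps)
  qed (simp add: x)
  obtain K where K: "\<And>y. y \<in> X \<Longrightarrow> norm y \<le> K" using assms(1) by (auto simp: bounded_iff)
  obtain n where n: "real n * norm w > K + norm x" using w reals_Archimedean3[of "norm w"] by auto
  have "norm (real n *\<^sub>R w) \<le> norm (x + real n *\<^sub>R w) + norm x"
    by (metis add.commute add_diff_cancel_left' norm_triangle_ineq4 norm_minus_commute)
  then show False using K[OF *[of n]] n by simp
qed

lemma tr_eq_iff:
  assumes "compact (supp T)" "supp T \<noteq> {}"
  shows "tr T x = tr T y \<longleftrightarrow> x = y"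
proof
  assume eq: "tr T x = tr T y"
  have "x - y = 0"
  proof (rule bounded_translation_invariant)
    show "bounded (supp T)" "supp T \<noteq> {}" using assms compact_imp_bounded by auto
    fix z assume "z \<in> supp T"
    then have "z + x \<in> supp (tr T x)" by (simp add: mem_supp_tr)
    then show "z + (x - y) \<in> supp T" unfolding eq by (simp add: mem_supp_tr algebra_simps)
  qed
  then show "x = y" by simp
qed simp

lemma is_tile_interior_nonempty: "is_tile T \<Longrightarrow> supp T \<noteq> {} \<Longrightarrow> interior (supp T) \<noteq> {}"
  unfolding is_tile_def by force

lemma is_tile_tr: "is_tile T \<Longrightarrow> is_tile (tr T x)"
  using closure_translation[of x "interior (supp T)"] interior_translation[of x "supp T"]
    compact_translation[of "supp T" x]
  by (simp add: is_tile_def supp_def tr_def add.commute[of _ x])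

lemma patch_meet_mono: "patch_meet S K = patch_meet S' K \<Longrightarrow> K' \<subseteq> K \<Longrightarrow> patch_meet S K' = patch_meet S' K'"
  by (auto simp: patch_meet_def set_eq_iff) blast+

lemma patch_meet_shift:
  assumes "patch_meet S (ball c r) = patch_meet S' (ball c r)"
  shows "patch_meet (tr_patch S w) (ball (c + w) r) = patch_meet (tr_patch S' w) (ball (c + w) r)"
proof -
  have *: "supp (tr T (- w)) \<inter> ball c r \<noteq> {} \<longleftrightarrow> supp T \<inter> ball (c + w) r \<noteq> {}" for T :: "('a, 'b) tile"
  proof -
    have "supp (tr T (- w)) \<inter> ball c r \<noteq> {} \<longleftrightarrow> (\<exists>z. z + w \<in> supp T \<and> dist (c + w) (z + w) < r)"
      by (auto simp: mem_supp_tr)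
    also have "\<dots> \<longleftrightarrow> (\<exists>z. z \<in> supp T \<and> dist (c + w) z < r)"
      by (metis diff_add_cancel)
    finally show ?thesis by auto
  qed
  have "T \<in> patch_meet (tr_patch U w) (ball (c + w) r) \<longleftrightarrow> tr T (- w) \<in> patch_meet U (ball c r)" for T and U :: "('a, 'b) patch"
    by (simp add: patch_meet_def mem_tr_patch *)
  with assms show ?thesis by (intro set_eqI) (simp only:)
qed

section \<open>The local matching topology\<close>

lemma lm_nbhd_mono: "R' \<le> R \<Longrightarrow> e \<le> e' \<Longrightarrow> lm_nbhd R e S \<subseteq> lm_nbhd R' e' S"
proof
  fix S' assume le: "R' \<le> R" "e \<le> e'" and "S' \<in> lm_nbhd R e S"
  then obtain u v where uv: "norm u < e" "norm v < e"
    "patch_meet (tr_patch S' u) (ball 0 R) = patch_meet (tr_patch S v) (ball 0 R)"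
    by (auto simp: lm_nbhd_def)
  have "patch_meet (tr_patch S' u) (ball 0 R') = patch_meet (tr_patch S v) (ball 0 R')"
    using patch_meet_mono[OF uv(3), of "ball 0 R'"] le by (simp add: subset_ball)
  then show "S' \<in> lm_nbhd R' e' S" using uv le unfolding lm_nbhd_def by force
qed

lemma istopology_lm_open: "istopology lm_open"
  unfolding istopology_def
proof (intro conjI allI impI)
  fix U V :: "('a, 'b) patch set" assume U: "lm_open U" and V: "lm_open V"
  show "lm_open (U \<inter> V)"
    unfolding lm_open_def
  proof
    fix S assume "S \<in> U \<inter> V"
    then obtain R1 e1 R2 e2 where *: "R1 > 0" "e1 > 0" "lm_nbhd R1 e1 S \<subseteq> U"
      "R2 > 0" "e2 > 0" "lm_nbhd R2 e2 S \<subseteq> V"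
      using U V unfolding lm_open_def by blast
    have "lm_nbhd (max R1 R2) (min e1 e2) S \<subseteq> U \<inter> V"
      using lm_nbhd_mono[of R1 "max R1 R2" "min e1 e2" e1 S] lm_nbhd_mono[of R2 "max R1 R2" "min e1 e2" e2 S] * by auto
    then show "\<exists>R>0. \<exists>e>0. lm_nbhd R e S \<subseteq> U \<inter> V" using * by (intro exI[of _ "max R1 R2"] conjI exI[of _ "min e1 e2"]) auto
  qed
next
  fix K :: "('a, 'b) patch set set" assume "\<forall>U\<in>K. lm_open U"
  then show "lm_open (\<Union>K)" unfolding lm_open_def by (meson Union_iff Union_upper order_trans)
qed

lemma openin_lm_topology: "openin lm_topology U \<longleftrightarrow> lm_open U"
  by (simp add: lm_topology_def istopology_lm_open topology_inverse')

lemma topspace_lm_topology [simp]: "topspace lm_topology = UNIV"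
proof -
  have "lm_open UNIV" unfolding lm_open_def by (auto intro: exI[of _ 1])
  then show ?thesis using openin_subset openin_lm_topology by blast
qed

text \<open>Closeness permits a small translation on either side; on a slightly smaller ball both
  merge into a single translation of \<open>Tl\<close>, so the agreement is exact.\<close>

lemma hull_local_agreement:
  fixes Tl :: "('n::finite, 'l) patch"
  assumes S: "S \<in> tiling_hull Tl"
  shows "\<exists>y. patch_meet S (ball 0 R) = patch_meet (tr_patch Tl y) (ball 0 R)"
proof -
  \<comment> \<open>The margin 1 absorbs the final translation by \<open>- v\<close>, whose norm is
    below 1; the maximum guards against negative \<open>R\<close>.\<close>
  define R0 where "R0 = max R 0 + 1"
  \<comment> \<open>Membership in the closure is tested on open sets, so an open variant of a basic
    neighbourhood is constructed. The strict slack between \<open>R0\<close> and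
    \<open>\<rho>\<close> makes it open: a nearby patch uses up only half of the slack.\<close>
  define W where "W = {S'. \<exists>u v \<rho>. norm u < 1 \<and> norm v < 1 \<and> R0 < \<rho> \<and>
    patch_meet (tr_patch S' u) (ball 0 \<rho>) = patch_meet (tr_patch S v) (ball 0 \<rho>)}"
  have "lm_open W"
    unfolding lm_open_def
  proof
    fix S' assume "S' \<in> W"
    then obtain u v \<rho> where uv: "norm u < 1" "norm v < 1" "R0 < \<rho>"
      and ag: "patch_meet (tr_patch S' u) (ball 0 \<rho>) = patch_meet (tr_patch S v) (ball 0 \<rho>)"
      by (auto simp: W_def)
    define R' where "R' = \<rho> + norm u + 1"
    define e where "e = min (min (1 - norm u) (1 - norm v)) ((\<rho> - R0) / 2)"
    define \<rho>' where "\<rho>' = (R0 + \<rho>) / 2"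
    have "lm_nbhd R' e S' \<subseteq> W"
    proof
      fix S'' assume "S'' \<in> lm_nbhd R' e S'"
      then obtain u' v' where uv': "norm u' < e" "norm v' < e"
        and ag': "patch_meet (tr_patch S'' u') (ball 0 R') = patch_meet (tr_patch S' v') (ball 0 R')"
        by (auto simp: lm_nbhd_def)
      have 1: "patch_meet (tr_patch S'' (u + u')) (ball u R') = patch_meet (tr_patch S' (u + v')) (ball u R')"
        using patch_meet_shift[OF ag', of u] by (simp add: tr_patch_tr_patch add.commute)
      have 2: "patch_meet (tr_patch S' (u + v')) (ball v' \<rho>) = patch_meet (tr_patch S (v + v')) (ball v' \<rho>)"
        using patch_meet_shift[OF ag, of v'] by (simp add: tr_patch_tr_patch)
      have s1: "ball 0 \<rho>' \<subseteq> ball u R'"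
      proof
        fix z :: "real^'n" assume "z \<in> ball 0 \<rho>'"
        then have "norm z < \<rho>" using uv(3) by (simp add: \<rho>'_def)
        then show "z \<in> ball u R'" using norm_triangle_ineq4[of u z] by (simp add: R'_def dist_norm)
      qed
      have s2: "ball 0 \<rho>' \<subseteq> ball v' \<rho>"
      proof
        fix z :: "real^'n" assume "z \<in> ball 0 \<rho>'"
        then have "norm z < (R0 + \<rho>) / 2" by (simp add: \<rho>'_def)
        moreover have "norm v' < (\<rho> - R0) / 2" using uv'(2) by (simp add: e_def)
        ultimately show "z \<in> ball v' \<rho>" using norm_triangle_ineq4[of v' z] by (simp add: dist_norm field_simps)
      qed
      have "patch_meet (tr_patch S'' (u + u')) (ball 0 \<rho>') = patch_meet (tr_patch S (v + v')) (ball 0 \<rho>')"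
        using patch_meet_mono[OF 1 s1] patch_meet_mono[OF 2 s2] by simp
      moreover have "norm (u + u') < 1" "norm (v + v') < 1"
        using uv' norm_triangle_ineq[of u u'] norm_triangle_ineq[of v v'] by (auto simp: e_def)
      moreover have "R0 < \<rho>'" using uv(3) by (simp add: \<rho>'_def)
      ultimately show "S'' \<in> W" unfolding W_def by blast
    qed
    moreover have "R' > 0" "e > 0" using uv norm_ge_zero[of u] by (auto simp: R'_def e_def R0_def simp del: norm_ge_zero)
    ultimately show "\<exists>R>0. \<exists>e>0. lm_nbhd R e S' \<subseteq> W" by blast
  qed
  moreover have "S \<in> W" unfolding W_def by (auto intro!: exI[of _ 0] exI[of _ "R0 + 1"])
  ultimately obtain x where "tr_patch Tl x \<in> W"
    using S unfolding tiling_hull_def in_closure_of openin_lm_topology[symmetric] by blast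
  then obtain u v \<rho> where uv: "norm u < 1" "norm v < 1" "R0 < \<rho>"
    and ag: "patch_meet (tr_patch Tl (x + u)) (ball 0 \<rho>) = patch_meet (tr_patch S v) (ball 0 \<rho>)"
    by (auto simp: W_def tr_patch_tr_patch)
  have "patch_meet (tr_patch Tl (x + u + - v)) (ball (- v) \<rho>) = patch_meet S (ball (- v) \<rho>)"
    using patch_meet_shift[OF ag, of "- v"] by (simp add: tr_patch_tr_patch)
  moreover have "ball 0 R \<subseteq> ball (- v) \<rho>"
  proof
    fix z :: "real^'n" assume "z \<in> ball 0 R"
    then show "z \<in> ball (- v) \<rho>" using uv norm_triangle_ineq[of v z]
      by (simp add: dist_norm R0_def norm_minus_commute add.commute)
  qed
  ultimately show ?thesis by (metis patch_meet_mono)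
qed

section \<open>Geometry of tilings with finite local complexity\<close>

locale flc_tiling =
  fixes A :: "('n::finite, 'l) tile set" and Tl :: "('n, 'l) patch"
  assumes finA: "finite A" and tileA: "P \<in> A \<Longrightarrow> is_tile P" and neA: "P \<in> A \<Longrightarrow> supp P \<noteq> {}"
    and Tl: "is_tiling Tl" and TlA: "T \<in> Tl \<Longrightarrow> \<exists>P\<in>A. \<exists>x. T = tr P x"
    and FLC: "FLC_tiling Tl"
begin

text \<open>Elements of the hull may contain tiles with empty support, which the local topology does not
  see; hence the restriction to nonempty supports.\<close>
definition A_patch :: "('n, 'l) patch \<Rightarrow> bool" where
  "A_patch S \<longleftrightarrow> (\<forall>T\<in>S. supp T \<noteq> {} \<longrightarrow> (\<exists>P\<in>A. \<exists>t. T = tr P t)) \<and>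
    (\<forall>T\<in>S. \<forall>T'\<in>S. supp T \<noteq> {} \<longrightarrow> supp T' \<noteq> {} \<longrightarrow> T \<noteq> T' \<longrightarrow> interior (supp T) \<inter> interior (supp T') = {})"

text \<open>The factor 2 leaves room for a position and a test point each known only up to
  \<open>rad\<close>. Centres and radius come from one choice because they have to fit
  together.\<close>

definition inner_ball :: "(('n, 'l) tile \<Rightarrow> real^'n) \<times> real" where
  "inner_ball = (SOME (p, r). 0 < r \<and> (\<forall>P\<in>A. ball (p P) (2 * r) \<subseteq> supp P))"

definition ctr where "ctr = fst inner_ball"
definition rad where "rad = snd inner_ball"

lemma rad_pos: "rad > 0" and ctr_ball: "P \<in> A \<Longrightarrow> ball (ctr P) (2 * rad) \<subseteq> supp P"
proof -
  have "\<exists>p e. 0 < e \<and> ball p e \<subseteq> supp P" if "P \<in> A" for P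
    using is_tile_interior_nonempty[OF tileA neA, OF that that] mem_interior by blast
  then obtain p e where pe: "\<And>P. P \<in> A \<Longrightarrow> 0 < e P \<and> ball (p P) (e P) \<subseteq> supp P"
    by metis
  define r where "r = Min (insert 1 (e ` A)) / 2"
  have r: "r > 0" using finA pe by (auto simp: r_def)
  moreover have "ball (p P) (2 * r) \<subseteq> supp P" if "P \<in> A" for P
  proof -
    have "2 * r \<le> e P" unfolding r_def using finA that by (auto intro: Min_le)
    then show ?thesis using pe[OF that] subset_ball by blast
  qed
  ultimately have "case (p, r) of (p, r) \<Rightarrow> 0 < r \<and> (\<forall>P\<in>A. ball (p P) (2 * r) \<subseteq> supp P)" by simp
  then have "case inner_ball of (p, r) \<Rightarrow> 0 < r \<and> (\<forall>P\<in>A. ball (p P) (2 * r) \<subseteq> supp P)"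
    unfolding inner_ball_def by (rule someI)
  then show "rad > 0" "P \<in> A \<Longrightarrow> ball (ctr P) (2 * rad) \<subseteq> supp P"
    by (auto simp: ctr_def rad_def split: prod.splits)
qed

lemma ctr_interior: "P \<in> A \<Longrightarrow> dist (ctr P + t) z < 2 * rad \<Longrightarrow> z \<in> interior (supp (tr P t))"
proof -
  assume P: "P \<in> A" and z: "dist (ctr P + t) z < 2 * rad"
  have "ball (ctr P) (2 * rad) \<subseteq> interior (supp P)" using ctr_ball[OF P] by (simp add: interior_maximal)
  moreover have "z - t \<in> ball (ctr P) (2 * rad)" using z by (simp add: dist_norm algebra_simps)
  ultimately show ?thesis by (auto simp: interior_supp_tr)
qed

lemma tr_eq_iff_A: "P \<in> A \<Longrightarrow> tr P x = tr P y \<longleftrightarrow> x = y"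
  using tr_eq_iff[of P x y] tileA[of P] neA[of P] by (simp add: is_tile_def)

lemma supp_bound: "\<exists>D>0. \<forall>P\<in>A. \<forall>z\<in>supp P. norm z \<le> D"
proof -
  have "bounded (\<Union>P\<in>A. supp P)"
    using finA tileA by (intro bounded_UN) (auto simp: is_tile_def compact_imp_bounded)
  then show ?thesis unfolding bounded_pos by blast
qed

lemma A_patch_Tl: "A_patch Tl"
  unfolding A_patch_def
proof (intro conjI ballI impI)
  show "\<exists>P\<in>A. \<exists>t. T = tr P t" if "T \<in> Tl" for T using that by (rule TlA)
  show "interior (supp T) \<inter> interior (supp T') = {}" if "T \<in> Tl" "T' \<in> Tl" "T \<noteq> T'" for T T'
    using that Tl by (simp add: is_tiling_def is_patch_def)
qed

text \<open>A tile is the closure of its interior, so a point of one tile inside the interior of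
  another forces the two interiors to meet.\<close>

lemma A_patch_overlap:
  assumes S: "A_patch S" and T: "T \<in> S" "T' \<in> S" and ne: "supp T' \<noteq> {}"
    and z: "z \<in> interior (supp T)" "z \<in> supp T'"
  shows "T = T'"
proof -
  obtain P t where P: "P \<in> A" "T' = tr P t" using S T(2) ne unfolding A_patch_def by blast
  have "supp T' = closure (interior (supp T'))" using is_tile_tr[OF tileA[OF P(1)]] P(2) by (simp add: is_tile_def)
  then have "z \<in> closure (interior (supp T'))" using z(2) by simp
  then have "interior (supp T) \<inter> interior (supp T') \<noteq> {}"
    using z(1) open_Int_closure_eq_empty[OF open_interior] by blast
  moreover have "supp T \<noteq> {}" using z(1) interior_subset by blast
  ultimately show ?thesis using S T ne unfolding A_patch_def by blast
qed

text \<open>If two copies are shifted by less than \<open>2 * rad\<close>, the centre of one lies in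
  the interior of the other, so they are the same tile.\<close>

lemma A_patch_separated:
  assumes "A_patch S" "P \<in> A" "tr P t \<in> S" "tr P t' \<in> S" "dist t t' < 2 * rad"
  shows "t = t'"
proof -
  have "tr P t = tr P t'"
  proof (rule A_patch_overlap[OF assms(1,3,4)])
    show "supp (tr P t') \<noteq> {}" using assms(2) neA by simp
    show "ctr P + t' \<in> interior (supp (tr P t))" using assms by (intro ctr_interior) auto
    show "ctr P + t' \<in> supp (tr P t')"
      using ctr_interior[OF assms(2), of t' "ctr P + t'"] rad_pos interior_subset by auto
  qed
  then show ?thesis using tr_eq_iff_A[OF assms(2)] by simp
qed

text \<open>The positions of a fixed prototile are uniformly discrete, and those of tiles meeting
  \<open>K\<close> are bounded.\<close>

lemma finite_patch_meet:
  assumes S: "A_patch S" and K: "bounded K"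
  shows "finite (patch_meet S K)"
proof -
  obtain D where D: "\<And>P z. P \<in> A \<Longrightarrow> z \<in> supp P \<Longrightarrow> norm z \<le> D" using supp_bound by blast
  obtain k where k: "\<And>z. z \<in> K \<Longrightarrow> norm z \<le> k" using K by (auto simp: bounded_iff)
  define V where "V P = {t. tr P t \<in> S \<and> norm t \<le> k + D}" for P
  have "finite (V P)" if "P \<in> A" for P
  proof -
    have "uniform_discrete (V P)"
      unfolding uniform_discrete_def V_def using A_patch_separated[OF S that] rad_pos
      by (intro exI[of _ "2 * rad"]) auto
    moreover have "bounded (V P)" by (rule boundedI[of _ "k + D"]) (simp add: V_def)
    ultimately show ?thesis using uniform_discrete_finite_iff by blast
  qed
  moreover have "patch_meet S K \<subseteq> (\<Union>P\<in>A. tr P ` V P)"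
  proof
    fix T assume "T \<in> patch_meet S K"
    then obtain z where z: "T \<in> S" "z \<in> supp T" "z \<in> K" by (auto simp: patch_meet_def)
    then obtain P t where P: "P \<in> A" "T = tr P t" using S unfolding A_patch_def by blast
    have "norm (z - t) \<le> D" using z(2) P D by (simp add: mem_supp_tr)
    then have "norm t \<le> k + D" using k[OF z(3)] norm_triangle_ineq4[of z "z - t"] by simp
    then show "T \<in> (\<Union>P\<in>A. tr P ` V P)" using P z(1) by (auto simp: V_def)
  qed
  ultimately show ?thesis using finA by (meson finite_UN_I finite_imageI finite_subset)
qed

text \<open>The support of a patch is the closure of a union, so covering each point requires local
  finiteness: near \<open>z\<close> the union is finite and closed.\<close>

lemma Tl_covers: "\<exists>T\<in>Tl. z \<in> supp T"
proof (rule ccontr)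
  assume no: "\<not> (\<exists>T\<in>Tl. z \<in> supp T)"
  define C where "C = (\<Union>T\<in>patch_meet Tl (ball z 1). supp T)"
  have "closed C"
    unfolding C_def using finite_patch_meet[OF A_patch_Tl, of "ball z 1"] Tl
    by (intro closed_UN) (auto simp: patch_meet_def is_tiling_def is_patch_def is_tile_def compact_imp_closed)
  then have "open (ball z 1 - C)" by (simp add: open_Diff)
  moreover have "z \<in> ball z 1 - C" using no by (auto simp: C_def patch_meet_def)
  moreover have "z \<in> closure (\<Union>T\<in>Tl. supp T)" using Tl by (simp add: is_tiling_def patch_supp_def)
  ultimately have "(ball z 1 - C) \<inter> (\<Union>T\<in>Tl. supp T) \<noteq> {}"
    using open_Int_closure_eq_empty by blast
  then show False by (auto simp: C_def patch_meet_def)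
qed

lemma hull_finite_subset:
  assumes S: "S \<in> tiling_hull Tl" and F: "finite F" "F \<subseteq> S" "\<And>T. T \<in> F \<Longrightarrow> supp T \<noteq> {}"
  shows "\<exists>y. F \<subseteq> tr_patch Tl y"
proof -
  obtain z where z: "\<And>T. T \<in> F \<Longrightarrow> z T \<in> supp T" using bchoice[of F "\<lambda>T z. z \<in> supp T"] F(3) by blast
  have "bounded (z ` F)" using F(1) by (simp add: finite_imp_bounded)
  then obtain R where R: "\<And>T. T \<in> F \<Longrightarrow> norm (z T) < R" by (auto simp: bounded_pos_less)
  obtain y where y: "patch_meet S (ball 0 R) = patch_meet (tr_patch Tl y) (ball 0 R)"
    using hull_local_agreement[OF S] by blast
  have "F \<subseteq> patch_meet S (ball 0 R)" using F(2) z R by (fastforce simp: patch_meet_def)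
  then show ?thesis unfolding y by (auto simp: patch_meet_def)
qed

lemma hull_finite_subset':
  assumes S: "S \<in> tiling_hull Tl" and F: "finite F" "F \<subseteq> S" "\<And>T. T \<in> F \<Longrightarrow> supp T \<noteq> {}"
  shows "\<exists>y. \<forall>T\<in>F. tr T y \<in> Tl"
  using hull_finite_subset[OF assms] unfolding subset_iff mem_tr_patch by blast

text \<open>The two properties involve one and two tiles, and every finite set of nonempty tiles in
  a hull element lies in a translate of \<open>Tl\<close>.\<close>

lemma A_patch_hull:
  assumes S: "S \<in> tiling_hull Tl"
  shows "A_patch S"
  unfolding A_patch_def
proof (intro conjI ballI impI)
  fix T assume "T \<in> S" "supp T \<noteq> {}"
  then obtain y where "tr T y \<in> Tl" using hull_finite_subset'[OF S, of "{T}"] by blast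
  then obtain P x where "P \<in> A" "tr T y = tr P x" using TlA by blast
  then have "T = tr P (x - y)" by (metis tr_tr tr_0 add.right_inverse diff_conv_add_uminus)
  then show "\<exists>P\<in>A. \<exists>t. T = tr P t" using \<open>P \<in> A\<close> by blast
next
  fix T T' assume T: "T \<in> S" "T' \<in> S" "supp T \<noteq> {}" "supp T' \<noteq> {}" "T \<noteq> T'"
  then obtain y where y: "tr T y \<in> Tl" "tr T' y \<in> Tl" using hull_finite_subset'[OF S, of "{T, T'}"] by blast
  have "tr T y \<noteq> tr T' y" using T(5) by (metis tr_tr tr_0 add.right_inverse)
  then have "interior (supp (tr T y)) \<inter> interior (supp (tr T' y)) = {}"
    using y Tl by (auto simp: is_tiling_def is_patch_def)
  moreover have "z + y \<in> interior (supp (tr T y))" if "z \<in> interior (supp T)" for z and T :: "('n, 'l) tile"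
    using that by (simp add: interior_supp_tr)
  ultimately show "interior (supp T) \<inter> interior (supp T') = {}" by blast
qed

lemma hull_covers:
  assumes S: "S \<in> tiling_hull Tl"
  shows "\<exists>T\<in>S. z \<in> supp T"
proof -
  obtain y where y: "patch_meet S (ball 0 (norm z + 1)) = patch_meet (tr_patch Tl y) (ball 0 (norm z + 1))"
    using hull_local_agreement[OF S] by blast
  obtain T where T: "T \<in> Tl" "z - y \<in> supp T" using Tl_covers by blast
  have "tr T y \<in> patch_meet (tr_patch Tl y) (ball 0 (norm z + 1))"
    using T by (auto simp: patch_meet_def tr_patch_def mem_supp_tr intro!: exI[of _ z])
  then have "tr T y \<in> S" unfolding y[symmetric] by (simp add: patch_meet_def)
  moreover have "z \<in> supp (tr T y)" using T(2) by (simp add: mem_supp_tr)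
  ultimately show ?thesis by blast
qed

text \<open>Two tiles at bounded distance appear together in one patch around the first. Up to
  translation there are finitely many such patches, each finite, and differences of positions are
  translation invariant.\<close>

lemma finite_relative_positions:
  "finite {t' - t | t t'. \<exists>P\<in>A. \<exists>P'\<in>A. tr P t \<in> Tl \<and> tr P' t' \<in> Tl \<and> norm (t' - t) \<le> R}" (is "finite ?D")
proof -
  obtain D where D: "\<And>P z. P \<in> A \<Longrightarrow> z \<in> supp P \<Longrightarrow> norm z \<le> D" using supp_bound by blast
  \<comment> \<open>A tile at distance at most \<open>R\<close> from the base position has a point
    within a further \<open>D\<close>; the maximum with 0 also covers the base tile itself.\<close>
  define K where "K = cball (0::real^'n) (max 0 R + D)"
  have "fin_up_to_tr {patch_meet Tl ((\<lambda>y. y + x) ` K) | x. True}"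
    by (rule FLC[unfolded FLC_tiling_def, rule_format]) (simp add: K_def)
  then obtain F where finF: "finite F"
    and F': "\<forall>Q\<in>{patch_meet Tl ((\<lambda>y. y + x) ` K) | x. True}. \<exists>F0\<in>F. \<exists>y. Q = tr_patch F0 y"
    unfolding fin_up_to_tr_def by (elim exE conjE)
  have F: "\<exists>F0\<in>F. \<exists>y. patch_meet Tl ((\<lambda>y. y + x) ` K) = tr_patch F0 y" for x
    by (rule bspec[OF F']) blast
  define V where "V F0 = {s. \<exists>P\<in>A. tr P s \<in> F0}" for F0 :: "('n, 'l) patch"
  have "finite (V F0)" if "finite F0" for F0
  proof -
    have "V F0 = (\<Union>P\<in>A. {s. tr P s \<in> F0})" by (auto simp: V_def)
    moreover have "finite {s. tr P s \<in> F0}" if "P \<in> A" for P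
    proof -
      have "inj_on (tr P) {s. tr P s \<in> F0}" using tr_eq_iff_A[OF that] by (auto simp: inj_on_def)
      moreover have "tr P ` {s. tr P s \<in> F0} \<subseteq> F0" by auto
      ultimately show ?thesis using \<open>finite F0\<close> finite_imageD finite_subset by blast
    qed
    ultimately show ?thesis using finA by simp
  qed
  then have "finite (\<Union>F0\<in>{F0\<in>F. finite F0}. (\<lambda>(s, s'). s' - s) ` (V F0 \<times> V F0))"
    using finF by auto
  moreover have "?D \<subseteq> (\<Union>F0\<in>{F0\<in>F. finite F0}. (\<lambda>(s, s'). s' - s) ` (V F0 \<times> V F0))"
  proof
    fix w assume "w \<in> ?D"
    then obtain t t' P P' where w: "w = t' - t" "P \<in> A" "P' \<in> A" "tr P t \<in> Tl" "tr P' t' \<in> Tl" "norm (t' - t) \<le> R"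
      by blast
    let ?K = "(\<lambda>y. y + t) ` K"
    obtain F0 y where F0: "F0 \<in> F" "patch_meet Tl ?K = tr_patch F0 y" using F by blast
    have "compact ?K" unfolding K_def
      by (intro compact_continuous_image continuous_intros compact_cball)
    then have "finite (patch_meet Tl ?K)" by (intro finite_patch_meet[OF A_patch_Tl] compact_imp_bounded)
    then have "finite (tr_patch F0 y)" using F0(2) by simp
    moreover have "tr_patch (tr_patch F0 y) (- y) = F0" by (simp add: tr_patch_tr_patch)
    ultimately have fin: "finite F0" unfolding tr_patch_def by (metis finite_imageI)
    have meets: "tr P'' s \<in> patch_meet Tl ?K" if "P'' \<in> A" "tr P'' s \<in> Tl" "norm (s - t) \<le> max 0 R" for P'' s
    proof -
      have "supp P'' \<noteq> {}" by (rule neA[OF that(1)])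
      then obtain z where z: "z \<in> supp P''" by blast
      have "norm (z + s - t) \<le> max 0 R + D"
        using D[OF that(1) z] that(3) norm_triangle_ineq[of z "s - t"] by (simp add: algebra_simps)
      then have "z + s \<in> ?K" by (auto simp: K_def image_iff intro!: bexI[of _ "z + s - t"])
      moreover have "z + s \<in> supp (tr P'' s)" using z by (simp add: mem_supp_tr)
      ultimately show ?thesis using that(2) by (auto simp: patch_meet_def)
    qed
    have "tr P t \<in> tr_patch F0 y" "tr P' t' \<in> tr_patch F0 y"
      using meets[OF w(2,4)] meets[OF w(3,5)] w(6) F0(2) by auto
    then have "t - y \<in> V F0" "t' - y \<in> V F0"
      using w(2,3) by (auto simp: V_def mem_tr_patch tr_tr)
    then show "w \<in> (\<Union>F0\<in>{F0\<in>F. finite F0}. (\<lambda>(s, s'). s' - s) ` (V F0 \<times> V F0))"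
      using F0(1) fin w(1) by (auto intro!: bexI[of _ F0] image_eqI[of _ _ "(t - y, t' - y)"])
  qed
  ultimately show ?thesis by (rule finite_subset[rotated])
qed

text \<open>Relative positions at bounded distance form a finite set, hence have a positive gap.
  Moving both tiles by less than half the gap changes the relative position by less than the gap, so
  not at all.\<close>

lemma rigidity:
  "\<exists>\<eta>>0. \<forall>S\<in>tiling_hull Tl. \<forall>S'\<in>tiling_hull Tl. \<forall>P\<in>A. \<forall>P'\<in>A. \<forall>t t' s s'.
     tr P t \<in> S \<longrightarrow> tr P' t' \<in> S \<longrightarrow> tr P s \<in> S' \<longrightarrow> tr P' s' \<in> S' \<longrightarrow> norm (t' - t) \<le> R \<longrightarrow>
     norm (s - t) < \<eta> \<longrightarrow> norm (s' - t') < \<eta> \<longrightarrow> s - t = s' - t'"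
proof -
  \<comment> \<open>The radius grows by 2 because each of the two tiles moves by less than
    1.\<close>
  define D where "D = {t' - t | t t'. \<exists>P\<in>A. \<exists>P'\<in>A. tr P t \<in> Tl \<and> tr P' t' \<in> Tl \<and> norm (t' - t) \<le> R + 2}"
  have D: "t' - t \<in> D" if S: "S \<in> tiling_hull Tl" and "P \<in> A" "P' \<in> A" "tr P t \<in> S" "tr P' t' \<in> S" "norm (t' - t) \<le> R + 2"
    for S P P' t t'
  proof -
    have "\<exists>y. \<forall>T\<in>{tr P t, tr P' t'}. tr T y \<in> Tl"
    proof (rule hull_finite_subset'[OF S])
      fix T assume "T \<in> {tr P t, tr P' t'}"
      then show "supp T \<noteq> {}" using neA[OF \<open>P \<in> A\<close>] neA[OF \<open>P' \<in> A\<close>] by (elim insertE emptyE) simp_all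
    qed (use that in simp_all)
    then obtain y where "tr (tr P t) y \<in> Tl" "tr (tr P' t') y \<in> Tl" by blast
    then show ?thesis using that unfolding D_def tr_tr mem_Collect_eq
      by (intro exI[of _ "t + y"] exI[of _ "t' + y"] conjI bexI[of _ P] bexI[of _ P']) simp_all
  qed
  have "finite D" unfolding D_def by (rule finite_relative_positions)
  then have "uniform_discrete D" by (induction rule: finite_induct) (simp_all add: uniform_discrete_insert)
  then obtain e where e: "e > 0" "\<And>x y. x \<in> D \<Longrightarrow> y \<in> D \<Longrightarrow> dist x y < e \<Longrightarrow> x = y"
    unfolding uniform_discrete_def by blast
  show ?thesis
  proof (intro exI[of _ "min 1 (e / 2)"] conjI ballI allI impI)
    show "min 1 (e / 2) > 0" using e by simp
    fix S S' P P' t t' s s'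
    assume *: "S \<in> tiling_hull Tl" "S' \<in> tiling_hull Tl" "P \<in> A" "P' \<in> A" "tr P t \<in> S" "tr P' t' \<in> S"
      "tr P s \<in> S'" "tr P' s' \<in> S'" "norm (t' - t) \<le> R" "norm (s - t) < min 1 (e / 2)" "norm (s' - t') < min 1 (e / 2)"
    have "norm ((s' - t') - (s - t)) < min 2 e" using *(10,11) norm_triangle_ineq4[of "s' - t'" "s - t"] by auto
    moreover have "(s' - t') - (s - t) = (s' - s) - (t' - t)" by simp
    ultimately have d: "norm ((s' - s) - (t' - t)) < min 2 e" by metis
    then have "norm (s' - s) \<le> R + 2"
      using *(9) norm_triangle_ineq2[of "s' - s" "t' - t"] by simp
    then have "s' - s = t' - t"
      using e(2)[OF D[OF *(2,3,4,7,8)] D[OF *(1,3,4,5,6)]] *(9) d by (simp add: dist_norm)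
    then show "s - t = s' - t'" by (simp add: algebra_simps)
  qed
qed

end

section \<open>Borel structure of the hull\<close>

locale tiling_system = flc_tiling A Tl
  for A :: "('n::finite, 'l) tile set" and Tl +
  fixes \<mu> :: "('n, 'l) patch measure"
  assumes \<mu>: "invariant_hull_measure Tl \<mu>"
begin

abbreviation X where "X \<equiv> tiling_hull Tl"

lemma space_mu: "space \<mu> = X" and prob_mu: "prob_space \<mu>"
  using \<mu> by (auto simp: invariant_hull_measure_def)

lemma sets_mu: "sets \<mu> = sigma_sets X {U \<inter> X | U. lm_open U}"
proof -
  have "sets \<mu> = sets (borel_of (subtopology lm_topology X))"
    using \<mu> by (simp add: invariant_hull_measure_def)
  also have "\<dots> = sigma_sets X {U. openin (subtopology lm_topology X) U}"
    unfolding borel_of_def by (subst sets_measure_of) (auto dest: openin_imp_subset)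
  also have "{U. openin (subtopology lm_topology X) U} = {U \<inter> X | U. lm_open U}"
    by (auto simp: openin_subtopology openin_lm_topology)
  finally show ?thesis .
qed

lemma hull_translate: "S \<in> X \<Longrightarrow> tr_patch S x \<in> X"
  using \<mu> measurable_space[of "\<lambda>S. tr_patch S x" \<mu> \<mu> S] by (auto simp: invariant_hull_measure_def)

text \<open>A single position \<open>t\<close> serves all \<open>v\<close>. With
  \<open>F = {0}\<close> this is a plain occurrence; with \<open>F\<close> a lattice it is a
  periodic one.\<close>

definition occ :: "('n, 'l) tile \<Rightarrow> (real^'n) set \<Rightarrow> (real^'n) set \<Rightarrow> ('n, 'l) patch set" where
  "occ P D F = {S\<in>X. \<exists>t\<in>D. \<forall>v\<in>F. tr P (t + v) \<in> S}"

text \<open>Finitely many tiles are visible in one ball, and agreement up to translations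
  \<open>u\<close> and \<open>w\<close> moves all of them by the same small vector
  \<open>w - u\<close>.\<close>

lemma lm_open_occurrence:
  assumes P: "supp P \<noteq> {}" and D: "open D" and F: "finite F"
  shows "lm_open {S. \<exists>t\<in>D. \<forall>v\<in>F. tr P (t + v) \<in> S}"
  unfolding lm_open_def
proof
  fix S assume "S \<in> {S. \<exists>t\<in>D. \<forall>v\<in>F. tr P (t + v) \<in> S}"
  then obtain t where t: "t \<in> D" "\<And>v. v \<in> F \<Longrightarrow> tr P (t + v) \<in> S" by blast
  obtain d where d: "d > 0" "ball t d \<subseteq> D" using D t(1) openE by blast
  obtain z where z: "z \<in> supp P" using P by blast
  have "bounded ((\<lambda>v. z + (t + v)) ` F)" using F by (simp add: finite_imp_bounded)
  then obtain R0 where R0: "R0 > 0" "\<And>v. v \<in> F \<Longrightarrow> norm (z + (t + v)) \<le> R0" unfolding bounded_pos by blast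
  have "lm_nbhd (R0 + 1) (min 1 (d / 2)) S \<subseteq> {S. \<exists>t\<in>D. \<forall>v\<in>F. tr P (t + v) \<in> S}"
  proof
    fix S' assume "S' \<in> lm_nbhd (R0 + 1) (min 1 (d / 2)) S"
    then obtain u w where uw: "norm u < min 1 (d / 2)" "norm w < min 1 (d / 2)"
      and ag: "patch_meet (tr_patch S' u) (ball 0 (R0 + 1)) = patch_meet (tr_patch S w) (ball 0 (R0 + 1))"
      unfolding lm_nbhd_def by blast
    have "tr P (t + (w - u) + v) \<in> S'" if v: "v \<in> F" for v
    proof -
      have "tr P (t + v + w) \<in> tr_patch S w" using t(2)[OF v] by (simp add: mem_tr_patch tr_tr)
      moreover have "z + (t + v) + w \<in> supp (tr P (t + v + w))" using z by (simp add: mem_supp_tr algebra_simps)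
      moreover have "norm (z + (t + v) + w) < R0 + 1"
        using R0(2)[OF v] uw norm_triangle_ineq[of "z + (t + v)" w] by linarith
      then have "z + (t + v) + w \<in> ball 0 (R0 + 1)" by simp
      ultimately have "tr P (t + v + w) \<in> patch_meet (tr_patch S w) (ball 0 (R0 + 1))"
        unfolding patch_meet_def by blast
      then have "tr P (t + v + w) \<in> patch_meet (tr_patch S' u) (ball 0 (R0 + 1))" by (simp only: ag)
      then have "tr P (t + v + w) \<in> tr_patch S' u" unfolding patch_meet_def by blast
      then show ?thesis by (simp add: mem_tr_patch tr_tr algebra_simps)
    qed
    moreover have "t + (w - u) \<in> D"
    proof -
      have "norm (w - u) < d" using uw norm_triangle_ineq4[of w u] by simp
      then have "t + (w - u) \<in> ball t d" by (simp add: dist_norm norm_minus_commute)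
      then show ?thesis using d by blast
    qed
    ultimately show "S' \<in> {S. \<exists>t\<in>D. \<forall>v\<in>F. tr P (t + v) \<in> S}" by blast
  qed
  then show "\<exists>R>0. \<exists>e>0. lm_nbhd R e S \<subseteq> {S. \<exists>t\<in>D. \<forall>v\<in>F. tr P (t + v) \<in> S}"
    using R0 d by (intro exI[of _ "R0 + 1"] conjI exI[of _ "min 1 (d / 2)"]) auto
qed

lemma occ_finite_sets: "P \<in> A \<Longrightarrow> open D \<Longrightarrow> finite F \<Longrightarrow> occ P D F \<in> sets \<mu>"
proof -
  assume "P \<in> A" "open D" "finite F"
  then have "lm_open {S. \<exists>t\<in>D. \<forall>v\<in>F. tr P (t + v) \<in> S}" by (intro lm_open_occurrence neA)
  moreover have "occ P D F = {S. \<exists>t\<in>D. \<forall>v\<in>F. tr P (t + v) \<in> S} \<inter> X" by (auto simp: occ_def)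
  ultimately show ?thesis unfolding sets_mu by (intro sigma_sets.Basic) blast
qed

definition basis0 :: "(real^'n) set set" where
  "basis0 = (SOME B. countable B \<and> topological_basis B)"

lemma basis0: "countable basis0" "topological_basis basis0"
proof -
  have "countable basis0 \<and> topological_basis basis0"
    unfolding basis0_def by (rule someI_ex[OF ex_countable_basis])
  then show "countable basis0" "topological_basis basis0" by auto
qed

text \<open>The diameter bound makes the position of a given prototile within such a set unique in
  any hull element.\<close>

definition basis :: "(real^'n) set set" where
  "basis = {D\<in>basis0. \<forall>x\<in>D. \<forall>y\<in>D. dist x y < rad}"

lemma countable_basis: "countable basis"
  using basis0(1) by (simp add: basis_def)

lemma basis_open: "D \<in> basis \<Longrightarrow> open D"
  using basis0(2) topological_basis_open by (auto simp: basis_def)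

lemma basis_small: "D \<in> basis \<Longrightarrow> x \<in> D \<Longrightarrow> y \<in> D \<Longrightarrow> dist x y < rad"
  by (simp add: basis_def)

lemma ex_basis:
  assumes "open U" "x \<in> U"
  shows "\<exists>D\<in>basis. x \<in> D \<and> D \<subseteq> U"
proof -
  have "open (U \<inter> ball x (rad / 2))" "x \<in> U \<inter> ball x (rad / 2)" using assms rad_pos by auto
  then obtain D where D: "D \<in> basis0" "x \<in> D" "D \<subseteq> U \<inter> ball x (rad / 2)"
    using topological_basisE[OF basis0(2)] by blast
  have "dist y z < rad" if "y \<in> D" "z \<in> D" for y z
  proof -
    have "dist x y < rad / 2" "dist x z < rad / 2" using that D(3) by auto
    then show ?thesis using dist_triangle3[of y z x] by simp
  qed
  then show ?thesis using D by (auto simp: basis_def)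
qed

text \<open>For infinite \<open>F\<close> openness is not at hand. On a small set \<open>D\<close>
  the position is unique, so the event is a countable intersection of events about two tiles; a
  general \<open>D\<close> is a countable union of small ones.\<close>

lemma occ_countable_sets:
  assumes P: "P \<in> A" and D: "open D" and F: "countable F" "0 \<in> F"
  shows "occ P D F \<in> sets \<mu>"
proof -
  have small: "occ P D F \<in> sets \<mu>" if D: "D \<in> basis" for D
  proof -
    have "occ P D F = (\<Inter>v\<in>F. occ P D {0, v})"
    proof (intro equalityI subsetI)
      fix S assume "S \<in> occ P D F"
      then show "S \<in> (\<Inter>v\<in>F. occ P D {0, v})" using F(2) by (auto simp: occ_def)
    next
      fix S assume S: "S \<in> (\<Inter>v\<in>F. occ P D {0, v})"
      then obtain t where t: "S \<in> X" "t \<in> D" "tr P t \<in> S" using F(2) by (force simp: occ_def)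
      have "tr P (t + v) \<in> S" if "v \<in> F" for v
      proof -
        have "S \<in> occ P D {0, v}" using S that by blast
        then obtain t' where t': "t' \<in> D" "tr P t' \<in> S" "tr P (t' + v) \<in> S" by (auto simp: occ_def)
        have "dist t t' < 2 * rad" using basis_small[OF D t(2) t'(1)] rad_pos by simp
        then have "t = t'" using A_patch_separated[OF A_patch_hull[OF t(1)] P t(3) t'(2)] by blast
        then show ?thesis using t' by simp
      qed
      then show "S \<in> occ P D F" using t by (auto simp: occ_def)
    qed
    moreover have "occ P D {0, v} \<in> sets \<mu>" for v
      using P basis_open[OF D] by (intro occ_finite_sets) auto
    ultimately show ?thesis using F by (auto intro!: sets.countable_INT')
  qed
  have "occ P D F = (\<Union>D'\<in>{D'\<in>basis. D' \<subseteq> D}. occ P D' F)"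
    using ex_basis[OF D] by (auto simp: occ_def) blast
  then show ?thesis using small countable_basis by (auto intro!: sets.countable_UN')
qed

definition cyl :: "(('n, 'l) tile \<times> (real^'n) set) set \<Rightarrow> (real^'n) set \<Rightarrow> ('n, 'l) patch set" where
  "cyl K F = {S\<in>X. \<forall>(P, D)\<in>K. S \<in> occ P D F}"

definition indices :: "(('n, 'l) tile \<times> (real^'n) set) set set" where
  "indices = {K. finite K \<and> K \<subseteq> A \<times> basis}"

lemma countable_indices: "countable indices"
proof -
  have "indices = {K. K \<subseteq> A \<times> basis \<and> finite K}" by (auto simp: indices_def)
  moreover have "countable (A \<times> basis)" using finA countable_basis by (simp add: countable_finite)
  ultimately show ?thesis using countable_Collect_finite_subset by (metis (no_types, lifting) Collect_cong)
qed

lemma cyl_sets: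
  assumes "K \<in> indices" "countable F" "0 \<in> F"
  shows "cyl K F \<in> sets \<mu>"
proof -
  have "cyl K F = X \<inter> (\<Inter>(P, D)\<in>K. occ P D F)" by (auto simp: cyl_def)
  moreover have "finite K" using assms by (simp add: indices_def)
  moreover have "X \<in> sets \<mu>" using space_mu sets.top by metis
  moreover have "occ P D F \<in> sets \<mu>" if "(P, D) \<in> K" for P D
    using that assms by (intro occ_countable_sets basis_open) (auto simp: indices_def)
  ultimately show ?thesis by (cases "K = {}") (auto intro!: sets.Int sets.finite_INT)
qed

text \<open>The cylinder fixes, up to a small error, all tiles of \<open>S\<close> that meet the
  ball. By rigidity they are displaced by one common vector; translating it away gives exact
  agreement on the ball.\<close>

lemma lm_nbhd_cylinder:
  assumes S: "S \<in> X" and R: "R > 0" and e: "e > 0"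
  shows "\<exists>K\<in>indices. S \<in> cyl K {0} \<and> cyl K {0} \<subseteq> lm_nbhd R e S"
proof -
  define Pi where "Pi = patch_meet S (ball 0 R)"
  have fin: "finite Pi" unfolding Pi_def by (rule finite_patch_meet[OF A_patch_hull[OF S]]) simp
  have PiS: "T \<in> S" "supp T \<noteq> {}" if "T \<in> Pi" for T
    using that by (auto simp: Pi_def patch_meet_def)
  have "\<exists>P t. P \<in> A \<and> T = tr P t" if "T \<in> Pi" for T
    using A_patch_hull[OF S] PiS[OF that] unfolding A_patch_def by blast
  then obtain p t where pt: "\<And>T. T \<in> Pi \<Longrightarrow> p T \<in> A \<and> T = tr (p T) (t T)" by metis
  have "bounded (t ` Pi)" using fin by (simp add: finite_imp_bounded)
  then obtain R1 where R1: "\<And>T. T \<in> Pi \<Longrightarrow> norm (t T) \<le> R1" by (auto simp: bounded_iff)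
  obtain \<eta> where \<eta>: "\<eta> > 0" and rigid: "\<forall>S\<in>X. \<forall>S'\<in>X. \<forall>P\<in>A. \<forall>P'\<in>A. \<forall>t t' s s'.
     tr P t \<in> S \<longrightarrow> tr P' t' \<in> S \<longrightarrow> tr P s \<in> S' \<longrightarrow> tr P' s' \<in> S' \<longrightarrow> norm (t' - t) \<le> 2 * R1 \<longrightarrow>
     norm (s - t) < \<eta> \<longrightarrow> norm (s' - t') < \<eta> \<longrightarrow> s - t = s' - t'"
    using rigidity[of "2 * R1"] by blast
  have "\<exists>D\<in>basis. t T \<in> D \<and> D \<subseteq> ball (t T) (min \<eta> e)" for T
    using \<eta> e by (intro ex_basis) auto
  then obtain D where D: "\<And>T. D T \<in> basis \<and> t T \<in> D T \<and> D T \<subseteq> ball (t T) (min \<eta> e)" by metis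
  define K where "K = (\<lambda>T. (p T, D T)) ` Pi"
  have K: "K \<in> indices" using fin pt D by (auto simp: K_def indices_def)
  have SK: "S \<in> cyl K {0}"
    using S pt D PiS by (fastforce simp: cyl_def K_def occ_def)
  have "cyl K {0} \<subseteq> lm_nbhd R e S"
  proof
    fix S' assume "S' \<in> cyl K {0}"
    then have S': "S' \<in> X" and "\<And>T. T \<in> Pi \<Longrightarrow> \<exists>s. s \<in> D T \<and> tr (p T) s \<in> S'"
      by (auto simp: cyl_def K_def occ_def)
    then obtain s where s: "\<And>T. T \<in> Pi \<Longrightarrow> s T \<in> D T \<and> tr (p T) (s T) \<in> S'" by metis
    have near: "norm (s T - t T) < min \<eta> e" if "T \<in> Pi" for T
      using s[OF that] D[of T] by (auto simp: dist_norm norm_minus_commute dest!: subsetD)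
    \<comment> \<open>Some tile covers the origin, so \<open>Pi\<close> is nonempty; the
      displacement of this tile serves as the common one.\<close>
    obtain T0 where T0: "T0 \<in> Pi"
      using hull_covers[OF S, of 0] R by (force simp: Pi_def patch_meet_def)
    define w where "w = s T0 - t T0"
    have sw: "s T = t T + w" if T: "T \<in> Pi" for T
    proof -
      have "norm (t T - t T0) \<le> 2 * R1" using R1[OF T] R1[OF T0] norm_triangle_ineq4[of "t T" "t T0"] by simp
      moreover have "tr (p T) (t T) \<in> S" "tr (p T0) (t T0) \<in> S" using PiS pt T T0 by metis+
      ultimately have "s T0 - t T0 = s T - t T"
        using rigid S S' pt[OF T] pt[OF T0] s[OF T] s[OF T0] near[OF T] near[OF T0] by (metis min_less_iff_conj)
      then show ?thesis by (simp add: w_def algebra_simps)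
    qed
    have sub: "Pi \<subseteq> tr_patch S' (- w)"
    proof
      fix T assume T: "T \<in> Pi"
      have "tr T w = tr (p T) (s T)" using pt[OF T] sw[OF T] by (metis tr_tr)
      then show "T \<in> tr_patch S' (- w)" using s[OF T] by (simp add: mem_tr_patch)
    qed
    have S'w: "tr_patch S' (- w) \<in> X" by (rule hull_translate[OF S'])
    have "patch_meet (tr_patch S' (- w)) (ball 0 R) = Pi"
    proof
      show "Pi \<subseteq> patch_meet (tr_patch S' (- w)) (ball 0 R)"
        using sub unfolding Pi_def patch_meet_def by blast
      show "patch_meet (tr_patch S' (- w)) (ball 0 R) \<subseteq> Pi"
      proof
        fix T assume T: "T \<in> patch_meet (tr_patch S' (- w)) (ball 0 R)"
        then have T1: "T \<in> tr_patch S' (- w)" "supp T \<inter> ball 0 R \<noteq> {}" by (auto simp: patch_meet_def)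
        then obtain P x where P: "P \<in> A" "T = tr P x"
          using A_patch_hull[OF S'w] unfolding A_patch_def by blast
        \<comment> \<open>No further tile can meet the ball: it would have interior points there,
          which a tile of \<open>Pi\<close> already covers.\<close>
        have "supp T = closure (interior (supp T))"
          using is_tile_tr[OF tileA[OF P(1)]] P(2) by (simp add: is_tile_def)
        then have "interior (supp T) \<inter> ball 0 R \<noteq> {}"
          using T1(2) open_Int_closure_eq_empty[OF open_ball, of 0 R "interior (supp T)"] by (metis Int_commute)
        then obtain z where z: "z \<in> interior (supp T)" "z \<in> ball 0 R" by blast
        obtain T' where T': "T' \<in> S" "z \<in> supp T'" using hull_covers[OF S] by blast
        then have "T' \<in> Pi" using z(2) by (auto simp: Pi_def patch_meet_def)
        moreover have "T = T'"
          using A_patch_overlap[OF A_patch_hull[OF S'w] T1(1), of T'] sub \<open>T' \<in> Pi\<close> T'(2) z(1) by blast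
        ultimately show "T \<in> Pi" by simp
      qed
    qed
    then have "patch_meet (tr_patch S' (- w)) (ball 0 R) = patch_meet (tr_patch S 0) (ball 0 R)"
      by (simp add: Pi_def)
    moreover have "norm (- w) < e" using near[OF T0] by (simp add: w_def norm_minus_commute)
    ultimately show "S' \<in> lm_nbhd R e S" unfolding lm_nbhd_def using e
      by (intro CollectI exI[of _ "- w"] exI[of _ 0] conjI) simp_all
  qed
  then show ?thesis using K SK by blast
qed

text \<open>An open set is the union of the cylinders inside it, and there are only countably many
  cylinders.\<close>

lemma sets_mu_cyl: "sets \<mu> = sigma_sets X {cyl K {0} | K. K \<in> indices}" (is "_ = sigma_sets X ?G")
proof
  have "?G \<subseteq> sets \<mu>" using cyl_sets by auto
  then have "sigma_sets (space \<mu>) ?G \<subseteq> sets \<mu>" by (rule sets.sigma_sets_subset)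
  then show "sigma_sets X ?G \<subseteq> sets \<mu>" by (simp add: space_mu)
  have "U \<inter> X \<in> sigma_sets X ?G" if U: "lm_open U" for U
  proof -
    have "U \<inter> X = (\<Union>K\<in>{K\<in>indices. cyl K {0} \<subseteq> U}. cyl K {0})"
    proof (intro equalityI subsetI)
      fix S assume S: "S \<in> U \<inter> X"
      then obtain R e where "R > 0" "e > 0" "lm_nbhd R e S \<subseteq> U" using U unfolding lm_open_def by blast
      then show "S \<in> (\<Union>K\<in>{K\<in>indices. cyl K {0} \<subseteq> U}. cyl K {0})"
        using lm_nbhd_cylinder[of S R e] S by blast
    qed (auto simp: cyl_def)
    moreover have "countable {K\<in>indices. cyl K {0} \<subseteq> U}" using countable_indices by simp
    moreover have "sigma_algebra X (sigma_sets X ?G)" by (rule sigma_algebra_sigma_sets) (auto simp: cyl_def)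
    moreover have "cyl K {0} \<in> sigma_sets X ?G" if "K \<in> {K\<in>indices. cyl K {0} \<subseteq> U}" for K
      using that by (intro sigma_sets.Basic) blast
    ultimately show ?thesis by (simp only: sigma_algebra.countable_UN'')
  qed
  then show "sets \<mu> \<subseteq> sigma_sets X ?G"
    unfolding sets_mu by (intro sigma_sets_mono) auto
qed

lemma Int_stable_cyl: "Int_stable {cyl K {0} | K. K \<in> indices}"
proof (rule Int_stableI)
  fix a b assume "a \<in> {cyl K {0} | K. K \<in> indices}" "b \<in> {cyl K {0} | K. K \<in> indices}"
  then obtain K K' where K: "K \<in> indices" "a = cyl K {0}" "K' \<in> indices" "b = cyl K' {0}" by blast
  then have "a \<inter> b = cyl (K \<union> K') {0}" "K \<union> K' \<in> indices"
    by (auto simp: cyl_def indices_def ball_Un)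
  then show "a \<inter> b \<in> {cyl K {0} | K. K \<in> indices}" by blast
qed

text \<open>The condition that a position minus \<open>x\<close> lies in the open set
  \<open>D\<close> is exhausted by countably many rectangles \<open>D1\<close>, \<open>D2\<close>
  whose differences stay in \<open>D\<close>.\<close>

lemma flow_jointly_measurable:
  "(\<lambda>(x, S). tr_patch S (- x)) \<in> borel \<Otimes>\<^sub>M \<mu> \<rightarrow>\<^sub>M \<mu>"
proof (rule measurable_sigma_sets[OF sets_mu_cyl])
  let ?f = "\<lambda>(x :: real^'n, S). tr_patch S (- x)"
  let ?N = "borel \<Otimes>\<^sub>M \<mu> :: ((real^'n) \<times> ('n, 'l) patch) measure"
  have spc: "space ?N = UNIV \<times> X" by (simp add: space_pair_measure space_mu)
  show "{cyl K {0} | K. K \<in> indices} \<subseteq> Pow X" by (auto simp: cyl_def)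
  show "?f \<in> space ?N \<rightarrow> X" using hull_translate by (auto simp: spc)
  have occ: "?f -` occ P D {0} \<inter> space ?N \<in> sets ?N" if P: "P \<in> A" and D: "open D" for P D
  proof -
    let ?I = "{(D1, D2)\<in>basis \<times> basis. \<forall>t\<in>D1. \<forall>x\<in>D2. t - x \<in> D}"
    have "?f -` occ P D {0} \<inter> space ?N = (\<Union>(D1, D2)\<in>?I. D2 \<times> occ P D1 {0})"
    proof (intro equalityI subsetI)
      fix w assume w: "w \<in> ?f -` occ P D {0} \<inter> space ?N"
      obtain x S where xS: "w = (x, S)" by (cases w)
      have S: "S \<in> X" using w by (simp add: xS spc)
      obtain t where t: "t \<in> D" "tr P t \<in> tr_patch S (- x)" using w by (auto simp: xS occ_def)
      obtain d where d: "d > 0" "ball t d \<subseteq> D" using D t(1) openE by blast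
      obtain D1 where D1: "D1 \<in> basis" "t + x \<in> D1" "D1 \<subseteq> ball (t + x) (d / 2)"
        using ex_basis[of "ball (t + x) (d / 2)" "t + x"] d by auto
      obtain D2 where D2: "D2 \<in> basis" "x \<in> D2" "D2 \<subseteq> ball x (d / 2)"
        using ex_basis[of "ball x (d / 2)" x] d by auto
      have "t' - x' \<in> D" if "t' \<in> D1" "x' \<in> D2" for t' x'
      proof -
        have "norm ((t + x) - t') < d / 2" "norm (x - x') < d / 2" using that D1 D2 by (auto simp: dist_norm)
        then have "norm (((t + x) - t') - (x - x')) < d" using norm_triangle_ineq4[of "(t + x) - t'" "x - x'"] by simp
        then have "t' - x' \<in> ball t d" by (simp add: dist_norm algebra_simps)
        then show ?thesis using d by blast
      qed
      then have "(D1, D2) \<in> ?I" using D1 D2 by simp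
      moreover have "S \<in> occ P D1 {0}" using S t(2) D1(2) by (auto simp: occ_def mem_tr_patch tr_tr)
      ultimately show "w \<in> (\<Union>(D1, D2)\<in>?I. D2 \<times> occ P D1 {0})" using D2 xS by blast
    next
      fix w assume "w \<in> (\<Union>(D1, D2)\<in>?I. D2 \<times> occ P D1 {0})"
      then obtain D1 D2 x S t where *: "w = (x, S)" "x \<in> D2" "S \<in> X" "t \<in> D1" "tr P t \<in> S"
        "\<forall>t\<in>D1. \<forall>x\<in>D2. t - x \<in> D" by (auto simp: occ_def)
      then have "t - x \<in> D" "tr P (t - x) \<in> tr_patch S (- x)" by (auto simp: mem_tr_patch tr_tr)
      then show "w \<in> ?f -` occ P D {0} \<inter> space ?N"
        using * hull_translate by (auto simp: occ_def spc)
    qed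
    moreover have "countable ?I" by (rule countable_subset[of _ "basis \<times> basis"]) (auto simp: countable_basis)
    moreover have "D2 \<times> occ P D1 {0} \<in> sets ?N" if "(D1, D2) \<in> ?I" for D1 D2
      using that basis_open P by (auto intro!: pair_measureI occ_finite_sets)
    ultimately show ?thesis by (auto intro!: sets.countable_UN')
  qed
  fix y assume "y \<in> {cyl K {0} | K. K \<in> indices}"
  then obtain K where K: "K \<in> indices" "y = cyl K {0}" by blast
  have "?f -` y \<inter> space ?N = {w\<in>space ?N. \<forall>k\<in>K. w \<in> ?f -` occ (fst k) (snd k) {0} \<inter> space ?N}"
    using hull_translate by (auto simp: K(2) cyl_def spc)
  also have "\<dots> \<in> sets ?N"
  proof (rule sets.sets_Collect_finite_All)
    show "finite K" using K by (simp add: indices_def)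
    fix k assume "k \<in> K"
    then have "?f -` occ (fst k) (snd k) {0} \<inter> space ?N \<in> sets ?N"
      using K basis_open by (intro occ) (auto simp: indices_def)
    moreover have "{w\<in>space ?N. w \<in> ?f -` occ (fst k) (snd k) {0} \<inter> space ?N} = ?f -` occ (fst k) (snd k) {0} \<inter> space ?N"
      by blast
    ultimately show "{w\<in>space ?N. w \<in> ?f -` occ (fst k) (snd k) {0} \<inter> space ?N} \<in> sets ?N" by simp
  qed
  finally show "?f -` y \<inter> space ?N \<in> sets ?N" .
qed

end

section \<open>Periodic occurrences of tiles\<close>

text \<open>The minus sign makes \<open>eigen_everywhere\<close> agree with the eigenvalue equation,
  which translates by \<open>- x\<close>.\<close>

sublocale tiling_system \<subseteq> flow: measure_flow \<mu> "\<lambda>x S. tr_patch S (- x)"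
proof (rule measure_flow.intro[OF prob_mu measure_flow_axioms.intro])
  show "(\<lambda>(x, S). tr_patch S (- x)) \<in> borel \<Otimes>\<^sub>M \<mu> \<rightarrow>\<^sub>M \<mu>" by (rule flow_jointly_measurable)
  show "distr \<mu> \<mu> (\<lambda>S. tr_patch S (- x)) = \<mu>" for x
    using \<mu> by (simp add: invariant_hull_measure_def)
qed (simp_all add: tr_patch_tr_patch add.commute)

context tiling_system
begin

section \<open>Periodic cylinder events\<close>

lemma cyl_alt: "cyl K F = {S\<in>X. \<forall>k\<in>K. S \<in> occ (fst k) (snd k) F}"
  by (simp add: cyl_def case_prod_beta)

lemma occ_antimono: "F' \<subseteq> F \<Longrightarrow> occ P D F \<subseteq> occ P D F'"
  unfolding occ_def by blast

lemma cyl_antimono: "F' \<subseteq> F \<Longrightarrow> cyl K F \<subseteq> cyl K F'"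
proof
  fix S assume "F' \<subseteq> F" "S \<in> cyl K F"
  then have "S \<in> X" "\<forall>k\<in>K. S \<in> occ (fst k) (snd k) F'"
    using occ_antimono[of F' F] unfolding cyl_alt by blast+
  then show "S \<in> cyl K F'" unfolding cyl_alt by blast
qed

lemma periodic_cyl:
  assumes lin: "linear B"
  shows "flow.periodic_set B (cyl K (B ` Zvec))"
proof -
  have imp: "tr_patch S (- B k) \<in> cyl K (B ` Zvec)" if S: "S \<in> cyl K (B ` Zvec)" and k: "k \<in> Zvec" for S k
  proof -
    have "tr_patch S (- B k) \<in> occ P D (B ` Zvec)" if PD: "(P, D) \<in> K" for P D
    proof -
      obtain t where t: "t \<in> D" "\<forall>v\<in>B ` Zvec. tr P (t + v) \<in> S" using S PD by (auto simp: cyl_def occ_def)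
      have "tr P (t + B l) \<in> tr_patch S (- B k)" if "l \<in> Zvec" for l
        using t(2) Zvec_add[OF that k] by (auto simp: mem_tr_patch tr_tr linear_add[OF lin] add.assoc[symmetric])
      then show ?thesis using t(1) S hull_translate by (auto simp: occ_def cyl_def)
    qed
    then show ?thesis using S hull_translate by (auto simp: cyl_def)
  qed
  have "S \<in> cyl K (B ` Zvec)" if "tr_patch S (- B k) \<in> cyl K (B ` Zvec)" "k \<in> Zvec" for S k
    using imp[OF that(1), of "- k"] that(2) by (simp add: Zvec_uminus tr_patch_tr_patch linear_neg[OF lin])
  with imp show ?thesis unfolding flow.periodic_set_def by blast
qed

text \<open>For infinite \<open>F\<close> membership involves tiles arbitrarily far away. A
  translation by \<open>h\<close> moves all of them together from \<open>t\<close> to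
  \<open>t - h\<close>, so openness of the position set suffices along orbits.\<close>

lemma orbitwise_open_cyl:
  assumes K: "K \<in> indices"
  shows "flow.orbitwise_open (cyl K F)"
  unfolding flow.orbitwise_open_def
proof (intro ballI allI impI)
  fix S and h :: "nat \<Rightarrow> real^'n" assume S: "S \<in> cyl K F" and h: "h \<longlonglongrightarrow> 0"
  have "\<forall>\<^sub>F n in sequentially. tr_patch S (- h n) \<in> occ (fst k) (snd k) F" if k: "k \<in> K" for k
  proof -
    obtain t where t: "t \<in> snd k" "\<forall>v\<in>F. tr (fst k) (t + v) \<in> S" "S \<in> X"
      using S k by (auto simp: cyl_def occ_def)
    have "(\<lambda>n. t - h n) \<longlonglongrightarrow> t - 0" by (intro tendsto_intros h)
    moreover have "open (snd k)" using K k basis_open by (auto simp: indices_def)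
    ultimately have "\<forall>\<^sub>F n in sequentially. t - h n \<in> snd k"
      using t(1) topological_tendstoD by fastforce
    then show ?thesis
    proof eventually_elim
      case (elim n)
      have "tr (fst k) ((t - h n) + v) \<in> tr_patch S (- h n)" if "v \<in> F" for v
        using t(2) that by (simp add: mem_tr_patch tr_tr)
      then show ?case using elim t(3) hull_translate unfolding occ_def by blast
    qed
  qed
  moreover have "finite K" using K by (simp add: indices_def)
  ultimately have "\<forall>\<^sub>F n in sequentially. \<forall>k\<in>K. tr_patch S (- h n) \<in> occ (fst k) (snd k) F"
    by (simp add: eventually_ball_finite)
  then show "\<forall>\<^sub>F n in sequentially. tr_patch S (- h n) \<in> cyl K F"
    by eventually_elim (use S hull_translate in \<open>auto simp: cyl_def\<close>)
qed

text \<open>As the lattices shrink, periodic occurrences increase to all occurrences up to a null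
  set, so the integral over each plain cylinder vanishes in the limit. Plain cylinders are stable
  under intersection and generate the Borel sets.\<close>

lemma integral_all_sets_eq_0:
  assumes \<Lambda>: "\<And>n. countable (\<Lambda> n)" "\<And>n. 0 \<in> \<Lambda> n" "decseq \<Lambda>"
    and null: "\<And>P D. P \<in> A \<Longrightarrow> D \<in> basis \<Longrightarrow> (\<lambda>n. measure \<mu> (occ P D {0} - occ P D (\<Lambda> n))) \<longlonglongrightarrow> 0"
    and g: "L2 \<mu> g"
    and zero: "\<And>K n. K \<in> indices \<Longrightarrow> (LINT S|\<mu>. g S * indicator (cyl K (\<Lambda> n)) S) = 0"
  shows "AE S in \<mu>. g S = 0"
proof -
  have gI: "integrable \<mu> g" by (rule flow.L2_integrable[OF g])
  then have [measurable]: "g \<in> borel_measurable \<mu>" by simp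
  have gInd: "integrable \<mu> (\<lambda>S. g S * indicator V S)" if [measurable]: "V \<in> sets \<mu>" for V
    by (rule Bochner_Integration.integrable_bound[OF gI]) (auto split: split_indicator)
  have occ_mono: "S \<in> occ P D (\<Lambda> m)" if "S \<in> occ P D (\<Lambda> n)" "n \<le> m" for S P D n m
    using that occ_antimono[OF decseqD[OF \<Lambda>(3) that(2)]] by blast
  have "AE S in \<mu>. S \<in> occ P D {0} \<longrightarrow> (\<exists>n. S \<in> occ P D (\<Lambda> n))" if P: "P \<in> A" and D: "D \<in> basis" for P D
  proof -
    have sets: "occ P D {0} - occ P D (\<Lambda> n) \<in> sets \<mu>" for n
      using occ_countable_sets[OF P basis_open[OF D]] \<Lambda>(1,2) by auto
    define N where "N = (\<Inter>n. occ P D {0} - occ P D (\<Lambda> n))"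
    have N: "N \<in> sets \<mu>" unfolding N_def using sets by (intro sets.countable_INT) auto
    have "measure \<mu> N \<le> measure \<mu> (occ P D {0} - occ P D (\<Lambda> n))" for n
      by (rule flow.finite_measure_mono) (auto simp: N_def sets)
    then have "measure \<mu> N \<le> 0" using LIMSEQ_le_const[OF null[OF P D]] by blast
    then have "emeasure \<mu> N = 0" using measure_nonneg[of \<mu> N] by (simp add: flow.emeasure_eq_measure)
    then have "AE S in \<mu>. S \<notin> N" using N by (intro AE_not_in null_setsI)
    then show ?thesis by eventually_elim (auto simp: N_def)
  qed
  note ae = this
  have cyl0: "(LINT S|\<mu>. g S * indicator (cyl K {0}) S) = 0" if K: "K \<in> indices" for K
  proof -
    have finK: "finite K" using K by (simp add: indices_def)
    have "AE S in \<mu>. \<forall>k\<in>K. S \<in> occ (fst k) (snd k) {0} \<longrightarrow> (\<exists>n. S \<in> occ (fst k) (snd k) (\<Lambda> n))"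
      using K by (intro AE_finite_allI[OF finK] ae) (auto simp: indices_def)
    then have lim: "AE S in \<mu>. (\<lambda>n. g S * indicator (cyl K (\<Lambda> n)) S) \<longlonglongrightarrow> g S * indicator (cyl K {0}) S"
    proof eventually_elim
      case (elim S)
      show ?case
      proof (cases "S \<in> cyl K {0}")
        case False
        then have "S \<notin> cyl K (\<Lambda> n)" for n using cyl_antimono[of "{0}" "\<Lambda> n" K] \<Lambda>(2)[of n] by blast
        then show ?thesis using False by simp
      next
        case True
        then have "\<forall>k\<in>K. \<exists>n. S \<in> occ (fst k) (snd k) (\<Lambda> n)" using elim unfolding cyl_alt by blast
        then obtain n where n: "\<And>k. k \<in> K \<Longrightarrow> S \<in> occ (fst k) (snd k) (\<Lambda> (n k))" by metis
        define N where "N = Max (insert 0 (n ` K))"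
        have nN: "n k \<le> N" if "k \<in> K" for k using finK that by (simp add: N_def)
        then have "S \<in> cyl K (\<Lambda> m)" if "m \<ge> N" for m
        proof -
          have "S \<in> occ (fst k) (snd k) (\<Lambda> m)" if "k \<in> K" for k
            using occ_mono[OF n[OF that], of m] nN[OF that] \<open>m \<ge> N\<close> by simp
          then show ?thesis using True by (simp add: cyl_alt)
        qed
        then have "\<forall>\<^sub>F m in sequentially. g S * indicator (cyl K (\<Lambda> m)) S = g S * indicator (cyl K {0}) S"
          using True by (auto simp: eventually_sequentially intro!: exI[of _ N])
        then show ?thesis by (rule tendsto_eventually)
      qed
    qed
    have [measurable]: "cyl K (\<Lambda> n) \<in> sets \<mu>" "cyl K {0} \<in> sets \<mu>" for n
      using K \<Lambda> by (auto intro!: cyl_sets)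
    have "(\<lambda>n. LINT S|\<mu>. g S * indicator (cyl K (\<Lambda> n)) S) \<longlonglongrightarrow> (LINT S|\<mu>. g S * indicator (cyl K {0}) S)"
      by (rule integral_dominated_convergence[where w="\<lambda>S. cmod (g S)"])
        (use gI lim in \<open>auto split: split_indicator\<close>)
    then have "(\<lambda>n::nat. 0) \<longlonglongrightarrow> (LINT S|\<mu>. g S * indicator (cyl K {0}) S)" by (simp only: zero[OF K])
    then show ?thesis using LIMSEQ_unique tendsto_const by blast
  qed
  \<comment> \<open>The empty index set gives the whole hull, which the complement step
    requires.\<close>
  have space: "(LINT S|\<mu>. g S * indicator X S) = 0"
    using cyl0[of "{}"] by (simp add: cyl_def indices_def)
  have "(LINT S|\<mu>. g S * indicator V S) = 0" if V: "V \<in> sets \<mu>" for V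
  proof -
    have "{cyl K {0} | K. K \<in> indices} \<subseteq> Pow X" by (auto simp: cyl_def)
    from Int_stable_cyl this V[unfolded sets_mu_cyl] show ?thesis
    proof (induction rule: sigma_sets_induct_disjoint)
      case (basic V)
      then show ?case using cyl0 by blast
    next
      case empty
      then show ?case by simp
    next
      case (compl V)
      then have V: "V \<in> sets \<mu>" by (simp add: sets_mu_cyl)
      have "X \<in> sets \<mu>" using space_mu sets.top by metis
      have "g S * indicator (X - V) S = g S * indicator X S - g S * indicator V S" for S
        using sets.sets_into_space[OF V] by (auto simp: space_mu split: split_indicator)
      then show ?case using gInd[OF V] gInd[OF \<open>X \<in> sets \<mu>\<close>] compl space by simp
    next
      case (union V)
      then have V [measurable]: "V i \<in> sets \<mu>" for i by (auto simp: sets_mu_cyl)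
      have "set_lebesgue_integral \<mu> (\<Union>i. V i) g = (\<Sum>i. set_lebesgue_integral \<mu> (V i) g)"
        using union(1) gInd[of "\<Union>i. V i"]
        by (intro lebesgue_integral_countable_add)
          (auto simp: disjoint_family_on_def set_integrable_def scaleR_conv_of_real mult.commute of_real_indicator)
      moreover have "set_lebesgue_integral \<mu> W g = (LINT S|\<mu>. g S * indicator W S)" for W
        by (simp add: set_lebesgue_integral_def scaleR_conv_of_real mult.commute of_real_indicator)
      ultimately show ?case using union by simp
    qed
  qed
  then have "set_lebesgue_integral \<mu> V g = 0" if "V \<in> sets \<mu>" for V
    using that by (simp add: set_lebesgue_integral_def scaleR_conv_of_real mult.commute of_real_indicator)
  then show ?thesis using flow.density_zero[OF gI] by blast
qed

text \<open>Positions of a prototile in one patch are separated, so a convergent sequence of them is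
  eventually constant.\<close>

lemma tile_occurrence_limit:
  assumes S: "S \<in> X" and P: "P \<in> A" and ev: "\<forall>\<^sub>F k in sequentially. tr P (s k) \<in> S" and s: "s \<longlonglongrightarrow> a"
  shows "tr P a \<in> S"
proof -
  obtain k0 where k0: "\<And>k. k \<ge> k0 \<Longrightarrow> tr P (s k) \<in> S \<and> dist (s k) a < rad"
    using eventually_conj[OF ev tendstoD[OF s rad_pos]] by (auto simp: eventually_sequentially)
  have "s k = s k0" if "k \<ge> k0" for k
  proof (rule A_patch_separated[OF A_patch_hull[OF S] P])
    show "dist (s k) (s k0) < 2 * rad" using k0[OF that] k0[of k0] dist_triangle2[of "s k" "s k0" a] by simp
  qed (use k0 that in auto)
  then have "\<forall>\<^sub>F k in sequentially. s k = s k0" unfolding eventually_sequentially by blast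
  then have "s \<longlonglongrightarrow> s k0" by (rule tendsto_eventually)
  then have "a = s k0" using s LIMSEQ_unique by blast
  then show ?thesis using k0 by simp
qed

text \<open>Compactness of \<open>R^n\<close> modulo the lattice \<open>B Z^n\<close>: the lattice-periodic part of the tiling
  survives, up to one translation, in every element of the hull.\<close>
lemma periodic_part_in_hull:
  fixes B :: "real^'n \<Rightarrow> real^'n"
  assumes S: "S \<in> X" and lin: "linear B" and bij: "bij B"
  shows "\<exists>s. \<forall>T. (\<forall>k\<in>Zvec. tr T (B k) \<in> Tl) \<longrightarrow> tr T s \<in> S"
proof -
  obtain y where y: "\<And>k::nat. patch_meet S (ball 0 (real k)) = patch_meet (tr_patch Tl (y k)) (ball 0 (real k))"
    using choice[of "\<lambda>(k::nat) y. patch_meet S (ball 0 (real k)) = patch_meet (tr_patch Tl y) (ball 0 (real k))"]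
      hull_local_agreement[OF S] by blast
  \<comment> \<open>Lattice vectors map periodic tiles to tiles of \<open>Tl\<close>, so
    \<open>y k\<close> can be reduced modulo the lattice into a bounded set; a limit point of the
    reduced translations is the one sought.\<close>
  define m where "m k = (\<chi> i. real_of_int \<lfloor>inv B (y k) $ i + 1/2\<rfloor>)" for k
  have m: "inv B (y k) - m k \<in> unit_cube" "m k \<in> Zvec" for k
    using nearest_Zvec[of "inv B (y k)" "m k"] by (auto simp: m_def)
  define s where "s k = B (inv B (y k) - m k)" for k
  have s: "s k = y k + B (- m k)" for k
    using bij by (simp add: s_def linear_diff[OF lin] linear_neg[OF lin] bij_is_surj surj_f_inv_f)
  have bB: "bounded (B ` unit_cube)"
    by (rule bounded_linear_image[OF bounded_unit_cube]) (use lin in \<open>simp add: linear_conv_bounded_linear\<close>)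
  then have "bounded (range s)" by (rule bounded_subset) (use m in \<open>auto simp: s_def\<close>)
  then obtain a r where r: "strict_mono r" "(s \<circ> r) \<longlonglongrightarrow> a"
    using bounded_imp_convergent_subsequence by blast
  obtain M where M: "\<And>k. norm (s k) \<le> M" using \<open>bounded (range s)\<close> by (auto simp: bounded_iff)
  have "tr T a \<in> S" if T: "\<forall>k\<in>Zvec. tr T (B k) \<in> Tl" for T
  proof -
    have "T \<in> Tl" using T zero_Zvec linear_0[OF lin] by force
    then obtain P t where P: "P \<in> A" "T = tr P t" using TlA by blast
    then have "supp T \<noteq> {}" using neA by simp
    then obtain z where z: "z \<in> supp T" by blast
    have in_S: "tr T (s k) \<in> S" if "real k > norm z + M" for k
    proof -
      have "tr T (B (- m k)) \<in> Tl" using T m(2) Zvec_uminus by blast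
      then have "tr T (s k) \<in> tr_patch Tl (y k)" by (simp add: mem_tr_patch tr_tr s)
      moreover have "z + s k \<in> supp (tr T (s k))" using z by (simp add: mem_supp_tr)
      moreover have "norm (z + s k) < real k" using that M[of k] norm_triangle_ineq[of z "s k"] by linarith
      then have "z + s k \<in> ball 0 (real k)" by simp
      ultimately have "tr T (s k) \<in> patch_meet (tr_patch Tl (y k)) (ball 0 (real k))"
        unfolding patch_meet_def by blast
      then show ?thesis unfolding y[symmetric] by (simp add: patch_meet_def)
    qed
    have "\<forall>\<^sub>F k in sequentially. tr P (t + (s \<circ> r) k) \<in> S"
    proof -
      obtain k0 :: nat where k0: "real k0 > norm z + M" using reals_Archimedean2 by blast
      have "tr P (t + (s \<circ> r) k) \<in> S" if "k \<ge> k0" for k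
      proof -
        have "k0 \<le> r k" using seq_suble[OF r(1), of k] that by simp
        then show ?thesis using in_S[of "r k"] k0 P(2) by (simp add: tr_tr)
      qed
      then show ?thesis by (auto simp: eventually_sequentially)
    qed
    then have "tr P (t + a) \<in> S"
      by (rule tile_occurrence_limit[OF S P(1)]) (intro tendsto_intros r(2))
    then show ?thesis by (simp add: P(2) tr_tr)
  qed
  then show ?thesis by blast
qed

text \<open>If a periodic tile comes near the test point \<open>q\<close>, it overlaps any copy of
  \<open>P\<close> placed in \<open>D\<close> and therefore equals it. So nonperiodic occurrences
  lie where no periodic tile is near \<open>q\<close>, and averaging over a fundamental domain
  bounds the measure of that event.\<close>

lemma nonperiodic_occurrences_bound:
  fixes B :: "real^'n \<Rightarrow> real^'n"
  assumes P: "P \<in> A" and D: "D \<in> basis" and lin: "linear B" and bij: "bij B"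
    and Z [measurable]: "Z \<in> sets borel" and Zper: "\<And>z k. k \<in> Zvec \<Longrightarrow> z + B k \<in> Z \<longleftrightarrow> z \<in> Z"
    and Zsupp: "\<And>z. z \<in> Z \<Longrightarrow> \<exists>T. (\<forall>k\<in>Zvec. tr T (B k) \<in> Tl) \<and> z \<in> supp T"
  shows "emeasure \<mu> (occ P D {0} - occ P D (B ` Zvec)) \<le> emeasure cube_measure {x. B x \<notin> Z}"
proof (cases "D = {}")
  case True
  then show ?thesis by (simp add: occ_def)
next
  case False
  then obtain c where c: "c \<in> D" by blast
  define q where "q = ctr P + c"
  let ?L = "B ` Zvec"
  have L: "countable ?L" "0 \<in> ?L" using countable_Zvec zero_Zvec linear_0[OF lin] by (auto simp: image_iff)
  \<comment> \<open>Closeness to \<open>q\<close>, instead of covering \<open>q\<close>, keeps this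
    set open, as the measurability of \<open>G\<close> demands; within \<open>rad\<close> it still
    forces overlap.\<close>
  define V where "V P' = (\<Union>z\<in>supp P'. ball (q - z) rad)" for P' :: "('n, 'l) tile"
  define G where "G = (\<Union>P'\<in>A. occ P' (V P') ?L)"
  have V: "t \<in> V P' \<longleftrightarrow> supp (tr P' t) \<inter> ball q rad \<noteq> {}" for P' t
  proof -
    have dd: "dist (q - z) t = dist q (z + t)" for z by (simp add: dist_norm algebra_simps)
    have "t \<in> V P' \<longleftrightarrow> (\<exists>z\<in>supp P'. dist q (z + t) < rad)" by (simp add: V_def dd)
    also have "\<dots> \<longleftrightarrow> (\<exists>w. w - t \<in> supp P' \<and> dist q w < rad)"
      by (metis add_diff_cancel_right' diff_add_cancel)
    finally show ?thesis by (auto simp: mem_supp_tr)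
  qed
  have G [measurable]: "G \<in> sets \<mu>"
    unfolding G_def V_def using finA L by (intro sets.finite_UN occ_countable_sets) auto
  have [measurable]: "X \<in> sets \<mu>" using space_mu sets.top by metis
  have [measurable]: "B \<in> borel_measurable borel"
    by (rule linear_borel_measurable[OF lin])
  have sub: "occ P D {0} - occ P D ?L \<subseteq> X - G"
  proof
    fix S assume S: "S \<in> occ P D {0} - occ P D ?L"
    then obtain t where t: "S \<in> X" "t \<in> D" "tr P t \<in> S" by (auto simp: occ_def)
    have "S \<notin> G"
    proof
      assume "S \<in> G"
      then obtain P' t' where P': "P' \<in> A" "t' \<in> V P'" "\<And>k. k \<in> Zvec \<Longrightarrow> tr P' (t' + B k) \<in> S"
        by (auto simp: G_def occ_def)
      then obtain z where z: "z \<in> supp (tr P' t')" "dist q z < rad" using V by auto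
      have "dist (ctr P + t) z \<le> dist (ctr P + t) q + dist q z" by (rule dist_triangle)
      also have "dist (ctr P + t) q = dist t c" by (simp add: q_def)
      finally have "dist (ctr P + t) z < 2 * rad" using basis_small[OF D t(2) c] z(2) by simp
      then have "z \<in> interior (supp (tr P t))" by (rule ctr_interior[OF P])
      moreover have "tr P' t' \<in> S" using P'(3)[OF zero_Zvec] linear_0[OF lin] by simp
      ultimately have "tr P t = tr P' t'"
        using A_patch_overlap[OF A_patch_hull[OF t(1)] t(3), of "tr P' t'" z] z(1) neA[OF P'(1)] by simp
      then have "tr P (t + v) = tr P' (t' + v)" for v by (metis tr_tr)
      then have "\<forall>v\<in>?L. tr P (t + v) \<in> S" using P'(3) by auto
      then have "S \<in> occ P D ?L" using t unfolding occ_def by blast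
      then show False using S by blast
    qed
    then show "S \<in> X - G" using t by blast
  qed
  interpret C: prob_space "cube_measure :: (real^'n) measure" by (rule prob_space_cube_measure)
  interpret F: pair_sigma_finite \<mu> "cube_measure :: (real^'n) measure" ..
  have BZ: "{x. B x \<notin> Z} \<in> sets borel"
  proof -
    have "B -` (- Z) \<inter> space borel \<in> sets borel"
      by (rule measurable_sets[OF linear_borel_measurable[OF lin] borel_comp[OF Z]])
    also have "B -` (- Z) \<inter> space borel = {x. B x \<notin> Z}" by auto
    finally show ?thesis .
  qed
  define \<theta> where "\<theta> = emeasure cube_measure {x. B x \<notin> Z}"
  \<comment> \<open>Invariance allows averaging over translations by \<open>B x\<close> with x in
    the cube; after exchanging the integrals, a single hull element is examined.\<close>
  have "emeasure \<mu> (X - G) = (\<integral>\<^sup>+x. emeasure \<mu> (X - G) \<partial>(cube_measure :: (real^'n) measure))"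
    using C.emeasure_space_1 by simp
  also have "\<dots> = (\<integral>\<^sup>+x. \<integral>\<^sup>+S. indicator (X - G) (tr_patch S (- B x)) \<partial>\<mu> \<partial>cube_measure)"
  proof (rule nn_integral_cong)
    fix x :: "real^'n"
    have "emeasure \<mu> (X - G) = emeasure \<mu> {S\<in>space \<mu>. tr_patch S (- B x) \<in> X - G}"
      by (rule flow.emeasure_flow[symmetric]) measurable
    also have "\<dots> = (\<integral>\<^sup>+S. indicator {S\<in>space \<mu>. tr_patch S (- B x) \<in> X - G} S \<partial>\<mu>)"
      by (rule nn_integral_indicator[symmetric]) measurable
    also have "\<dots> = (\<integral>\<^sup>+S. indicator (X - G) (tr_patch S (- B x)) \<partial>\<mu>)"
      by (intro nn_integral_cong) (auto simp: indicator_def)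
    finally show "emeasure \<mu> (X - G) = (\<integral>\<^sup>+S. indicator (X - G) (tr_patch S (- B x)) \<partial>\<mu>)" .
  qed
  also have "\<dots> = (\<integral>\<^sup>+S. \<integral>\<^sup>+x. indicator (X - G) (tr_patch S (- B x)) \<partial>cube_measure \<partial>\<mu>)"
  proof (rule F.Fubini')
    have "(\<lambda>p. (B (snd p), fst p)) \<in> \<mu> \<Otimes>\<^sub>M cube_measure \<rightarrow>\<^sub>M borel \<Otimes>\<^sub>M \<mu>"
    proof (rule measurable_Pair[OF measurable_compose[OF measurable_snd] measurable_fst])
      show "B \<in> cube_measure \<rightarrow>\<^sub>M borel"
        using linear_borel_measurable[OF lin] measurable_cong_sets[OF sets_cube_measure refl] by blast
    qed
    note measurable_compose[OF this flow.joint]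
    then have m: "(\<lambda>p. tr_patch (fst p) (- B (snd p))) \<in> \<mu> \<Otimes>\<^sub>M cube_measure \<rightarrow>\<^sub>M \<mu>"
      by (simp only: prod.case)
    have XG: "X - G \<in> sets \<mu>" by (intro sets.Diff G) (metis space_mu sets.top)
    show "(\<lambda>(S, x). indicator (X - G) (tr_patch S (- B x)) :: ennreal)
        \<in> borel_measurable (\<mu> \<Otimes>\<^sub>M cube_measure)"
      unfolding case_prod_beta by (rule measurable_compose[OF m borel_measurable_indicator[OF XG]])
  qed
  also have "\<dots> \<le> (\<integral>\<^sup>+S. \<theta> \<partial>\<mu>)"
  proof (rule nn_integral_mono)
    fix S assume "S \<in> space \<mu>"
    then have S: "S \<in> X" by (simp add: space_mu)
    obtain s where s: "\<And>T. (\<forall>k\<in>Zvec. tr T (B k) \<in> Tl) \<Longrightarrow> tr T s \<in> S"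
      using periodic_part_in_hull[OF S lin bij] by blast
    define z where "z = inv B (q - s)"
    have Bz: "B z = q - s" using bij by (simp add: z_def bij_is_surj surj_f_inv_f)
    \<comment> \<open>In \<open>S\<close> the periodic tiles appear moved by \<open>s\<close>, so
      after translation by \<open>- B x\<close> one of them covers \<open>q\<close> as soon as
      \<open>B x + q - s\<close> lies in \<open>Z\<close>.\<close>
    have good: "tr_patch S (- B x) \<in> G" if "B (x + z) \<in> Z" for x
    proof -
      obtain T where T: "\<forall>k\<in>Zvec. tr T (B k) \<in> Tl" "B (x + z) \<in> supp T" using Zsupp[OF \<open>B (x + z) \<in> Z\<close>] by blast
      have "T \<in> Tl" using T(1) zero_Zvec linear_0[OF lin] by force
      then obtain P' t where P': "P' \<in> A" "T = tr P' t" using TlA by blast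
      define t' where "t' = t + s - B x"
      have "tr P' (t' + B k) \<in> tr_patch S (- B x)" if k: "k \<in> Zvec" for k
      proof -
        have "\<forall>l\<in>Zvec. tr (tr T (B k)) (B l) \<in> Tl"
          using T(1) Zvec_add[OF k] by (simp add: tr_tr linear_add[OF lin, symmetric])
        from s[OF this] have "tr T (B k + s) \<in> S" by (simp add: tr_tr)
        then show ?thesis by (simp add: mem_tr_patch P' tr_tr t'_def algebra_simps)
      qed
      moreover have "q \<in> supp (tr P' t')"
        using T(2) by (simp add: P' mem_supp_tr t'_def linear_add[OF lin] Bz algebra_simps)
      then have "t' \<in> V P'" using V rad_pos centre_in_ball by blast
      ultimately show ?thesis using P'(1) hull_translate[OF S] by (auto simp: G_def occ_def)
    qed
    have "(\<integral>\<^sup>+x. indicator (X - G) (tr_patch S (- B x)) \<partial>cube_measure)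
        \<le> (\<integral>\<^sup>+x. indicator {x. B x \<notin> Z} (x + z) \<partial>cube_measure)"
      using good by (intro nn_integral_mono) (auto split: split_indicator)
    also have "\<dots> = (\<integral>\<^sup>+x. indicator {x. B x \<notin> Z} x \<partial>cube_measure)"
      by (rule nn_integral_cube_shift[OF borel_measurable_indicator[OF BZ]])
        (simp add: linear_add[OF lin] Zper indicator_def)
    also have "\<dots> = \<theta>"
      unfolding \<theta>_def by (rule nn_integral_indicator) (simp only: sets_cube_measure BZ)
    finally show "(\<integral>\<^sup>+x. indicator (X - G) (tr_patch S (- B x)) \<partial>cube_measure) \<le> \<theta>" .
  qed
  also have "\<dots> = \<theta>" using flow.emeasure_space_1 by simp
  finally show ?thesis
    using order_trans[OF emeasure_mono[OF sub]] unfolding \<theta>_def by simp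
qed

end

section \<open>Tilings containing a lattice of tiles\<close>

text \<open>The empty set passes as a tile. Substituting an empty prototile yields empty tiles only,
  so every power of the matrix has entry 0 from an empty to a nonempty prototile, against
  primitivity.\<close>

lemma primitive_supp_nonempty:
  assumes sr: "subst_rule A Q \<omega>" and prim: "primitive_subst A \<omega>"
    and P: "P \<in> A" "supp P \<noteq> {}" and P': "P' \<in> A"
  shows "supp P' \<noteq> {}"
proof
  assume empty: "supp P' = {}"
  have zero: "subst_matrix A \<omega> P1 P2 = 0" if "supp P1 \<noteq> {}" "P2 \<in> A" "supp P2 = {}" for P1 P2
  proof -
    have "patch_supp (\<omega> P2) = {}" using sr that by (simp add: subst_rule_def)
    then have "(\<Union>T\<in>\<omega> P2. supp T) = {}" unfolding patch_supp_def by simp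
    then have "supp T = {}" if "T \<in> \<omega> P2" for T using that by blast
    moreover have "supp (tr P1 x) \<noteq> {}" for x using that(1) by simp
    ultimately have "{T\<in>\<omega> P2. \<exists>x. T = tr P1 x} = {}" by blast
    then show ?thesis unfolding subst_matrix_def by (metis card.empty)
  qed
  have "mat_pow A (subst_matrix A \<omega>) k P1 P' = 0" if "supp P1 \<noteq> {}" for k P1
    using that
  proof (induction k arbitrary: P1)
    case 0
    then show ?case using empty by auto
  next
    case (Suc k)
    have "subst_matrix A \<omega> P1 l * mat_pow A (subst_matrix A \<omega>) k l P' = 0" if "l \<in> A" for l
      using Suc.IH[of l] zero[OF Suc.prems that] by (cases "supp l = {}") simp_all
    then have "(\<Sum>l\<in>A. subst_matrix A \<omega> P1 l * mat_pow A (subst_matrix A \<omega>) k l P') = 0"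
      by (rule sum.neutral[OF ballI])
    then show ?case by simp
  qed
  then show False using prim P P' unfolding primitive_subst_def by (metis less_irrefl)
qed

section \<open>Supertiles of the lattice of tiles\<close>

locale lattice_self_affine = tiling_system A Tl \<mu>
  for A :: "('n::finite, 'l) tile set" and Tl \<mu> +
  fixes Q :: "real^'n \<Rightarrow> real^'n" and \<omega> T0 and B :: "real^'n \<Rightarrow> real^'n"
  assumes rule: "subst_rule A Q \<omega>" and fixed: "subst_patch A Q \<omega> Tl = Tl"
    and linB: "linear B" and bijB: "bij B"
    and T0: "\<And>k. k \<in> Zvec \<Longrightarrow> tr T0 (B k) \<in> Tl" and QL: "Q ` B ` Zvec \<subseteq> B ` Zvec"
begin

lemma expQ: "expansive Q" and linQ: "linear Q" and bijQ: "bij Q"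
  using rule expansive_bij by (auto simp: subst_rule_def expansive_def)

lemma lin_inv: "linear (inv Q)" "linear (inv B)"
  using inj_linear_imp_inv_linear linQ linB bijQ bijB bij_is_inj by blast+

lemma linear_funpow: "linear f \<Longrightarrow> linear (f ^^ n)" for f :: "real^'n \<Rightarrow> real^'n"
proof (induction n)
  case (Suc n)
  show ?case using linear_compose[OF Suc.IH[OF Suc.prems] Suc.prems] by (simp add: o_def)
qed (simp add: linear_id id_def[symmetric])

lemma inv_Q_funpow: "i \<le> n \<Longrightarrow> (inv Q ^^ i) ((Q ^^ n) x) = (Q ^^ (n - i)) x"
proof (induction i)
  case (Suc i)
  then have "(inv Q ^^ Suc i) ((Q ^^ n) x) = inv Q ((Q ^^ Suc (n - Suc i)) x)" by (simp add: Suc_diff_Suc)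
  then show ?case using bijQ by (simp add: bij_is_inj)
qed simp

lemma Q_inv_funpow: "(Q ^^ i) ((inv Q ^^ i) z) = z"
proof (induction i arbitrary: z)
  case (Suc i)
  have "(Q ^^ Suc i) ((inv Q ^^ Suc i) z) = (Q ^^ i) (Q (inv Q ((inv Q ^^ i) z)))"
    by (simp only: funpow_Suc_right o_apply funpow.simps(2)) (metis funpow_swap1)
  then show ?case using Suc bijQ by (simp add: bij_is_surj surj_f_inv_f)
qed simp

text \<open>Coordinates adapted to the n-th period lattice: integer points parametrise it, and the
  unit cube parametrises a fundamental domain.\<close>

definition BQ :: "nat \<Rightarrow> real^'n \<Rightarrow> real^'n" where "BQ n x = (Q ^^ n) (B x)"

lemma linear_BQ: "linear (BQ n)" and bij_BQ: "bij (BQ n)"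
proof -
  have "BQ n = (Q ^^ n) \<circ> B" by (simp add: BQ_def fun_eq_iff)
  then show "linear (BQ n)" "bij (BQ n)"
    using linear_compose[OF linB linear_funpow[OF linQ, of n]] bij_comp[OF bijB bij_fn[OF bijQ]] by auto
qed

definition lat :: "nat \<Rightarrow> (real^'n) set" where "lat n = BQ n ` Zvec"

lemma countable_lat: "countable (lat n)" and zero_lat: "0 \<in> lat n"
  using countable_Zvec zero_Zvec linear_0[OF linear_BQ] by (auto simp: lat_def image_iff intro!: bexI[of _ 0])

lemma lat_eq: "lat n = (Q ^^ n) ` B ` Zvec"
  by (simp add: lat_def BQ_def image_image)

lemma decseq_lat: "decseq lat"
proof (rule decseq_SucI)
  fix n
  have "lat (Suc n) = (Q ^^ n) ` Q ` B ` Zvec"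
    unfolding lat_eq funpow_Suc_right by (simp add: image_comp o_assoc)
  then show "lat (Suc n) \<subseteq> lat n" unfolding lat_eq using QL by blast
qed

lemma lat_subset: "lat n \<subseteq> B ` Zvec"
  using decseqD[OF decseq_lat, of 0 n] by (simp add: lat_eq)

definition periodic_tile :: "nat \<Rightarrow> ('n, 'l) tile \<Rightarrow> bool" where
  "periodic_tile n T \<longleftrightarrow> (\<forall>v\<in>lat n. tr T v \<in> Tl)"

lemma periodic_tile_T0:
  assumes "u \<in> B ` Zvec"
  shows "periodic_tile n (tr T0 u)"
  unfolding periodic_tile_def
proof
  fix v assume "v \<in> lat n"
  then obtain k l where "k \<in> Zvec" "l \<in> Zvec" "u = B k" "v = B l" using assms lat_subset by blast
  then show "tr (tr T0 u) v \<in> Tl" using T0[OF Zvec_add, of k l] by (simp add: tr_tr linear_add[OF linB])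
qed

text \<open>The tiling is its own substitution, and translates of \<open>T\<close> by
  \<open>v\<close> have substitutions translated by \<open>Q v\<close>; so each tile of the
  substituted \<open>T\<close> inherits the periods \<open>Q v\<close>.\<close>

lemma periodic_tile_subst:
  assumes T: "periodic_tile n T" and z: "z \<in> supp T"
  shows "\<exists>T'. periodic_tile (Suc n) T' \<and> Q z \<in> supp T'"
proof -
  have "T \<in> Tl" using T zero_lat[of n] unfolding periodic_tile_def by (metis tr_0)
  then obtain P x where P: "P \<in> A" "T = tr P x" using TlA by blast
  have w: "finite (\<omega> P)" "is_patch (\<omega> P)" "patch_supp (\<omega> P) = Q ` supp P"
    using rule P(1) by (auto simp: subst_rule_def)
  have "closed (\<Union>U\<in>\<omega> P. supp U)"
    using w(1,2) by (intro closed_UN) (auto simp: is_patch_def is_tile_def compact_imp_closed)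
  then have "(\<Union>U\<in>\<omega> P. supp U) = Q ` supp P" using w(3) by (simp add: patch_supp_def)
  moreover have "z - x \<in> supp P" using z by (simp add: P mem_supp_tr)
  ultimately obtain U where U: "U \<in> \<omega> P" "Q (z - x) \<in> supp U" by blast
  have "tr (tr U (Q x)) v \<in> Tl" if "v \<in> lat (Suc n)" for v
  proof -
    obtain v' where v': "v' \<in> lat n" "v = Q v'" using \<open>v \<in> lat (Suc n)\<close> by (auto simp: lat_eq image_image)
    have "tr T v' \<in> Tl" using T v' by (simp add: periodic_tile_def)
    moreover have "tr U (Q (x + v')) \<in> subst_tile A Q \<omega> (tr T v')"
      unfolding subst_tile_def P tr_tr using P(1) U(1) by (auto simp: tr_patch_def)
    ultimately have "tr U (Q (x + v')) \<in> subst_patch A Q \<omega> Tl" unfolding subst_patch_def by blast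
    then show ?thesis by (simp add: fixed tr_tr v' linear_add[OF linQ])
  qed
  moreover have "Q z \<in> supp (tr U (Q x))" using U(2) by (simp add: mem_supp_tr linear_diff[OF linQ])
  ultimately show ?thesis unfolding periodic_tile_def by blast
qed

lemma periodic_tile_subst_funpow:
  assumes "periodic_tile n T" "z \<in> supp T"
  shows "\<exists>T'. periodic_tile (n + i) T' \<and> (Q ^^ i) z \<in> supp T'"
proof (induction i)
  case 0
  then show ?case using assms by (intro exI[of _ T]) simp
next
  case (Suc i)
  then obtain T' where "periodic_tile (n + i) T'" "(Q ^^ i) z \<in> supp T'" by blast
  from periodic_tile_subst[OF this] show ?case by simp
qed

definition W0 :: "(real^'n) set" where "W0 = (\<Union>u\<in>B ` Zvec. supp (tr T0 u))"

lemma T0_Tl: "T0 \<in> Tl"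
  using T0[OF zero_Zvec] linear_0[OF linB] by simp

lemma W0_borel: "W0 \<in> sets borel"
  unfolding W0_def
proof (rule sets.countable_UN'')
  show "countable (B ` Zvec)" by (simp add: countable_Zvec)
  fix u assume "u \<in> B ` Zvec"
  then have "tr T0 u \<in> Tl" using T0 by auto
  then have "compact (supp (tr T0 u))" using Tl by (auto simp: is_tiling_def is_patch_def is_tile_def)
  then show "supp (tr T0 u) \<in> sets borel" by (simp add: borel_compact)
qed

lemma W0_periodic: "u \<in> B ` Zvec \<Longrightarrow> x + u \<in> W0 \<longleftrightarrow> x \<in> W0"
proof -
  have *: "x + u \<in> W0" if "u \<in> B ` Zvec" "x \<in> W0" for x u
  proof -
    obtain k l where kl: "k \<in> Zvec" "l \<in> Zvec" "u = B k" "x \<in> supp (tr T0 (B l))" using \<open>u \<in> B ` Zvec\<close> \<open>x \<in> W0\<close> by (auto simp: W0_def)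
    then have "x + u \<in> supp (tr T0 (B (l + k)))" by (simp add: mem_supp_tr linear_add[OF linB])
    then show ?thesis using Zvec_add[OF kl(2,1)] by (auto simp: W0_def)
  qed
  assume u: "u \<in> B ` Zvec"
  then have "- u \<in> B ` Zvec" using Zvec_uminus by (force simp: linear_neg[OF linB, symmetric])
  then show ?thesis using *[OF u, of x] *[of "- u" "x + u"] by auto
qed

text \<open>The union of the images of \<open>W0\<close> under the first n + 1 powers of
  \<open>Q\<close>, that is, the region covered by supertiles of level at most n over
  \<open>T0 + L\<close>.\<close>

definition Z :: "nat \<Rightarrow> (real^'n) set" where "Z n = {z. \<exists>i\<le>n. (inv Q ^^ i) z \<in> W0}"

lemma Z_borel: "Z n \<in> sets borel"
proof -
  have "Z n = (\<Union>i\<le>n. (inv Q ^^ i) -` W0 \<inter> space borel)" by (auto simp: Z_def)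
  moreover have "(inv Q ^^ i) -` W0 \<inter> space borel \<in> sets borel" for i
    by (rule measurable_sets[OF linear_borel_measurable[OF linear_funpow[OF lin_inv(1)]] W0_borel])
  ultimately show ?thesis by auto
qed

text \<open>The i-th power of \<open>inv Q\<close> carries \<open>lat n\<close> to
  \<open>lat (n - i)\<close>, which still consists of periods of \<open>W0\<close>.\<close>

lemma Z_periodic: "k \<in> Zvec \<Longrightarrow> z + BQ n k \<in> Z n \<longleftrightarrow> z \<in> Z n"
proof -
  assume k: "k \<in> Zvec"
  have "(inv Q ^^ i) (z + BQ n k) \<in> W0 \<longleftrightarrow> (inv Q ^^ i) z \<in> W0" if "i \<le> n" for i
  proof -
    have "(inv Q ^^ i) (BQ n k) = BQ (n - i) k" using inv_Q_funpow[OF that] by (simp add: BQ_def)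
    moreover have "BQ (n - i) k \<in> B ` Zvec" using lat_subset[of "n - i"] k by (auto simp: lat_def)
    ultimately show ?thesis using W0_periodic by (simp add: linear_add[OF linear_funpow[OF lin_inv(1)]])
  qed
  then show ?thesis by (auto simp: Z_def)
qed

lemma Z_supp:
  assumes "z \<in> Z n"
  shows "\<exists>T. (\<forall>k\<in>Zvec. tr T (BQ n k) \<in> Tl) \<and> z \<in> supp T"
proof -
  obtain i u where i: "i \<le> n" "u \<in> B ` Zvec" "(inv Q ^^ i) z \<in> supp (tr T0 u)"
    using assms by (auto simp: Z_def W0_def)
  \<comment> \<open>The start is at level \<open>n - i\<close>, so that \<open>i\<close>
    substitutions end exactly at level \<open>n\<close>.\<close>
  from periodic_tile_subst_funpow[OF periodic_tile_T0[OF i(2), of "n - i"] i(3), of i]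
  obtain T where "periodic_tile n T" "z \<in> supp T" using i(1) by (auto simp: Q_inv_funpow)
  then show ?thesis by (intro exI[of _ T]) (simp add: periodic_tile_def lat_def)
qed

text \<open>Conjugating \<open>Q\<close> by \<open>B\<close> moves the question to the standard
  torus, where \<open>contracted_copies_exhaust\<close> applies; continuity from above for a
  decreasing sequence gives the limit.\<close>

lemma exceptional_set_tendsto_0:
  "(\<lambda>n. emeasure cube_measure {x. BQ n x \<notin> Z n}) \<longlonglongrightarrow> 0"
proof -
  define W where "W = {x. B x \<in> W0}"
  define f where "f n x = inv B ((Q ^^ n) (B x))" for n x
  define g where "g n x = inv B ((inv Q ^^ n) (B x))" for n x
  have BinvB: "B (inv B x) = x" "inv B (B x) = x" for x
    using bijB by (auto simp: bij_is_surj surj_f_inv_f bij_is_inj)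
  have lf: "linear (f n)" "linear (g n)" for n
    unfolding f_def g_def
    using linear_compose[OF linear_compose[OF linB linear_funpow[OF linQ, of n]] lin_inv(2)]
      linear_compose[OF linear_compose[OF linB linear_funpow[OF lin_inv(1), of n]] lin_inv(2)]
    by (simp_all add: o_def)
  have W: "W \<in> sets borel"
  proof -
    have "B -` W0 \<inter> space borel \<in> sets borel"
      by (rule measurable_sets[OF linear_borel_measurable[OF linB] W0_borel])
    also have "B -` W0 \<inter> space borel = W" by (auto simp: W_def)
    finally show ?thesis .
  qed
  have Wper: "x + k \<in> W \<longleftrightarrow> x \<in> W" if "k \<in> Zvec" for x k
    using W0_periodic[of "B k" "B x"] that by (simp add: W_def linear_add[OF linB])
  have pos: "emeasure lborel (unit_cube \<inter> W) > 0"
  proof (rule periodic_open_cube_pos[OF W Wper])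
    have T: "is_tile T0" "supp T0 \<noteq> {}"
    proof -
      obtain P x where "P \<in> A" "T0 = tr P x" using TlA[OF T0_Tl] by blast
      then show "is_tile T0" "supp T0 \<noteq> {}" using is_tile_tr[OF tileA] neA by simp_all
    qed
    have "continuous_on UNIV B" using linB by (simp add: linear_continuous_on linear_conv_bounded_linear)
    then show "open (B -` interior (supp T0))" by (simp add: open_vimage)
    show "B -` interior (supp T0) \<noteq> {}"
      using is_tile_interior_nonempty[OF T] BinvB(1) by (metis ex_in_conv vimageI)
    have "supp T0 \<subseteq> W0" unfolding W0_def
    proof
      fix x assume "x \<in> supp T0"
      then show "x \<in> (\<Union>u\<in>B ` Zvec. supp (tr T0 u))"
        using zero_Zvec linear_0[OF linB] by (auto intro!: bexI[of _ 0])
    qed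
    then show "B -` interior (supp T0) \<subseteq> W" using interior_subset by (auto simp: W_def)
  qed
  have null: "emeasure lborel (unit_cube - (\<Union>n. f n -` W)) = 0"
  proof (rule contracted_copies_exhaust[OF W _ pos lf(1) _ _ lf(2)])
    show "x + k \<in> W" if "x \<in> W" "k \<in> Zvec" for x k using Wper that by blast
    show "f n (g n y) = y" for n y by (simp add: f_def g_def BinvB Q_inv_funpow)
    show "(\<lambda>n. g n y) \<longlonglongrightarrow> 0" for y
    proof -
      have "isCont (inv B) 0" using lin_inv(2) by (simp add: linear_continuous_at linear_conv_bounded_linear)
      from isCont_tendsto_compose[OF this expansive_inverse_orbit_tendsto_0[OF expQ, of "B y"]]
      show ?thesis using linear_0[OF lin_inv(2)] by (simp add: g_def)
    qed
  qed
  define E where "E n = {x. BQ n x \<notin> Z n}" for n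
  \<comment> \<open>With j = n - i the single conditions no longer depend on \<open>n\<close>, so
    the sets decrease.\<close>
  have Eeq: "E n = {x. \<forall>j\<le>n. x \<notin> f j -` W}" for n
  proof -
    have "BQ n x \<in> Z n \<longleftrightarrow> (\<exists>j\<le>n. x \<in> f j -` W)" for x
    proof -
      have "BQ n x \<in> Z n \<longleftrightarrow> (\<exists>i\<le>n. (Q ^^ (n - i)) (B x) \<in> W0)"
        unfolding Z_def BQ_def using inv_Q_funpow by auto
      also have "\<dots> \<longleftrightarrow> (\<exists>j\<le>n. (Q ^^ j) (B x) \<in> W0)" by (metis diff_diff_cancel diff_le_self)
      finally show ?thesis by (simp add: W_def f_def BinvB)
    qed
    then show ?thesis by (auto simp: E_def)
  qed
  have Esets: "E n \<in> sets borel" for n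
  proof -
    have "BQ n -` (- Z n) \<inter> space borel \<in> sets borel"
      by (rule measurable_sets[OF linear_borel_measurable[OF linear_BQ] borel_comp[OF Z_borel]])
    also have "BQ n -` (- Z n) \<inter> space borel = E n" by (auto simp: E_def)
    finally show ?thesis .
  qed
  interpret C: prob_space "cube_measure :: (real^'n) measure" by (rule prob_space_cube_measure)
  have "(\<lambda>n. emeasure cube_measure (E n)) \<longlonglongrightarrow> emeasure cube_measure (\<Inter>n. E n)"
  proof (rule Lim_emeasure_decseq)
    show "range E \<subseteq> sets cube_measure" using Esets by auto
    show "decseq E" by (rule decseq_SucI) (auto simp: Eeq)
    show "emeasure cube_measure (E n) \<noteq> \<infinity>" for n using C.emeasure_finite by simp
  qed
  moreover have "emeasure cube_measure (\<Inter>n. E n) = 0"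
  proof -
    have "(\<Inter>n. E n) = - (\<Union>n. f n -` W)" by (auto simp: Eeq)
    moreover have "(\<Inter>n. E n) \<in> sets borel" using Esets by auto
    ultimately show ?thesis using null by (simp add: emeasure_cube_measure Diff_eq)
  qed
  ultimately show ?thesis by (simp add: E_def)
qed

lemma nonperiodic_occurrences_null:
  assumes "P \<in> A" "D \<in> basis"
  shows "(\<lambda>n. measure \<mu> (occ P D {0} - occ P D (lat n))) \<longlonglongrightarrow> 0"
proof -
  interpret C: prob_space "cube_measure :: (real^'n) measure" by (rule prob_space_cube_measure)
  have "emeasure \<mu> (occ P D {0} - occ P D (lat n)) \<le> emeasure cube_measure {x. BQ n x \<notin> Z n}" for n
    unfolding lat_def
    by (rule nonperiodic_occurrences_bound[OF assms linear_BQ bij_BQ Z_borel Z_periodic Z_supp])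
  then have le: "measure \<mu> (occ P D {0} - occ P D (lat n)) \<le> measure cube_measure {x. BQ n x \<notin> Z n}" for n
    unfolding flow.emeasure_eq_measure C.emeasure_eq_measure by simp
  have "(\<lambda>n. measure cube_measure {x. BQ n x \<notin> Z n}) \<longlonglongrightarrow> 0"
    using exceptional_set_tendsto_0 unfolding C.emeasure_eq_measure
    by (simp add: ennreal_tendsto_0_iff)
  then show ?thesis by (rule tendsto_sandwich[OF _ _ tendsto_const, rotated 2]) (use le in auto)
qed

lemma eigenfunction_of_eigen_everywhere:
  assumes f: "flow.eigen_everywhere a f" and norm: "L2_inner \<mu> f f = 1"
  shows "eigenfunction \<mu> a f"
  unfolding eigenfunction_def
proof (intro conjI allI notI)
  show "L2 \<mu> f" using f by (intro flow.L2_bounded_on_space) (simp add: flow.eigen_everywhere_def)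
  show False if "AE S in \<mu>. f S = 0"
  proof -
    have "AE S in \<mu>. f S * cnj (f S) = 0" using that by eventually_elim simp
    then have "L2_inner \<mu> f f = 0" unfolding L2_inner_def by (rule integral_eq_zero_AE)
    then show False using norm by simp
  qed
  show "AE S in \<mu>. f (tr_patch S (- x)) = exp (\<i> * complex_of_real (2 * pi * (x \<bullet> a))) * f S" for x
    using f by (intro AE_I2) (simp add: flow.eigen_everywhere_def char_fun_def cis_conv_exp)
qed

theorem pure_discrete: "pure_discrete_spectrum \<mu>"
proof -
  \<comment> \<open>Each periodic cylinder is paired with the coordinate map of its own period
    lattice, which fixes the frequencies of its Fourier coefficients.\<close>
  define \<V> where "\<V> = (\<lambda>(K, n). (cyl K (lat n), BQ n)) ` (indices \<times> UNIV)"
  have "\<exists>B. (\<forall>f\<in>B. \<exists>a. flow.eigen_everywhere a f) \<and> (\<forall>f\<in>B. L2_inner \<mu> f f = 1) \<and>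
    (\<forall>f\<in>B. \<forall>g\<in>B. f \<noteq> g \<longrightarrow> L2_inner \<mu> f g = 0) \<and>
    (\<forall>g. L2 \<mu> g \<and> (\<forall>f\<in>B. L2_inner \<mu> g f = 0) \<longrightarrow> (AE S in \<mu>. g S = 0))"
  proof (rule flow.periodic_sets_eigenbasis[of \<V>])
    show "countable \<V>" unfolding \<V>_def using countable_indices by simp
    have "{} \<in> indices" by (simp add: indices_def)
    then show "\<V> \<noteq> {}" unfolding \<V>_def by blast
    fix V b assume "(V, b) \<in> \<V>"
    then obtain K n where K: "K \<in> indices" "V = cyl K (lat n)" "b = BQ n" by (auto simp: \<V>_def)
    show "V \<in> sets \<mu> \<and> linear b \<and> bij b \<and> flow.periodic_set b V \<and> flow.orbitwise_open V"
      unfolding K(2,3) using cyl_sets[OF K(1) countable_lat zero_lat] linear_BQ bij_BQ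
        periodic_cyl[OF linear_BQ, of n K] orbitwise_open_cyl[OF K(1), of "lat n"]
      by (simp add: lat_def)
  next
    fix g assume g: "L2 \<mu> g" and zero: "\<And>V b. (V, b) \<in> \<V> \<Longrightarrow> (LINT S|\<mu>. g S * indicator V S) = 0"
    show "AE S in \<mu>. g S = 0"
    proof (rule integral_all_sets_eq_0[OF countable_lat zero_lat decseq_lat nonperiodic_occurrences_null g])
      fix K n assume "K \<in> indices"
      then have "(cyl K (lat n), BQ n) \<in> \<V>" by (auto simp: \<V>_def)
      then show "(LINT S|\<mu>. g S * indicator (cyl K (lat n)) S) = 0" by (rule zero)
    qed
  qed
  then obtain E where E: "\<forall>f\<in>E. \<exists>a. flow.eigen_everywhere a f" "\<forall>f\<in>E. L2_inner \<mu> f f = 1"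
    "\<forall>f\<in>E. \<forall>g\<in>E. f \<noteq> g \<longrightarrow> L2_inner \<mu> f g = 0"
    "\<forall>g. L2 \<mu> g \<and> (\<forall>f\<in>E. L2_inner \<mu> g f = 0) \<longrightarrow> (AE S in \<mu>. g S = 0)"
    by (elim exE conjE)
  have "\<forall>f\<in>E. \<exists>a. eigenfunction \<mu> a f"
    using E(1,2) eigenfunction_of_eigen_everywhere by blast
  then show ?thesis
    unfolding pure_discrete_spectrum_def by (intro exI[of _ E] conjI E(2-4))
qed

end

theorem theorem4p8:
  fixes A :: "('n::finite, 'l) tile set"
    and Q :: "real^'n \<Rightarrow> real^'n"
    and \<omega> :: "('n, 'l) tile \<Rightarrow> ('n, 'l) patch"
    and Tl :: "('n, 'l) patch"
    and T0 :: "('n, 'l) tile"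
    and L :: "(real^'n) set"
    and \<mu> :: "('n, 'l) patch measure"
  assumes "subst_rule A Q \<omega>"
    and "primitive_subst A \<omega>"
    and "FLC_subst A Q \<omega>"
    and "self_affine_tiling A Q \<omega> Tl"
    and "T0 \<in> Tl"
    and "lattice L"
    and "(\<lambda>v. tr T0 v) ` L \<subseteq> Tl"
    and "Q ` L \<subseteq> L"
    and "invariant_hull_measure Tl \<mu>"
  shows "pure_discrete_spectrum \<mu>"
proof -
  have Tl: "is_tiling Tl" "\<And>T. T \<in> Tl \<Longrightarrow> \<exists>P\<in>A. \<exists>x. T = tr P x" "subst_patch A Q \<omega> Tl = Tl" "FLC_tiling Tl"
    using assms(4) by (auto simp: self_affine_tiling_def)
  \<comment> \<open>The tiles fill space, so one of them is nonempty; from its prototile primitivity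
    carries nonemptiness to all prototiles.\<close>
  have "\<exists>T\<in>Tl. supp T \<noteq> {}"
  proof (rule ccontr)
    assume "\<not> (\<exists>T\<in>Tl. supp T \<noteq> {})"
    then have "(\<Union>T\<in>Tl. supp T) = {}" by simp
    then have "patch_supp Tl = {}" unfolding patch_supp_def by simp
    then show False using Tl(1) by (simp add: is_tiling_def)
  qed
  then obtain P where P: "P \<in> A" "supp P \<noteq> {}" using Tl(2) by (metis supp_tr_eq_empty)
  obtain M :: "real^'n^'n" where M: "invertible M" "L = {M *v k | k. \<forall>i. k $ i \<in> \<int>}"
    using assms(6) unfolding lattice_def by blast
  have L: "L = (*v) M ` Zvec" unfolding M(2) Zvec_def by blast
  interpret lattice_self_affine A Tl \<mu> Q \<omega> T0 "(*v) M"
  proof (intro lattice_self_affine.intro tiling_system.intro flc_tiling.intro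
      tiling_system_axioms.intro lattice_self_affine_axioms.intro)
    show "finite A" "\<And>P. P \<in> A \<Longrightarrow> is_tile P" "subst_rule A Q \<omega>"
      using assms(1) by (auto simp: subst_rule_def)
    show "\<And>P'. P' \<in> A \<Longrightarrow> supp P' \<noteq> {}"
      by (rule primitive_supp_nonempty[OF assms(1,2) P])
    show "is_tiling Tl" "subst_patch A Q \<omega> Tl = Tl" "FLC_tiling Tl" "invariant_hull_measure Tl \<mu>"
      by (fact Tl assms)+
    show "\<And>T. T \<in> Tl \<Longrightarrow> \<exists>P\<in>A. \<exists>x. T = tr P x" by (fact Tl(2))
    show "linear ((*v) M)" by (rule matrix_vector_mul_linear)
    show "bij ((*v) M)" using M(1) by (simp only: invertible_eq_bij)
    show "\<And>k. k \<in> Zvec \<Longrightarrow> tr T0 (M *v k) \<in> Tl" using assms(7) unfolding L by blast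
    show "Q ` (*v) M ` Zvec \<subseteq> (*v) M ` Zvec" using assms(8) unfolding L .
  qed
  show ?thesis by (rule pure_discrete)
qed

end
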